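(* Assume that Babenko's equation in the deep-water limit, $$(c^2 K_\infty - 1)\eta - \eta K_\infty \eta - \frac{1}{2} K_\infty(\eta^2) = 0,$$ admits a $2\pi$-periodic solution $\eta \in \mathrm{Dom}(K_\infty) \subset L^2(\mathbb{T})$ with the local behavior $$\eta(u) = \frac{c^2}{2} - A|u|^{2/3} - B|u|^{\mu} + o(|u|^{\mu}) \quad \text{as } u \to 0,$$ where $\mu \in \left(\frac{2}{3}, 2\right)$, for some admissible values of $A > 0$, $B \in \mathbb{R}$, and $c \in \mathbb{R}$. Then $\mu$ is the second root of the transcendental equation $$\left(\mu + \frac{2}{3}\right)\tan\left(\frac{\pi\mu}{2} + \frac{\pi}{3}\right) + \mu\tan\left(\frac{\pi\mu}{2}\right) + \frac{2}{\sqrt{3}} = 0.$$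
   Context: $\mathbb{T}$ denotes the $2\pi$-periodic domain $\mathbb{R}/2\pi\mathbb{Z}$, with coordinate $u$ (represented by $u \in [-\pi,\pi]$), and $\eta$ is real-valued. The operator $K_\infty$ is the linear self-adjoint operator in $L^2(\mathbb{T})$ given by the Fourier multiplier $\widehat{(K_\infty)}_n = |n|$, $n \in \mathbb{Z}$, with domain $\mathrm{Dom}(K_\infty) = \{ f \in L^2(\mathbb{T}) : \sum_{n} n^2 |\hat f_n|^2 < \infty\}$. Equivalently, $K_\infty = -\mathcal{H}\partial_u$, where $\mathcal{H}$ is the periodic Hilbert transform with Fourier symbol $i\,\mathrm{sgn}(n)$ for $n \neq 0$ and $0$ for $n = 0$. It is the limit as $h \to \infty$ (deep-water limit) of the operators $K_h$ with symbol $n\coth(hn)$ for $n \ne 0$ and $0$ for $n = 0$. "Admissible values" of $A$, $B$, $c$ means values for which such a solution exists; they are not determined by the local analysis. Pointwise behavior of $\eta$ refers to its continuous representative. Roots of the transcendental equation are counted among positive $\mu$ in increasing order, the first root being $\mu = \frac{2}{3}$; the second root is found numerically at $\mu \approx 1.469$.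
   Formalization: The formal theorem assumes B ≠ 0 where the statement allows any real B; with B = 0 the expansion does not determine μ (the extreme Stokes wave satisfies it with B = 0 and, for example, μ = 1, which is not a root). *)

theory Defs
  imports "HOL-Analysis.Analysis" "HOL-Library.Landau_Symbols"
begin

text \<open>
  Functions on the circle of length \<open>2 * pi\<close> are \<open>2 * pi\<close>-periodic functions on the real line.
  Elements of \<open>L2_circle\<close> are representatives; equality in the Hilbert space is equality almost
  everywhere. Only real-valued functions are needed, and the multiplier below, being real and
  even, maps real-valued functions to real-valued functions.
\<close>

definition L2_circle :: "(real \<Rightarrow> real) set" where
  "L2_circle = {f. f \<in> borel_measurable borel \<and> (\<forall>u. f (u + 2 * pi) = f u) \<and>
     set_integrable lborel {-pi..pi} (\<lambda>u. (f u)\<^sup>2)}"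

definition fourier_coeff :: "(real \<Rightarrow> real) \<Rightarrow> int \<Rightarrow> complex" where
  "fourier_coeff f n =
     (LINT u:{-pi..pi}|lborel. complex_of_real (f u) * cis (- (of_int n * u)))
       / complex_of_real (2 * pi)"

definition Dom_K :: "(real \<Rightarrow> real) set" where
  "Dom_K = {f \<in> L2_circle.
     (\<lambda>n::int. (of_int n)\<^sup>2 * (cmod (fourier_coeff f n))\<^sup>2) summable_on UNIV}"

text \<open>
  \<open>K_maps f g\<close> says that \<open>f\<close> is in the domain of the multiplier operator with symbol
  \<open>\<bar>n\<bar>\<close> and that \<open>g\<close> represents its image. Such a \<open>g\<close> exists for each \<open>f\<close>
  in \<open>Dom_K\<close> by the Riesz-Fischer theorem, and it is unique up to null sets.
\<close>

definition K_maps :: "(real \<Rightarrow> real) \<Rightarrow> (real \<Rightarrow> real) \<Rightarrow> bool" where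
  "K_maps f g \<longleftrightarrow> f \<in> Dom_K \<and> g \<in> L2_circle \<and>
     (\<forall>n. fourier_coeff g n = of_int \<bar>n\<bar> * fourier_coeff f n)"

text \<open>
  Requiring an image of the square of \<open>\<eta>\<close> is no extra hypothesis: \<open>Dom_K\<close> is the first-order
  Sobolev space of the circle, which is closed under multiplication.
\<close>

definition babenko_solution :: "real \<Rightarrow> (real \<Rightarrow> real) \<Rightarrow> bool" where
  "babenko_solution c \<eta> \<longleftrightarrow> \<eta> \<in> Dom_K \<and>
     (\<exists>K\<eta> K\<eta>2. K_maps \<eta> K\<eta> \<and> K_maps (\<lambda>u. (\<eta> u)\<^sup>2) K\<eta>2 \<and>
       (AE u in lborel. (c\<^sup>2 * K\<eta> u - \<eta> u) - \<eta> u * K\<eta> u - 1 / 2 * K\<eta>2 u = 0))"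

text \<open>
  The two conditions on \<open>cos\<close> exclude the poles of the tangents, where \<open>tan\<close> is \<open>0\<close> by convention.
\<close>

definition exponent_roots :: "real set" where
  "exponent_roots = {\<mu>. \<mu> > 0 \<and> cos (pi * \<mu> / 2 + pi / 3) \<noteq> 0 \<and> cos (pi * \<mu> / 2) \<noteq> 0 \<and>
     (\<mu> + 2 / 3) * tan (pi * \<mu> / 2 + pi / 3) + \<mu> * tan (pi * \<mu> / 2) + 2 / sqrt 3 = 0}"

definition is_second_root :: "real \<Rightarrow> bool" where
  "is_second_root \<mu> \<longleftrightarrow> \<mu> \<in> exponent_roots \<and> card {\<nu> \<in> exponent_roots. \<nu> < \<mu>} = 1"

end

theory Submission
  imports Defs
begin

text \<open>
  Put \<open>\<zeta> = c\<^sup>2 / 2 - \<eta>\<close> and \<open>k = c\<^sup>2 / 2\<close>. Babenko's equation turns into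
  \<open>\<zeta> (1 - K \<zeta>) = k + K (\<zeta>\<^sup>2) / 2\<close>. The function \<open>g = 1 - K \<zeta> + \<i> \<zeta>'\<close> on the circle has only
  Fourier modes \<open>n \<ge> 0\<close> and the mean \<open>1\<close>. The equation says exactly that \<open>h = \<zeta> cnj g\<close>, too, has
  only these modes, and that its mean is \<open>k\<close>. Hence the product \<open>g h = \<zeta> \<bar>g\<bar>\<^sup>2\<close> has only modes \<open>n \<ge> 0\<close>; as it is real, it is
  a constant, and its mean is \<open>k\<close>. This is Bernoulli's law on the free surface. In terms
  of the Fourier coefficients \<open>a\<close> of \<open>\<zeta>\<close> and \<open>b\<close> of \<open>\<zeta>\<^sup>2\<close> it reads, on the unit disc,

  \<open>G H = k\<close>, where \<open>G z = 1 - 2 \<Sum> n a\<^sub>n z\<^sup>n\<close> and \<open>H z = k + \<Sum> n b\<^sub>n z\<^sup>n\<close>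

  (\<open>bernoulli_coefficient_identity\<close>). The gain over the original equation is that \<open>G\<close> depends
  linearly on \<open>\<zeta>\<close> and \<open>H\<close> linearly on \<open>\<zeta>\<^sup>2\<close>, so that inside the disc both can be expanded
  from a pointwise expansion of \<open>\<zeta>\<close> at \<open>0\<close> alone. The remainder \<open>o(\<bar>u\<bar>\<^sup>\<mu>)\<close> carries no
  information on derivatives, and expanding the equation itself on the circle would need it.

  With \<open>z = (1 - Y) / (1 + Y)\<close> and \<open>u = 2 arctan (Y x)\<close> the two sums become exactly integrals of
  \<open>\<zeta>\<close> and \<open>\<zeta>\<^sup>2\<close> over the line against \<open>1 / (1 + \<i> x)\<^sup>2\<close>
  (\<open>disc_derivative_eq_line_integral\<close>). As \<open>Y\<close> tends to \<open>0\<close>, dominated convergence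
  (\<open>scaling_limit\<close>) shows that a term \<open>\<bar>u\<bar>\<^sup>s\<close> in the expansion contributes a multiple of
  \<open>J(s) Y\<^sup>s\<^sup>-\<^sup>1\<close> with \<open>J(s) = - \<pi> s / cos (\<pi> s / 2)\<close>. For \<open>s > 1\<close> there is also a term that is
  constant in \<open>Y\<close> and depends on \<open>\<zeta>\<close> globally. The real parts start with \<open>Y\<^sup>-\<^sup>1\<^sup>/\<^sup>3\<close> for \<open>G\<close> and with
  \<open>Y\<^sup>1\<^sup>/\<^sup>3\<close> for \<open>H\<close>; comparing the terms of relative size \<open>Y\<^sup>\<mu>\<^sup>-\<^sup>2\<^sup>/\<^sup>3\<close> in \<open>G H = k\<close> gives
  \<open>J(\<mu> + 2/3) = J(\<mu>)\<close>. The global constant in \<open>G\<close> disappears in the difference of the values at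
  \<open>Y / 2\<close> and \<open>Y\<close>, which also shows that \<open>\<mu> = 1\<close>, where \<open>G\<close> would have a logarithm, cannot occur
  (\<open>exponent_condition_of_line_asymptotics\<close>).

  It remains to see that \<open>J(\<mu> + 2/3) = J(\<mu>)\<close> singles out the second root. Multiplied by its
  two cosines, the left-hand side of the exponent equation splits into a factor whose only zero
  in \<open>(0, 2)\<close> is \<open>2/3\<close>, and a factor that vanishes when \<open>J(\<mu> + 2/3) = J(\<mu>)\<close>, is positive on
  \<open>(0, 1]\<close> and decreases on \<open>(1, 2)\<close> (\<open>is_second_rootI\<close>).
\<close>

section \<open>The exponent equation\<close>

lemma sin_eq_cos_minus_pi_half: "sin x = cos (x - pi / 2)" for x :: real
  by (simp add: cos_diff)

lemma cos_neg_between: "pi / 2 < x \<Longrightarrow> x < 3 * pi / 2 \<Longrightarrow> cos x < 0" for x :: real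
  using cos_gt_zero_pi[of "pi - x"] by (simp add: field_simps)

text \<open>
  With \<open>b = \<pi> \<nu> / 2\<close>, the addition theorems turn the numerator into
  \<open>\<nu> sin (2 b + \<pi>/3) + (4/3) cos b cos (b + \<pi>/6)\<close>, and \<open>cos (b + \<pi>/6)\<close> divides the first
  summand, too, by the double-angle formula. The zero of \<open>cos (b + \<pi>/6)\<close> is the first root \<open>2/3\<close>.
\<close>

lemma exponent_equation_factorisation:
  fixes \<nu> :: real
  assumes "cos (pi * \<nu> / 2 + pi / 3) \<noteq> 0" "cos (pi * \<nu> / 2) \<noteq> 0"
  shows "((\<nu> + 2 / 3) * tan (pi * \<nu> / 2 + pi / 3) + \<nu> * tan (pi * \<nu> / 2) + 2 / sqrt 3)
           * (cos (pi * \<nu> / 2 + pi / 3) * cos (pi * \<nu> / 2))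
         = 2 * cos (pi * \<nu> / 2 + pi / 6)
           * (\<nu> * sin (pi * \<nu> / 2 + pi / 6) + 2 / 3 * cos (pi * \<nu> / 2))"
proof -
  define b where "b = pi * \<nu> / 2"
  have s: "2 / sqrt 3 = 2 / 3 * sqrt 3" by (simp add: field_simps)
  have "((\<nu> + 2 / 3) * tan (b + pi / 3) + \<nu> * tan b + 2 / sqrt 3) * (cos (b + pi / 3) * cos b)
     = (\<nu> + 2 / 3) * sin (b + pi / 3) * cos b + \<nu> * sin b * cos (b + pi / 3)
       + 2 / 3 * sqrt 3 * cos (b + pi / 3) * cos b"
    using assms unfolding s b_def[symmetric] tan_def by (simp add: field_simps)
  also have "\<dots> = 2 * cos (b + pi / 6) * (\<nu> * sin (b + pi / 6) + 2 / 3 * cos b)"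
  proof -
    have q: "sqrt 3 * (sqrt 3 * x) = 3 * x" for x :: real
      by (simp only: mult.assoc[symmetric]) simp
    show ?thesis
      unfolding sin_add cos_add sin_30 cos_30 sin_60 cos_60 by (simp add: field_simps q)
  qed
  finally show ?thesis unfolding b_def .
qed

text \<open>
  For \<open>b = \<pi> v / 2\<close> between \<open>\<pi>/2\<close> and \<open>\<pi>\<close> the derivative is negative because
  \<open>cos (b + \<pi>/6) < 0\<close> and \<open>sin (b + \<pi>/6) < sin b < (\<pi>/3) sin b\<close>.
\<close>

lemma exponent_factor_decreasing:
  fixes x y :: real
  assumes "1 < x" "x < y" "y < 2"
  shows "y * sin (pi * y / 2 + pi / 6) + 2 / 3 * cos (pi * y / 2)
       < x * sin (pi * x / 2 + pi / 6) + 2 / 3 * cos (pi * x / 2)"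
proof (rule DERIV_neg_imp_decreasing[OF assms(2)])
  fix v assume v: "x \<le> v" "v \<le> y"
  let ?b = "pi * v / 2"
  let ?d = "sin (?b + pi / 6) + v * (cos (?b + pi / 6) * (pi / 2)) - 2 / 3 * (sin ?b * (pi / 2))"
  have b: "pi / 2 < ?b" "?b < pi"
    using v assms pi_gt_zero by auto
  have "((\<lambda>v. v * sin (pi * v / 2 + pi / 6) + 2 / 3 * cos (pi * v / 2)) has_real_derivative ?d) (at v)"
    by (auto intro!: derivative_eq_intros)
  moreover have "?d < 0"
  proof -
    have c: "cos (?b + pi / 6) < 0"
      using b by (intro cos_neg_between) linarith+
    have "cos (?b + pi / 6 - pi / 2) < cos (?b - pi / 2)"
      using b by (intro cos_monotone_0_pi) linarith+
    hence s: "sin (?b + pi / 6) < sin ?b" unfolding sin_eq_cos_minus_pi_half .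
    have sb: "sin ?b > 0" using b by (intro sin_gt_zero) auto
    have "2 / 3 * (sin ?b * (pi / 2)) = sin ?b * (pi / 3)" by simp
    moreover have "sin ?b * (pi / 3) > sin ?b * 1"
      using sb pi_gt3 by (intro mult_strict_left_mono) auto
    moreover have "v * (cos (?b + pi / 6) * (pi / 2)) < 0"
      using c v assms by (intro mult_pos_neg mult_neg_pos) auto
    ultimately show ?thesis using s by linarith
  qed
  ultimately show "\<exists>d. ((\<lambda>v. v * sin (pi * v / 2 + pi / 6) + 2 / 3 * cos (pi * v / 2)) has_real_derivative d) (at v) \<and> d < 0"
    by blast
qed

text \<open>
  The hypothesis is the vanishing of the second factor in \<open>exponent_equation_factorisation\<close>. This
  factor is positive on \<open>(0, 1]\<close>, so \<open>\<mu> > 1\<close>, and by monotonicity \<open>\<mu>\<close> is its only zero in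
  \<open>(1, 2)\<close>. Hence \<open>2/3\<close>, the zero of the first factor, is the only smaller root.
\<close>

lemma is_second_rootI:
  fixes \<mu> :: real
  assumes \<mu>: "2 / 3 < \<mu>" "\<mu> < 2" "\<mu> \<noteq> 1"
    and eq: "(\<mu> + 2 / 3) * cos (pi * \<mu> / 2) = \<mu> * cos (pi * \<mu> / 2 + pi / 3)"
  shows "is_second_root \<mu>"
proof -
  define N where "N = (\<lambda>\<nu>::real. \<nu> * sin (pi * \<nu> / 2 + pi / 6) + 2 / 3 * cos (pi * \<nu> / 2))"
  have N\<mu>: "N \<mu> = 0"
  proof -
    have "cos (pi * \<mu> / 2 + pi / 3) = cos (pi * \<mu> / 2) - sin (pi * \<mu> / 2 + pi / 6)"
      by (simp add: cos_add sin_add cos_60 sin_60 cos_30 sin_30)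
    hence "\<mu> * sin (pi * \<mu> / 2 + pi / 6) = \<mu> * cos (pi * \<mu> / 2) - \<mu> * cos (pi * \<mu> / 2 + pi / 3)"
      by (simp only: right_diff_distrib[symmetric]) simp
    thus ?thesis using eq unfolding N_def distrib_right by linarith
  qed
  have Npos: "N \<nu> > 0" if "0 < \<nu>" "\<nu> \<le> 1" for \<nu>
  proof -
    have b: "0 < pi * \<nu> / 2" "pi * \<nu> / 2 \<le> pi / 2" using that by auto
    have "sin (pi * \<nu> / 2 + pi / 6) > 0" using b by (intro sin_gt_zero) linarith+
    moreover have "cos (pi * \<nu> / 2) \<ge> 0" using b by (intro cos_ge_zero) linarith+
    ultimately show ?thesis using that unfolding N_def by (simp add: add_pos_nonneg)
  qed
  have gt1: "\<mu> > 1" using Npos[of \<mu>] N\<mu> \<mu> by force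
  have cos0: "cos (pi * \<nu> / 2 + pi / 6) = 0 \<longleftrightarrow> \<nu> = 2 / 3" if "0 < \<nu>" "\<nu> < 2" for \<nu>
  proof
    assume c0: "cos (pi * \<nu> / 2 + pi / 6) = 0"
    have r: "0 < pi * \<nu> / 2" "pi * \<nu> / 2 < pi" using that by auto
    have "pi * \<nu> / 2 + pi / 6 \<le> pi / 2"
      using cos_neg_between[of "pi * \<nu> / 2 + pi / 6"] c0 r by linarith
    moreover have "\<not> pi * \<nu> / 2 + pi / 6 < pi / 2"
      using cos_gt_zero_pi[of "pi * \<nu> / 2 + pi / 6"] c0 r by linarith
    ultimately have "pi * \<nu> / 2 + pi / 6 = pi / 2" by linarith
    hence "pi * \<nu> = pi * (2 / 3)" by linarith
    thus "\<nu> = 2 / 3" unfolding mult_cancel_left by simp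
  next
    assume "\<nu> = 2 / 3"
    hence "pi * \<nu> / 2 + pi / 6 = pi / 2" by (simp only:) simp
    thus "cos (pi * \<nu> / 2 + pi / 6) = 0" by (simp only: cos_pi_half)
  qed
  have root: "\<nu> \<in> exponent_roots \<longleftrightarrow> (cos (pi * \<nu> / 2 + pi / 3) \<noteq> 0 \<and> cos (pi * \<nu> / 2) \<noteq> 0 \<and>
      (\<nu> = 2 / 3 \<or> N \<nu> = 0))" if "0 < \<nu>" "\<nu> < 2" for \<nu>
    using exponent_equation_factorisation[of \<nu>] cos0[OF that] that
    unfolding exponent_roots_def N_def by auto
  have "\<mu> \<in> exponent_roots"
  proof -
    have b: "pi / 2 < pi * \<mu> / 2" "pi * \<mu> / 2 < pi" using \<mu> gt1 by auto
    have "cos (pi * \<mu> / 2) < 0" "cos (pi * \<mu> / 2 + pi / 3) < 0"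
      using b by (intro cos_neg_between; linarith)+
    thus ?thesis using root[of \<mu>] \<mu> N\<mu> by auto
  qed
  moreover have "{\<nu> \<in> exponent_roots. \<nu> < \<mu>} = {2 / 3}"
  proof (intro equalityI subsetI)
    fix \<nu> assume "\<nu> \<in> {\<nu> \<in> exponent_roots. \<nu> < \<mu>}"
    hence \<nu>: "\<nu> \<in> exponent_roots" "\<nu> < \<mu>" "\<nu> > 0" by (auto simp: exponent_roots_def)
    have "N \<nu> \<noteq> 0"
    proof (cases "\<nu> \<le> 1")
      case True thus ?thesis using Npos[of \<nu>] \<nu> by auto
    next
      case False
      thus ?thesis using exponent_factor_decreasing[of \<nu> \<mu>] \<nu> \<mu> N\<mu> unfolding N_def by auto
    qed
    thus "\<nu> \<in> {2 / 3}" using root[of \<nu>] \<nu> \<mu> by auto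
  next
    fix \<nu> :: real assume "\<nu> \<in> {2 / 3}"
    hence \<nu>: "\<nu> = 2 / 3" by simp
    have e: "pi * \<nu> / 2 + pi / 3 = pi - pi / 3" "pi * \<nu> / 2 = pi / 3" unfolding \<nu> by auto
    have "cos (pi * \<nu> / 2 + pi / 3) \<noteq> 0" "cos (pi * \<nu> / 2) \<noteq> 0"
      unfolding e(1) cos_pi_minus unfolding e(2) cos_60 by simp_all
    moreover have "0 < \<nu>" "\<nu> < 2" "\<nu> < \<mu>" using \<nu> \<mu> by simp_all
    ultimately show "\<nu> \<in> {\<nu> \<in> exponent_roots. \<nu> < \<mu>}" using root[of \<nu>] \<nu> by blast
  qed
  ultimately show ?thesis unfolding is_second_root_def by simp
qed

section \<open>Moments of rational kernels on the line\<close>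

lemma has_bochner_integral_even:
  fixes f :: "real \<Rightarrow> real"
  assumes half: "has_bochner_integral lborel (\<lambda>x. indicator {0<..} x * f x) I"
    and even: "\<And>x. f (- x) = f x"
  shows "has_bochner_integral lborel f (2 * I)"
proof -
  have "has_bochner_integral lborel (\<lambda>x. indicator {0<..} (0 + (-1) * x) * f (0 + (-1) * x)) (I /\<^sub>R \<bar>-1\<bar>)"
    using half by (subst lborel_has_bochner_integral_real_affine_iff[of "-1" _ _ 0, symmetric]) auto
  hence "has_bochner_integral lborel (\<lambda>x. indicator {0<..} (- x) * f x) I"
    using even by simp
  from has_bochner_integral_add[OF half this]
  have *: "has_bochner_integral lborel (\<lambda>x. indicator {0<..} x * f x + indicator {0<..} (- x) * f x) (2 * I)"
    by simp
  have AE0: "AE x in lborel. x \<noteq> (0::real)"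
    by (rule AE_lborel_singleton)
  have "(\<lambda>x. indicator {0<..} x * f x + indicator {0<..} (- x) * f x) \<in> borel_measurable lborel"
    using * by (rule borel_measurable_has_bochner_integral)
  hence "(\<lambda>x. if x = 0 then f 0 else indicator {0<..} x * f x + indicator {0<..} (- x) * f x) \<in> borel_measurable lborel"
    by measurable
  also have "(\<lambda>x. if x = 0 then f 0 else indicator {0<..} x * f x + indicator {0<..} (- x) * f x) = f"
    by (auto simp: fun_eq_iff indicator_def)
  finally have "f \<in> borel_measurable lborel" .
  thus ?thesis
    using * AE0 by (subst has_bochner_integral_cong_AE[where g = "\<lambda>x. indicator {0<..} x * f x + indicator {0<..} (- x) * f x"])
      (auto elim!: eventually_mono simp: indicator_def borel_measurable_has_bochner_integral)
qed

text \<open>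
  The substitution \<open>v = x\<^sup>2 / (1 + x\<^sup>2)\<close> maps the half line to the unit interval and turns Euler's
  Beta integral into half of this one.
\<close>

lemma Beta_integral_on_line:
  fixes a b :: real
  assumes "a > 0" "b > 0"
  shows "has_bochner_integral lborel (\<lambda>x. \<bar>x\<bar> powr (2 * a - 1) / (1 + x\<^sup>2) powr (a + b)) (Beta a b)"
proof -
  let ?f = "\<lambda>v::real. v powr (a - 1) * (1 - v) powr (b - 1)"
  let ?g = "\<lambda>x::real. x\<^sup>2 / (1 + x\<^sup>2)"
  let ?g' = "\<lambda>x::real. 2 * x / (1 + x\<^sup>2)\<^sup>2"
  let ?h = "\<lambda>x::real. \<bar>x\<bar> powr (2 * a - 1) / (1 + x\<^sup>2) powr (a + b)"
  have pos: "1 + x\<^sup>2 > 0" for x :: real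
    by (simp add: add_pos_nonneg)
  have img: "?g ` {0<..} = {0<..<1}"
  proof (intro equalityI subsetI)
    fix v :: real assume v: "v \<in> {0<..<1}"
    define w where "w = v / (1 - v)"
    have w: "w > 0" "w / (1 + w) = v" using v unfolding w_def by (auto simp: field_simps)
    hence "?g (sqrt w) = v" and "sqrt w > 0" by simp_all
    thus "v \<in> ?g ` {0<..}" by (intro image_eqI[where x = "sqrt w"]) simp_all
  next
    fix v assume "v \<in> ?g ` {0<..}"
    then obtain x where x: "x > 0" "v = ?g x" by auto
    have "x\<^sup>2 > 0" using x by simp
    thus "v \<in> {0<..<1}" unfolding x(2) using pos[of x] by (simp add: divide_simps)
  qed
  have inj: "inj_on ?g {0<..}"
  proof (rule inj_onI)
    fix x y :: real assume xy: "x \<in> {0<..}" "y \<in> {0<..}" "?g x = ?g y"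
    have e: "?g v = 1 - 1 / (1 + v\<^sup>2)" for v
      using pos[of v] by (simp add: field_simps)
    have "1 / (1 + x\<^sup>2) = 1 / (1 + y\<^sup>2)"
      using xy(3) unfolding e by linarith
    hence "x\<^sup>2 = y\<^sup>2" by simp
    thus "x = y" using xy(1,2) by (simp add: power2_eq_iff_nonneg)
  qed
  have der: "(?g has_field_derivative ?g' x) (at x within {0<..})" for x
    using pos[of x] by (auto intro!: derivative_eq_intros simp: power2_eq_square field_simps)
  have "(?f has_integral Beta a b) {0<..<1}"
    using has_integral_Beta_real[OF assms] by (simp add: has_integral_Icc_iff_Ioo)
  hence "?f absolutely_integrable_on {0<..<1} \<and> integral {0<..<1} ?f = Beta a b"
    by (auto intro!: nonnegative_absolutely_integrable_1 simp: has_integral_iff)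
  hence "?f absolutely_integrable_on ?g ` {0<..} \<and> integral (?g ` {0<..}) ?f = Beta a b"
    by (simp only: img)
  hence *: "(\<lambda>x. \<bar>?g' x\<bar> * ?f (?g x)) absolutely_integrable_on {0<..} \<and>
      integral {0<..} (\<lambda>x. \<bar>?g' x\<bar> * ?f (?g x)) = Beta a b"
    by (subst has_absolute_integral_change_of_variables_1'[OF _ der inj]) auto
  have eq: "\<bar>?g' x\<bar> * ?f (?g x) = 2 * ?h x" if "x > 0" for x
  proof -
    have 1: "1 - ?g x = 1 / (1 + x\<^sup>2)" using pos[of x] by (simp add: field_simps)
    have x2: "(x\<^sup>2) powr (a - 1) = x powr (2 * a - 2)"
      using that by (simp add: powr_power[symmetric] powr_numeral[symmetric] powr_powr del: powr_numeral)
    have "(1 / (1 + x\<^sup>2)) powr (b - 1) = (1 + x\<^sup>2) powr (1 - b)"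
      using pos[of x] by (simp add: powr_divide powr_minus_divide[symmetric])
    moreover have "(?g x) powr (a - 1) = x powr (2 * a - 2) * (1 + x\<^sup>2) powr (1 - a)"
      using pos[of x] that x2 powr_minus_divide[of "1 + x\<^sup>2" "a - 1"] by (simp add: powr_divide)
    ultimately have "?f (?g x) = x powr (2 * a - 2) * ((1 + x\<^sup>2) powr (1 - a) * (1 + x\<^sup>2) powr (1 - b))"
      unfolding 1 by simp
    also have "(1 + x\<^sup>2) powr (1 - a) * (1 + x\<^sup>2) powr (1 - b) = (1 + x\<^sup>2) powr (2 - a - b)"
      by (simp only: powr_add[symmetric]) (simp add: algebra_simps)
    finally have 2: "?f (?g x) = x powr (2 * a - 2) * (1 + x\<^sup>2) powr (2 - a - b)"
      .
    have "2 * x = 2 * x powr 1" using that by simp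
    hence "\<bar>?g' x\<bar> * ?f (?g x) = 2 * (x powr 1 * x powr (2 * a - 2)) * ((1 + x\<^sup>2) powr (2 - a - b) / (1 + x\<^sup>2) powr 2)"
      unfolding 2 using that pos[of x] by (simp add: field_simps)
    also have "\<dots> = 2 * x powr (2 * a - 1) * (1 + x\<^sup>2) powr (- (a + b))"
      by (simp only: powr_add[symmetric] powr_diff[symmetric]) (simp add: algebra_simps)
    also have "\<dots> = 2 * ?h x"
      using that by (simp only: powr_minus_divide abs_of_pos) simp
    finally show ?thesis .
  qed
  have h2: "(\<lambda>x. 2 * ?h x) absolutely_integrable_on {0<..}"
  proof -
    have "(\<lambda>x. \<bar>?g' x\<bar> * ?f (?g x)) absolutely_integrable_on {0<..} \<longleftrightarrow> (\<lambda>x. 2 * ?h x) absolutely_integrable_on {0<..}"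
      by (rule set_integrable_cong[OF refl refl], rule eq, simp)
    thus ?thesis using * by blast
  qed
  have "integral {0<..} (\<lambda>x. 2 * ?h x) = Beta a b"
  proof -
    have "integral {0<..} (\<lambda>x. \<bar>?g' x\<bar> * ?f (?g x)) = integral {0<..} (\<lambda>x. 2 * ?h x)"
      by (rule integral_cong, rule eq, simp)
    thus ?thesis using * by argo
  qed
  hence i2: "(LINT x:{0<..}|lebesgue. 2 * ?h x) = Beta a b"
    using set_lebesgue_integral_eq_integral(2)[OF h2] by simp
  have m: "(\<lambda>x. indicator {0<..} x *\<^sub>R (2 * ?h x)) \<in> borel_measurable lborel"
    by measurable
  have "integrable lborel (\<lambda>x. indicator {0<..} x *\<^sub>R (2 * ?h x))"
    using h2 m unfolding set_integrable_def by (subst (asm) integrable_completion) auto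
  moreover have "integral\<^sup>L lborel (\<lambda>x. indicator {0<..} x *\<^sub>R (2 * ?h x)) = Beta a b"
    using i2 m unfolding set_lebesgue_integral_def by (subst (asm) integral_completion) auto
  ultimately have "has_bochner_integral lborel (\<lambda>x. indicator {0<..} x *\<^sub>R (2 * ?h x)) (Beta a b)"
    by (simp add: has_bochner_integral_iff)
  hence "has_bochner_integral lborel (\<lambda>x. indicator {0<..} x * (2 * ?h x)) (Beta a b)" by simp
  from has_bochner_integral_even[OF this]
  have "has_bochner_integral lborel (\<lambda>x. 2 * ?h x) (2 * Beta a b)" by simp
  from has_bochner_integral_mult_right[OF this, of "1/2"] show ?thesis by simp
qed

text \<open>
  The case \<open>a + b = 1\<close> of the Beta integral is evaluated by the reflection formula of the Gamma
  function, and the case \<open>a + b = 2\<close> follows from it by the recursion of the Beta function.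
\<close>

lemma rational_moments:
  fixes p :: real
  assumes "\<bar>p\<bar> < 1"
  shows "has_bochner_integral lborel (\<lambda>x. \<bar>x\<bar> powr p / (1 + x\<^sup>2)) (pi / cos (pi * p / 2))"
    and "has_bochner_integral lborel (\<lambda>x. \<bar>x\<bar> powr p / (1 + x\<^sup>2)\<^sup>2)
           ((1 - p) / 2 * (pi / cos (pi * p / 2)))"
proof -
  let ?a = "(1 + p) / 2" and ?b = "(1 - p) / 2"
  have ab: "?a > 0" "?b > 0" using assms by auto
  have "Beta ?a ?b = Gamma ?a * Gamma (1 - ?a)"
    by (simp add: Beta_def field_simps)
  also have "\<dots> = pi / sin (pi * ?a)"
  proof -
    have "complex_of_real (Gamma ?a * Gamma (1 - ?a)) = Gamma (of_real ?a) * Gamma (1 - of_real ?a)"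
      by (simp add: Gamma_complex_of_real[symmetric] del: of_real_divide of_real_add)
    also have "\<dots> = of_real pi / sin (of_real pi * of_real ?a)"
      by (rule Gamma_reflection_complex)
    also have "\<dots> = of_real (pi / sin (pi * ?a))"
      by (simp add: sin_of_real[symmetric])
    finally show ?thesis by (simp only: of_real_eq_iff)
  qed
  also have "sin (pi * ?a) = cos (pi * p / 2)"
    by (simp add: sin_cos_eq cos_diff algebra_simps add_divide_distrib sin_add)
  finally have B: "Beta ?a ?b = pi / cos (pi * p / 2)" .
  have pos: "1 + x\<^sup>2 > 0" for x :: real
    by (simp add: add_pos_nonneg)
  have e: "2 * ?a - 1 = p" "?a + ?b = 1" "?a + (?b + 1) = 2" by (auto simp: field_simps)
  from Beta_integral_on_line[OF ab]
  show "has_bochner_integral lborel (\<lambda>x. \<bar>x\<bar> powr p / (1 + x\<^sup>2)) (pi / cos (pi * p / 2))"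
    unfolding B e using pos by (simp add: abs_of_pos)
  have "(?a + ?b) * Beta ?a (?b + 1) = ?b * Beta ?a ?b"
    using ab by (intro Beta_plus1_right) (auto elim!: nonpos_Ints_cases)
  hence B': "Beta ?a (?b + 1) = (1 - p) / 2 * (pi / cos (pi * p / 2))"
    unfolding B e by simp
  from Beta_integral_on_line[of ?a "?b + 1"] ab
  show "has_bochner_integral lborel (\<lambda>x. \<bar>x\<bar> powr p / (1 + x\<^sup>2)\<^sup>2)
           ((1 - p) / 2 * (pi / cos (pi * p / 2)))"
    unfolding B' e using pos by (simp add: abs_of_pos)
qed

text \<open>
  The real part of \<open>1 / (1 + \<i> x)\<^sup>2\<close>.
\<close>

definition kern :: "real \<Rightarrow> real" where
  "kern x = (1 - x\<^sup>2) / (1 + x\<^sup>2)\<^sup>2"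

text \<open>
  Off \<open>0\<close> this is \<open>kern x + 1 / x\<^sup>2\<close>. It decays like \<open>x\<^sup>-\<^sup>4\<close>, so that \<open>\<bar>x\<bar>\<^sup>s\<close> can be integrated
  against it for \<open>1 < s < 3\<close>, where \<open>kern\<close> decays too slowly.
\<close>

definition kern_reg :: "real \<Rightarrow> real" where
  "kern_reg x = (3 * x\<^sup>2 + 1) / (x\<^sup>2 * (1 + x\<^sup>2)\<^sup>2)"

text \<open>
  The imaginary part of \<open>1 / (1 + \<i> x)\<^sup>2\<close>.
\<close>

definition kern_odd :: "real \<Rightarrow> real" where
  "kern_odd x = - (2 * x) / (1 + x\<^sup>2)\<^sup>2"

text \<open>
  In \<open>\<integral> F (Y x) kern x dx / Y\<close>, replacing \<open>Y\<close> by \<open>Y / 2\<close> amounts to replacing \<open>kern x\<close> by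
  \<open>4 kern (2 x)\<close>. In the difference of the two kernels the leading terms \<open>- 1 / x\<^sup>2\<close> at infinity cancel, so that one kernel
  serves all exponents between \<open>0\<close> and \<open>3\<close>.
\<close>

definition kern_diff :: "real \<Rightarrow> real" where
  "kern_diff x = 4 * kern (2 * x) - kern x"

lemma one_plus_square_pos: "1 + x\<^sup>2 > (0 :: real)" "1 + x\<^sup>2 \<noteq> (0 :: real)"
  by (auto simp: add_pos_nonneg add_nonneg_eq_0_iff)

lemma kern_measurable [measurable]:
  "kern \<in> borel_measurable borel" "kern_reg \<in> borel_measurable borel"
  "kern_odd \<in> borel_measurable borel" "kern_diff \<in> borel_measurable borel"
  unfolding kern_def[abs_def] kern_reg_def[abs_def] kern_odd_def[abs_def] kern_diff_def[abs_def]
  by measurable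

lemma kern_even [simp]: "kern (- x) = kern x" "kern_diff (- x) = kern_diff x"
  and kern_odd_minus [simp]: "kern_odd (- x) = - kern_odd x"
  by (simp_all add: kern_def kern_diff_def kern_odd_def)

lemma kern_partial_fractions: "kern x = 2 / (1 + x\<^sup>2)\<^sup>2 - 1 / (1 + x\<^sup>2)"
  using one_plus_square_pos[of x] unfolding kern_def by (simp add: divide_simps) (simp add: algebra_simps power2_eq_square)

lemma kern_reg_eq: "x \<noteq> 0 \<Longrightarrow> kern_reg x = kern x + 1 / x\<^sup>2"
  using one_plus_square_pos[of x] unfolding kern_def kern_reg_def
  by (simp add: divide_simps) (simp add: algebra_simps power2_eq_square)

lemma kern_reg_partial_fractions:
  "x \<noteq> 0 \<Longrightarrow> x\<^sup>2 * kern_reg x = 3 * (1 / (1 + x\<^sup>2)) - 2 * (1 / (1 + x\<^sup>2)\<^sup>2)"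
  using one_plus_square_pos[of x] unfolding kern_reg_def
  by (simp add: divide_simps) (simp add: algebra_simps power2_eq_square)

lemma AE_lborel_neq_0: "AE x in lborel. x \<noteq> (0 :: real)"
  by (rule AE_lborel_singleton)

text \<open>
  By the partial fraction decomposition of the kernel.
\<close>

lemma kern_moment:
  assumes "0 < s" "s < 1"
  shows "has_bochner_integral lborel (\<lambda>x. \<bar>x\<bar> powr s * kern x) (- (pi * s / cos (pi * s / 2)))"
proof -
  have s: "\<bar>s\<bar> < 1" using assms by simp
  have "has_bochner_integral lborel (\<lambda>x. 2 * (\<bar>x\<bar> powr s / (1 + x\<^sup>2)\<^sup>2) - \<bar>x\<bar> powr s / (1 + x\<^sup>2))
      (2 * ((1 - s) / 2 * (pi / cos (pi * s / 2))) - pi / cos (pi * s / 2))"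
    by (intro has_bochner_integral_diff has_bochner_integral_mult_right rational_moments s)
  also have "(\<lambda>x. 2 * (\<bar>x\<bar> powr s / (1 + x\<^sup>2)\<^sup>2) - \<bar>x\<bar> powr s / (1 + x\<^sup>2)) = (\<lambda>x. \<bar>x\<bar> powr s * kern x)"
    by (simp add: kern_partial_fractions right_diff_distrib mult.commute)
  also have "2 * ((1 - s) / 2 * (pi / cos (pi * s / 2))) - pi / cos (pi * s / 2) = - (pi * s / cos (pi * s / 2))"
    by (simp add: algebra_simps diff_divide_distrib)
  finally show ?thesis .
qed

text \<open>
  The same formula as for \<open>kern_moment\<close>: the subtraction of \<open>- 1 / x\<^sup>2\<close> amounts to the analytic
  continuation of the moment in \<open>s\<close> across the pole at \<open>1\<close>. The proof reduces to the
  exponent \<open>s - 2\<close>.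
\<close>

lemma kern_reg_moment:
  assumes "1 < s" "s < 3"
  shows "has_bochner_integral lborel (\<lambda>x. \<bar>x\<bar> powr s * kern_reg x) (- (pi * s / cos (pi * s / 2)))"
proof -
  define p where "p = s - 2"
  have p: "\<bar>p\<bar> < 1" using assms by (simp add: p_def)
  have c: "cos (pi * p / 2) = - cos (pi * s / 2)"
  proof -
    have "pi * p / 2 = pi * s / 2 - pi" by (simp add: p_def field_simps)
    thus ?thesis by (simp only: cos_diff) simp
  qed
  have *: "has_bochner_integral lborel (\<lambda>x. 3 * (\<bar>x\<bar> powr p / (1 + x\<^sup>2)) - 2 * (\<bar>x\<bar> powr p / (1 + x\<^sup>2)\<^sup>2))
      (3 * (pi / cos (pi * p / 2)) - 2 * ((1 - p) / 2 * (pi / cos (pi * p / 2))))"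
    by (intro has_bochner_integral_diff has_bochner_integral_mult_right rational_moments p)
  have eq: "3 * (\<bar>x\<bar> powr p / (1 + x\<^sup>2)) - 2 * (\<bar>x\<bar> powr p / (1 + x\<^sup>2)\<^sup>2) = \<bar>x\<bar> powr s * kern_reg x" for x
  proof (cases "x = 0")
    case False
    have "\<bar>x\<bar> powr s = \<bar>x\<bar> powr p * x\<^sup>2"
      using False powr_add[of "\<bar>x\<bar>" p 2] by (simp add: p_def)
    hence "\<bar>x\<bar> powr s * kern_reg x = \<bar>x\<bar> powr p * (x\<^sup>2 * kern_reg x)" by simp
    also have "\<dots> = \<bar>x\<bar> powr p * (3 * (1 / (1 + x\<^sup>2)) - 2 * (1 / (1 + x\<^sup>2)\<^sup>2))"
      by (simp only: kern_reg_partial_fractions[OF False])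
    finally show ?thesis by (simp add: algebra_simps)
  qed simp
  have "3 * w - 2 * ((1 - p) / 2 * w) = (p + 2) * w" for w :: real
    by (simp add: field_simps)
  hence "3 * (pi / cos (pi * p / 2)) - 2 * ((1 - p) / 2 * (pi / cos (pi * p / 2))) = (p + 2) * (pi / cos (pi * p / 2))" .
  also have "\<dots> = - (pi * s / cos (pi * s / 2))" unfolding c by (simp add: p_def)
  finally show ?thesis using * unfolding eq by simp
qed

lemma dilation_moment:
  fixes m :: "real \<Rightarrow> real"
  assumes "has_bochner_integral lborel (\<lambda>x. \<bar>x\<bar> powr s * m x) J"
  shows "has_bochner_integral lborel (\<lambda>x. \<bar>x\<bar> powr s * (4 * m (2 * x) - m x)) ((2 powr (1 - s) - 1) * J)"
proof -
  have "has_bochner_integral lborel (\<lambda>x. \<bar>0 + 2 * x\<bar> powr s * m (0 + 2 * x)) (J /\<^sub>R \<bar>2\<bar>)"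
    using assms by (subst lborel_has_bochner_integral_real_affine_iff[of 2 _ _ 0, symmetric]) auto
  hence "has_bochner_integral lborel (\<lambda>x. \<bar>2 * x\<bar> powr s * m (2 * x)) (J / 2)"
    by (simp add: field_simps)
  from has_bochner_integral_diff[OF has_bochner_integral_mult_right[OF this, of "4 * 2 powr (- s)"] assms]
  have "has_bochner_integral lborel (\<lambda>x. 4 * 2 powr (- s) * (\<bar>2 * x\<bar> powr s * m (2 * x)) - \<bar>x\<bar> powr s * m x)
     (4 * 2 powr (- s) * (J / 2) - J)" by simp
  also have "(\<lambda>x. 4 * 2 powr (- s) * (\<bar>2 * x\<bar> powr s * m (2 * x)) - \<bar>x\<bar> powr s * m x)
      = (\<lambda>x. \<bar>x\<bar> powr s * (4 * m (2 * x) - m x))"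
    by (auto simp: abs_mult powr_mult powr_minus algebra_simps)
  also have "4 * 2 powr (- s) * (J / 2) - J = (2 powr (1 - s) - 1) * J"
    by (simp add: powr_diff powr_minus field_simps)
  finally show ?thesis .
qed

text \<open>
  Both \<open>kern\<close> and \<open>kern_reg\<close> lead to \<open>kern_diff\<close>, because \<open>1 / x\<^sup>2\<close> is annihilated by
  \<open>m \<mapsto> 4 m (2 x) - m x\<close>. Thus \<open>kern_moment\<close> covers \<open>s < 1\<close> and \<open>kern_reg_moment\<close> covers \<open>s > 1\<close>.
\<close>

lemma kern_diff_moment:
  assumes "0 < s" "s < 3" "s \<noteq> 1"
  shows "has_bochner_integral lborel (\<lambda>x. \<bar>x\<bar> powr s * kern_diff x)
           ((2 powr (1 - s) - 1) * - (pi * s / cos (pi * s / 2)))"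
proof (cases "s < 1")
  case True
  from dilation_moment[OF kern_moment[OF assms(1) True]] show ?thesis
    by (simp add: kern_diff_def)
next
  case False
  have "\<bar>x\<bar> powr s * (4 * kern_reg (2 * x) - kern_reg x) = \<bar>x\<bar> powr s * kern_diff x" for x
    by (cases "x = 0") (auto simp: kern_diff_def kern_reg_eq field_simps power2_eq_square)
  hence "(\<lambda>x. \<bar>x\<bar> powr s * kern_diff x) = (\<lambda>x. \<bar>x\<bar> powr s * (4 * kern_reg (2 * x) - kern_reg x))"
    by (intro ext) (rule sym)
  thus ?thesis using dilation_moment[OF kern_reg_moment[of s]] False assms by simp
qed

lemma abs_kern_diff_le: "\<bar>kern_diff x\<bar> \<le> 9 / (1 + x\<^sup>2)\<^sup>2"
proof -
  define q where "q = x\<^sup>2"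
  have q: "q \<ge> 0" by (simp add: q_def)
  have n: "1 + q \<noteq> 0" "1 + 4 * q \<noteq> 0" using q by auto
  have "kern_diff x = 4 * (1 - 4 * q) / (1 + 4 * q)\<^sup>2 - (1 - q) / (1 + q)\<^sup>2"
    by (simp add: kern_diff_def kern_def q_def power_mult_distrib)
  also have "\<dots> = (4 * (1 - 4 * q) * (1 + q)\<^sup>2 - (1 - q) * (1 + 4 * q)\<^sup>2) / ((1 + 4 * q)\<^sup>2 * (1 + q)\<^sup>2)"
    using n by (subst diff_frac_eq) auto
  also have "4 * (1 - 4 * q) * (1 + q)\<^sup>2 - (1 - q) * (1 + 4 * q)\<^sup>2 = 3 - 15 * q - 36 * q\<^sup>2"
    by (simp add: algebra_simps power2_eq_square)
  finally have e: "kern_diff x = (3 - 15 * q - 36 * q\<^sup>2) / ((1 + 4 * q)\<^sup>2 * (1 + q)\<^sup>2)" .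
  have "\<bar>3 - 15 * q - 36 * q\<^sup>2\<bar> \<le> 9 * (1 + 4 * q)\<^sup>2"
    using q by (simp add: abs_le_iff power2_eq_square algebra_simps)
  hence "\<bar>kern_diff x\<bar> \<le> (9 * (1 + 4 * q)\<^sup>2) / ((1 + 4 * q)\<^sup>2 * (1 + q)\<^sup>2)"
    unfolding e abs_divide abs_mult power2_abs[symmetric, of "1 + q"] power2_abs[symmetric, of "1 + 4 * q"] abs_power2 abs_idempotent
    by (rule divide_right_mono) simp
  also have "\<dots> = 9 / (1 + q)\<^sup>2" using n by simp
  finally show ?thesis by (simp add: q_def)
qed

lemma integrable_abs_kern_diff: "integrable lborel (\<lambda>x. \<bar>x\<bar> * kern_diff x)"
proof (rule Bochner_Integration.integrable_bound)
  have "has_bochner_integral lborel (\<lambda>x. \<bar>x\<bar> powr (2 * 1 - 1) / (1 + x\<^sup>2) powr (1 + 1)) (Beta 1 (1 :: real))"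
    by (rule Beta_integral_on_line) auto
  hence "integrable lborel (\<lambda>x::real. \<bar>x\<bar> / (1 + x\<^sup>2)\<^sup>2)"
    using one_plus_square_pos by (simp add: has_bochner_integral_iff)
  thus "integrable lborel (\<lambda>x::real. 9 * (\<bar>x\<bar> / (1 + x\<^sup>2)\<^sup>2))"
    by (rule integrable_mult_right)
  show "AE x in lborel. norm (\<bar>x\<bar> * kern_diff x) \<le> norm (9 * (\<bar>x\<bar> / (1 + x\<^sup>2)\<^sup>2))"
    using mult_left_mono[OF abs_kern_diff_le abs_ge_zero] by (intro AE_I2) (simp add: abs_mult field_simps)
qed measurable

text \<open>
  The exponent \<open>1\<close>, where the moments of \<open>kern\<close> have a pole, needs an antiderivative. What matters
  is that the value is not \<open>0\<close>, whereas the factor \<open>2\<^sup>1\<^sup>-\<^sup>s - 1\<close> of \<open>kern_diff_moment\<close> vanishes there.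
\<close>

lemma kern_diff_moment_one:
  "has_bochner_integral lborel (\<lambda>x. \<bar>x\<bar> powr 1 * kern_diff x) (- (2 * ln 2))"
proof -
  define Q where "Q = (\<lambda>x::real. - (1 / (1 + x\<^sup>2)) - ln (1 + x\<^sup>2) / 2)"
  define P where "P = (\<lambda>x::real. Q (2 * x) - Q x)"
  have dQ: "(Q has_real_derivative x * kern x) (at x)" for x
  proof -
    have e: "4 * x / (4 + x\<^sup>2 * 4) = x / (1 + x\<^sup>2)"
      using one_plus_square_pos[of x] by (simp add: field_simps)
    have "(Q has_real_derivative 2 * x / (1 + x\<^sup>2)\<^sup>2 - x / (1 + x\<^sup>2)) (at x)"
      using one_plus_square_pos[of x] unfolding Q_def
      by (auto intro!: derivative_eq_intros simp: power2_eq_square[of "1 + x\<^sup>2"] e)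
    thus ?thesis by (simp add: kern_partial_fractions right_diff_distrib mult.commute)
  qed
  have dP: "(P has_real_derivative x * kern_diff x) (at x)" for x
    unfolding P_def
    by (rule DERIV_cong[OF DERIV_diff[OF DERIV_chain2[OF dQ] dQ]])
       (auto intro!: derivative_eq_intros simp: kern_diff_def algebra_simps)
  have int: "set_integrable lborel (einterval 0 \<infinity>) (\<lambda>x. x * kern_diff x)"
  proof -
    have "set_integrable lborel (einterval 0 \<infinity>) (\<lambda>x. \<bar>x\<bar> * kern_diff x)"
      using integrable_abs_kern_diff unfolding set_integrable_def
      by (intro integrable_mult_indicator) auto
    also have "?this \<longleftrightarrow> ?thesis"
      by (intro set_integrable_cong) (auto simp: einterval_def)
    finally show ?thesis .
  qed
  have cont: "isCont (\<lambda>x. x * kern_diff x) x" for x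
    using one_plus_square_pos[of x] one_plus_square_pos[of "2 * x"] unfolding kern_diff_def kern_def by (auto intro!: continuous_intros)
  have lim0: "(P \<longlongrightarrow> P 0) (at_right 0)"
    using DERIV_isCont[OF dP[of 0]] by (auto simp: isCont_def intro: filterlim_mono at_le)
  have sq: "filterlim (\<lambda>x::real. 1 + x\<^sup>2) at_top at_top"
    by (intro filterlim_tendsto_add_at_top[OF tendsto_const] filterlim_pow_at_top filterlim_ident) auto
  have inv: "((\<lambda>x::real. 1 / (1 + x\<^sup>2)) \<longlongrightarrow> 0) at_top"
    using tendsto_inverse_0_at_top[OF sq] by (simp add: inverse_eq_divide)
  have inv2: "((\<lambda>x::real. 1 / (1 + (2 * x)\<^sup>2)) \<longlongrightarrow> 0) at_top"
    by (rule filterlim_compose[OF inv])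
       (intro filterlim_tendsto_pos_mult_at_top[OF tendsto_const] filterlim_ident, simp)
  have P_eq: "P x = - (1 / (1 + (2 * x)\<^sup>2)) + 1 / (1 + x\<^sup>2) - ln (4 - 3 * (1 / (1 + x\<^sup>2))) / 2" for x
  proof -
    have "4 - 3 * (1 / (1 + x\<^sup>2)) = (1 + (2 * x)\<^sup>2) / (1 + x\<^sup>2)"
      using one_plus_square_pos[of x] by (simp add: field_simps)
    also have "ln \<dots> = ln (1 + (2 * x)\<^sup>2) - ln (1 + x\<^sup>2)"
      using ln_divide_pos[OF one_plus_square_pos(1) one_plus_square_pos(1), of "2 * x" x] .
    finally show ?thesis unfolding P_def Q_def by (simp add: algebra_simps diff_divide_distrib)
  qed
  have "(P \<longlongrightarrow> - 0 + 0 - ln (4 - 3 * 0) / 2) at_top"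
    unfolding P_eq by (intro tendsto_intros inv inv2) auto
  moreover have "ln 4 = 2 * ln (2::real)" using ln_realpow[of 2 2] by simp
  ultimately have limtop: "(P \<longlongrightarrow> - ln 2) at_top" by simp
  have "(LBINT x=ereal 0..\<infinity>. x * kern_diff x) = - ln 2 - P 0"
    using int
    by (intro interval_integral_FTC_integrable[where F = P])
       (auto simp: has_real_derivative_iff_has_vector_derivative[symmetric] dP cont
          ereal_tendsto_simps1 zero_ereal_def lim0 limtop)
  hence "(LINT x:einterval 0 \<infinity>|lborel. x * kern_diff x) = - ln 2"
    by (simp add: interval_lebesgue_integral_def P_def Q_def zero_ereal_def)
  moreover have "(\<lambda>x. indicator (einterval 0 \<infinity>) x *\<^sub>R (x * kern_diff x)) = (\<lambda>x. indicator {0<..} x * (\<bar>x\<bar> * kern_diff x))"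
    by (auto simp: fun_eq_iff indicator_def einterval_def)
  ultimately have "has_bochner_integral lborel (\<lambda>x. indicator {0<..} x * (\<bar>x\<bar> * kern_diff x)) (- ln 2)"
    using int unfolding set_integrable_def set_lebesgue_integral_def has_bochner_integral_iff by simp
  from has_bochner_integral_even[OF this] show ?thesis by simp
qed

text \<open>
  For odd kernels only integrability is at stake.
\<close>

lemma kern_odd_moment:
  assumes "- 1 < s" "s < 2"
  shows "has_bochner_integral lborel (\<lambda>x. \<bar>x\<bar> powr s * kern_odd x) 0"
proof -
  have "has_bochner_integral lborel (\<lambda>x. \<bar>x\<bar> powr (2 * ((s + 2) / 2) - 1) / (1 + x\<^sup>2) powr ((s + 2) / 2 + (2 - s) / 2))
      (Beta ((s + 2) / 2) ((2 - s) / 2))"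
    using assms by (intro Beta_integral_on_line) auto
  moreover have e: "(s + 2) / 2 + (2 - s) / 2 = 2" "2 * ((s + 2) / 2) - 1 = s + 1" by (auto simp: field_simps)
  ultimately have b: "integrable lborel (\<lambda>x::real. \<bar>x\<bar> powr (s + 1) / (1 + x\<^sup>2)\<^sup>2)"
    unfolding e using one_plus_square_pos by (simp add: has_bochner_integral_iff)
  have int: "integrable lborel (\<lambda>x. \<bar>x\<bar> powr s * kern_odd x)"
  proof (rule Bochner_Integration.integrable_bound)
    show "integrable lborel (\<lambda>x::real. 2 * (\<bar>x\<bar> powr (s + 1) / (1 + x\<^sup>2)\<^sup>2))"
      using b by (rule integrable_mult_right)
    show "AE x in lborel. norm (\<bar>x\<bar> powr s * kern_odd x) \<le> norm (2 * (\<bar>x\<bar> powr (s + 1) / (1 + x\<^sup>2)\<^sup>2))"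
      by (intro AE_I2) (auto simp: kern_odd_def abs_mult powr_add mult.commute mult.left_commute)
  qed measurable
  have "(LINT x|lborel. \<bar>x\<bar> powr s * kern_odd x) = \<bar>-1\<bar> *\<^sub>R (LINT x|lborel. \<bar>0 + (-1) * x\<bar> powr s * kern_odd (0 + (-1) * x))"
    by (rule lborel_integral_real_affine) simp
  also have "\<dots> = - (LINT x|lborel. \<bar>x\<bar> powr s * kern_odd x)" by simp
  finally show ?thesis using int by (simp add: has_bochner_integral_iff)
qed

section \<open>Scaling limits and matching of two-term expansions\<close>

lemma scaling_integrable:
  fixes F m :: "real \<Rightarrow> real"
  assumes [measurable]: "F \<in> borel_measurable borel" "m \<in> borel_measurable borel"
    and bound: "\<And>t. t \<noteq> 0 \<Longrightarrow> \<bar>F t\<bar> \<le> C * \<bar>t\<bar> powr s"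
    and int: "integrable lborel (\<lambda>x. \<bar>x\<bar> powr s * m x)"
    and Y: "Y > 0"
  shows "integrable lborel (\<lambda>x. F (Y * x) * m x)"
proof (rule Bochner_Integration.integrable_bound)
  show "integrable lborel (\<lambda>x. (C * Y powr s) * (\<bar>x\<bar> powr s * m x))"
    using int by (rule integrable_mult_right)
  show "AE x in lborel. norm (F (Y * x) * m x) \<le> norm ((C * Y powr s) * (\<bar>x\<bar> powr s * m x))"
    using AE_lborel_neq_0
  proof eventually_elim
    case (elim x)
    have "\<bar>F (Y * x)\<bar> \<le> C * (Y powr s * \<bar>x\<bar> powr s)"
      using bound[of "Y * x"] Y elim by (simp add: abs_mult powr_mult)
    also have "\<dots> \<le> \<bar>C * Y powr s * \<bar>x\<bar> powr s\<bar>" by simp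
    finally have "\<bar>F (Y * x)\<bar> * \<bar>m x\<bar> \<le> \<bar>C * Y powr s * \<bar>x\<bar> powr s\<bar> * \<bar>m x\<bar>"
      by (rule mult_right_mono) simp
    thus ?case by (simp add: abs_mult mult.assoc)
  qed
qed measurable

text \<open>
  \<open>F (Y x) / Y\<^sup>s\<close> tends to \<open>\<alpha> \<bar>x\<bar>\<^sup>s\<close> and is dominated by \<open>C \<bar>x\<bar>\<^sup>s\<close>. As the bound on \<open>F\<close> is global, no
  separate treatment of the region away from \<open>0\<close> is needed.
\<close>

lemma scaling_limit:
  fixes F m :: "real \<Rightarrow> real"
  assumes [measurable]: "F \<in> borel_measurable borel" "m \<in> borel_measurable borel"
    and bound: "\<And>t. t \<noteq> 0 \<Longrightarrow> \<bar>F t\<bar> \<le> C * \<bar>t\<bar> powr s"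
    and lim: "((\<lambda>t. F t / \<bar>t\<bar> powr s) \<longlongrightarrow> \<alpha>) (at 0)"
    and int: "integrable lborel (\<lambda>x. \<bar>x\<bar> powr s * m x)"
  shows "((\<lambda>Y. Y powr (- s) * (LINT x|lborel. F (Y * x) * m x))
            \<longlongrightarrow> \<alpha> * (LINT x|lborel. \<bar>x\<bar> powr s * m x)) (at_right 0)"
proof -
  have "((\<lambda>Y. LINT x|lborel. Y powr (- s) * (F (Y * x) * m x))
            \<longlongrightarrow> (LINT x|lborel. \<alpha> * (\<bar>x\<bar> powr s * m x))) (at_right 0)"
  proof (rule tendsto_at_right_sequentially[of 0 1])
    fix S :: "nat \<Rightarrow> real" assume S: "\<And>n. 0 < S n" "S \<longlonglongrightarrow> 0"
    show "(\<lambda>n. LINT x|lborel. S n powr (- s) * (F (S n * x) * m x))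
            \<longlonglongrightarrow> (LINT x|lborel. \<alpha> * (\<bar>x\<bar> powr s * m x))"
    proof (rule integral_dominated_convergence[where w = "\<lambda>x. \<bar>C * (\<bar>x\<bar> powr s * m x)\<bar>"])
      show "integrable lborel (\<lambda>x. \<bar>C * (\<bar>x\<bar> powr s * m x)\<bar>)"
        using int by (intro integrable_abs integrable_mult_right)
      show "AE x in lborel. (\<lambda>n. S n powr (- s) * (F (S n * x) * m x)) \<longlonglongrightarrow> \<alpha> * (\<bar>x\<bar> powr s * m x)"
        using AE_lborel_neq_0
      proof eventually_elim
        case (elim x)
        have "filterlim (\<lambda>n. S n * x) (at 0) sequentially"
          using S elim tendsto_mult_right[OF S(2), of x]
          by (auto simp: filterlim_at intro!: always_eventually) (metis less_irrefl)
        from filterlim_compose[OF lim this]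
        have "(\<lambda>n. F (S n * x) / \<bar>S n * x\<bar> powr s * (\<bar>x\<bar> powr s * m x)) \<longlonglongrightarrow> \<alpha> * (\<bar>x\<bar> powr s * m x)"
          by (intro tendsto_mult tendsto_const) auto
        moreover have "F (S n * x) / \<bar>S n * x\<bar> powr s * (\<bar>x\<bar> powr s * m x) = S n powr (- s) * (F (S n * x) * m x)" for n
          using S(1)[of n] elim by (simp add: abs_mult powr_mult powr_minus field_simps)
        ultimately show ?case by simp
      qed
      show "AE x in lborel. norm (S n powr (- s) * (F (S n * x) * m x)) \<le> \<bar>C * (\<bar>x\<bar> powr s * m x)\<bar>" for n
        using AE_lborel_neq_0
      proof eventually_elim
        case (elim x)
        have Sp: "S n powr (- s) * S n powr s = 1" using S(1)[of n] by (simp add: powr_minus)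
        have "\<bar>F (S n * x)\<bar> \<le> C * (S n powr s * \<bar>x\<bar> powr s)"
          using bound[of "S n * x"] S(1)[of n] elim by (simp add: abs_mult powr_mult)
        hence "S n powr (- s) * \<bar>F (S n * x)\<bar> \<le> S n powr (- s) * (C * (S n powr s * \<bar>x\<bar> powr s))"
          by (rule mult_left_mono) simp
        also have "\<dots> = (S n powr (- s) * S n powr s) * (C * \<bar>x\<bar> powr s)" by (simp only: ac_simps)
        also have "\<dots> \<le> \<bar>C * \<bar>x\<bar> powr s\<bar>" unfolding Sp by simp
        finally have "S n powr (- s) * \<bar>F (S n * x)\<bar> * \<bar>m x\<bar> \<le> \<bar>C * \<bar>x\<bar> powr s\<bar> * \<bar>m x\<bar>"
          by (rule mult_right_mono) simp
        thus ?case by (simp add: abs_mult mult.assoc)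
      qed
    qed measurable
  qed simp
  thus ?thesis by simp
qed

text \<open>
  Provides the global bound of \<open>scaling_limit\<close>: near \<open>0\<close> it comes from the limit, and away from
  \<open>0\<close> a larger exponent only weakens a given bound.
\<close>

lemma growth_bound:
  fixes F :: "real \<Rightarrow> real"
  assumes bound: "\<And>t. t \<noteq> 0 \<Longrightarrow> \<bar>F t\<bar> \<le> D * \<bar>t\<bar> powr q"
    and lim: "((\<lambda>t. F t / \<bar>t\<bar> powr s) \<longlongrightarrow> L) (at 0)"
    and qs: "q \<le> s"
  obtains C where "\<And>t. t \<noteq> 0 \<Longrightarrow> \<bar>F t\<bar> \<le> C * \<bar>t\<bar> powr s"
proof -
  have D: "D \<ge> 0" using bound[of 1] by simp
  have "((\<lambda>t. \<bar>F t / \<bar>t\<bar> powr s\<bar>) \<longlongrightarrow> \<bar>L\<bar>) (at 0)" by (intro tendsto_rabs lim)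
  hence "eventually (\<lambda>t. \<bar>F t / \<bar>t\<bar> powr s\<bar> < \<bar>L\<bar> + 1) (at 0)"
    by (rule order_tendstoD) simp
  then obtain d where d: "d > 0" "\<And>t. t \<noteq> 0 \<Longrightarrow> \<bar>t\<bar> < d \<Longrightarrow> \<bar>F t / \<bar>t\<bar> powr s\<bar> < \<bar>L\<bar> + 1"
    unfolding eventually_at by (auto simp: dist_real_def)
  define C where "C = max (\<bar>L\<bar> + 1) (D * d powr (q - s))"
  have "\<bar>F t\<bar> \<le> C * \<bar>t\<bar> powr s" if t: "t \<noteq> 0" for t
  proof (cases "\<bar>t\<bar> < d")
    case True
    have "\<bar>F t\<bar> / \<bar>t\<bar> powr s \<le> \<bar>L\<bar> + 1" using d(2)[OF t True] by simp
    hence "\<bar>F t\<bar> \<le> (\<bar>L\<bar> + 1) * \<bar>t\<bar> powr s" using t by (simp add: field_simps)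
    also have "\<dots> \<le> C * \<bar>t\<bar> powr s" unfolding C_def by (intro mult_right_mono) auto
    finally show ?thesis .
  next
    case False
    have "\<bar>F t\<bar> \<le> D * \<bar>t\<bar> powr (q - s) * \<bar>t\<bar> powr s"
      using bound[OF t] t by (simp add: mult.assoc powr_add[symmetric])
    also have "\<bar>t\<bar> powr (q - s) \<le> d powr (q - s)"
      using False qs d(1) by (intro powr_mono2') auto
    hence "D * \<bar>t\<bar> powr (q - s) * \<bar>t\<bar> powr s \<le> D * d powr (q - s) * \<bar>t\<bar> powr s"
      using D by (intro mult_right_mono mult_left_mono) auto
    also have "\<dots> \<le> C * \<bar>t\<bar> powr s" unfolding C_def by (intro mult_right_mono) auto
    finally show ?thesis .
  qed
  thus ?thesis by (rule that)
qed

lemma tendsto_powr_at_right_0: "r > 0 \<Longrightarrow> ((\<lambda>Y::real. Y powr r) \<longlongrightarrow> 0) (at_right 0)"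
  by (rule tendsto_eq_rhs[OF tendsto_powr'[OF tendsto_ident_at tendsto_const]])
     (auto simp: eventually_at_filter)

lemma tendsto_abs_powr_at_0: "r > 0 \<Longrightarrow> ((\<lambda>t::real. \<bar>t\<bar> powr r) \<longlongrightarrow> 0) (at 0)"
  by (rule tendsto_eq_rhs[OF tendsto_powr'[OF tendsto_rabs[OF tendsto_ident_at] tendsto_const]])
     (auto simp: eventually_at_filter)

text \<open>
  The product of \<open>G = a Y\<^sup>-\<^sup>1\<^sup>/\<^sup>3 - e + \<dots>\<close> and \<open>H = b Y\<^sup>1\<^sup>/\<^sup>3 + f + \<dots>\<close> is nearly the constant \<open>k\<close>.
  Since \<open>G\<close> is unbounded, the constant term of \<open>H\<close> vanishes, and then \<open>a b = k\<close>. So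
  the correction \<open>f \<sim> \<beta> Y\<^sup>\<mu>\<^sup>-\<^sup>1\<^sup>/\<^sup>3\<close> of \<open>H\<close> determines the correction of \<open>G\<close>. Of the latter only the smallness
  relative to \<open>Y\<^sup>-\<^sup>1\<^sup>/\<^sup>3\<close> is assumed; its precise asymptotics is the conclusion.
\<close>

lemma two_term_matching:
  fixes a b d k \<beta> \<mu> :: real and e f \<omega> :: "real \<Rightarrow> real"
  assumes ab: "a \<noteq> 0" "b \<noteq> 0" and \<mu>: "2 / 3 < \<mu>" "\<mu> < 2"
    and prod: "\<And>Y. 0 < Y \<Longrightarrow> Y < 1 \<Longrightarrow>
        (1 + (1 - Y\<^sup>2) * (a * Y powr (- (1 / 3)) - e Y)) * (k + (1 - Y\<^sup>2) * (b * Y powr (1 / 3) + f Y - d)) = k + \<omega> Y"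
    and e: "((\<lambda>Y. Y powr (1 / 3) * e Y) \<longlongrightarrow> 0) (at_right 0)"
    and f: "((\<lambda>Y. Y powr (1 / 3 - \<mu>) * f Y) \<longlongrightarrow> \<beta>) (at_right 0)"
    and \<omega>: "((\<lambda>Y. Y powr (2 / 3 - \<mu>) * \<omega> Y) \<longlongrightarrow> 0) (at_right 0)"
  shows "((\<lambda>Y. Y powr (1 - \<mu>) * (1 - e Y)) \<longlongrightarrow> - (a * \<beta> / b)) (at_right 0)"
proof -
  define g where "g = (\<lambda>Y. Y powr (1 / 3) + (1 - Y\<^sup>2) * (a - Y powr (1 / 3) * e Y))"
  define h where "h = (\<lambda>Y. k + (1 - Y\<^sup>2) * (b * Y powr (1 / 3) + f Y - d))"
  have ev: "eventually (\<lambda>Y. 0 < Y \<and> Y < 1) (at_right (0 :: real))"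
    by (auto simp: eventually_at_right_field intro!: exI[of _ 1])
  have pw: "Y powr p * (Y powr q * z) = Y powr (p + q) * z" for Y p q z :: real
    by (simp add: powr_add)
  have sq: "((\<lambda>Y::real. Y\<^sup>2) \<longlongrightarrow> 0) (at_right 0)"
    by (rule tendsto_eq_intros tendsto_ident_at refl | simp)+
  have f0: "((\<lambda>Y. f Y) \<longlongrightarrow> 0) (at_right 0)"
  proof (rule Lim_transform_eventually)
    show "((\<lambda>Y. Y powr (\<mu> - 1 / 3) * (Y powr (1 / 3 - \<mu>) * f Y)) \<longlongrightarrow> 0) (at_right 0)"
      using tendsto_mult[OF tendsto_powr_at_right_0[of "\<mu> - 1 / 3"] f] \<mu> by simp
  qed (use ev in eventually_elim, simp add: pw)
  have f1: "((\<lambda>Y. Y powr (- (1 / 3)) * f Y) \<longlongrightarrow> 0) (at_right 0)"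
  proof (rule Lim_transform_eventually)
    show "((\<lambda>Y. Y powr (\<mu> - 2 / 3) * (Y powr (1 / 3 - \<mu>) * f Y)) \<longlongrightarrow> 0) (at_right 0)"
      using tendsto_mult[OF tendsto_powr_at_right_0[of "\<mu> - 2 / 3"] f] \<mu> by simp
  qed (use ev in eventually_elim, simp add: pw)
  have \<omega>0: "(\<omega> \<longlongrightarrow> 0) (at_right 0)"
  proof (rule Lim_transform_eventually)
    show "((\<lambda>Y. Y powr (\<mu> - 2 / 3) * (Y powr (2 / 3 - \<mu>) * \<omega> Y)) \<longlongrightarrow> 0) (at_right 0)"
      using tendsto_mult[OF tendsto_powr_at_right_0[of "\<mu> - 2 / 3"] \<omega>] \<mu> by simp
  qed (use ev in eventually_elim, simp add: pw)
  have g_lim: "(g \<longlongrightarrow> 0 + (1 - 0) * (a - 0)) (at_right 0)"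
    unfolding g_def by (intro tendsto_intros sq e tendsto_powr_at_right_0) simp
  have gh: "g Y * h Y = Y powr (1 / 3) * (k + \<omega> Y)" if "0 < Y" "Y < 1" for Y
  proof -
    have "g Y = Y powr (1 / 3) * (1 + (1 - Y\<^sup>2) * (a * Y powr (- (1 / 3)) - e Y))"
      using that by (simp add: g_def algebra_simps powr_add[symmetric])
    thus ?thesis using prod[OF that] by (simp add: h_def mult.assoc)
  qed
  \<comment> \<open>the constant term of \<open>h\<close> must vanish, since \<open>g\<close> tends to \<open>a \<noteq> 0\<close>\<close>
  have "k = d"
  proof -
    have "(h \<longlongrightarrow> k + (1 - 0) * (b * 0 + 0 - d)) (at_right 0)"
      unfolding h_def by (intro tendsto_intros sq f0 tendsto_powr_at_right_0) simp
    from tendsto_mult[OF g_lim this]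
    have "((\<lambda>Y. g Y * h Y) \<longlongrightarrow> a * (k - d)) (at_right 0)" by simp
    moreover have "((\<lambda>Y. g Y * h Y) \<longlongrightarrow> 0) (at_right 0)"
    proof (rule Lim_transform_eventually)
      show "((\<lambda>Y. Y powr (1 / 3) * (k + \<omega> Y)) \<longlongrightarrow> 0) (at_right 0)"
        using tendsto_mult[OF tendsto_powr_at_right_0[of "1 / 3"] tendsto_add[OF tendsto_const[of k] \<omega>0]] by simp
    qed (use ev in eventually_elim, simp add: gh)
    ultimately have "a * (k - d) = 0" by (rule tendsto_unique[rotated]) simp
    thus ?thesis using ab by simp
  qed
  define h' where "h' = (\<lambda>Y. k * Y powr (5 / 3) + (1 - Y\<^sup>2) * (b + Y powr (- (1 / 3)) * f Y))"
  have h'_lim: "(h' \<longlongrightarrow> k * 0 + (1 - 0) * (b + 0)) (at_right 0)"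
    unfolding h'_def by (intro tendsto_intros sq f1 tendsto_powr_at_right_0) simp
  have h': "h Y = Y powr (1 / 3) * h' Y" if "0 < Y" for Y
  proof -
    have "Y powr (1 / 3) * Y powr (5 / 3) = Y\<^sup>2"
      using that by (simp add: powr_add[symmetric])
    moreover have "Y powr (1 / 3) * Y powr (- (1 / 3)) = 1"
      using that by (simp add: powr_add[symmetric])
    ultimately show ?thesis
      unfolding h_def h'_def \<open>k = d\<close> by (simp add: algebra_simps)
  qed
  have gh': "g Y * h' Y = k + \<omega> Y" if "0 < Y" "Y < 1" for Y
  proof -
    have "Y powr (1 / 3) * (g Y * h' Y) = Y powr (1 / 3) * (k + \<omega> Y)"
      using gh[OF that] h'[of Y] that by (simp add: algebra_simps)
    thus ?thesis using that by simp
  qed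
  have "a * b = k"
  proof -
    have "((\<lambda>Y. g Y * h' Y) \<longlongrightarrow> a * b) (at_right 0)"
      using tendsto_mult[OF g_lim h'_lim] by simp
    moreover have "((\<lambda>Y. g Y * h' Y) \<longlongrightarrow> k + 0) (at_right 0)"
      by (rule Lim_transform_eventually[OF tendsto_add[OF tendsto_const \<omega>0]])
         (use ev in eventually_elim, simp add: gh')
    ultimately show ?thesis using tendsto_unique[of "at_right (0::real)"] by force
  qed
  have h'1: "((\<lambda>Y. Y powr (2 / 3 - \<mu>) * (h' Y - b)) \<longlongrightarrow> \<beta>) (at_right 0)"
  proof (rule Lim_transform_eventually)
    show "((\<lambda>Y. k * Y powr (7 / 3 - \<mu>) + (1 - Y\<^sup>2) * (Y powr (1 / 3 - \<mu>) * f Y) - b * Y powr (8 / 3 - \<mu>)) \<longlongrightarrow> \<beta>) (at_right 0)"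
      using tendsto_diff[OF tendsto_add[OF tendsto_mult[OF tendsto_const[of k] tendsto_powr_at_right_0[of "7 / 3 - \<mu>"]]
              tendsto_mult[OF tendsto_diff[OF tendsto_const[of 1] sq] f]]
            tendsto_mult[OF tendsto_const[of b] tendsto_powr_at_right_0[of "8 / 3 - \<mu>"]]] \<mu>
      by simp
    show "eventually (\<lambda>Y. k * Y powr (7 / 3 - \<mu>) + (1 - Y\<^sup>2) * (Y powr (1 / 3 - \<mu>) * f Y) - b * Y powr (8 / 3 - \<mu>)
        = Y powr (2 / 3 - \<mu>) * (h' Y - b)) (at_right 0)"
      using ev
    proof eventually_elim
      case (elim Y)
      have p: "Y powr (2 / 3 - \<mu>) * Y powr (5 / 3) = Y powr (7 / 3 - \<mu>)"
        "Y powr (2 / 3 - \<mu>) * Y powr (- (1 / 3)) = Y powr (1 / 3 - \<mu>)"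
        "Y powr (2 / 3 - \<mu>) * Y\<^sup>2 = Y powr (8 / 3 - \<mu>)"
        using elim by (simp_all add: powr_add[symmetric] powr_numeral[symmetric] del: powr_numeral)
      show ?case unfolding h'_def p[symmetric] by (simp add: algebra_simps)
    qed
  qed
  have g1: "((\<lambda>Y. Y powr (2 / 3 - \<mu>) * (g Y - a)) \<longlongrightarrow> - (a * \<beta> / b)) (at_right 0)"
  proof (rule Lim_transform_eventually)
    show "((\<lambda>Y. (Y powr (2 / 3 - \<mu>) * \<omega> Y - a * (Y powr (2 / 3 - \<mu>) * (h' Y - b))) / h' Y) \<longlongrightarrow> - (a * \<beta> / b)) (at_right 0)"
      using tendsto_divide[OF tendsto_diff[OF \<omega> tendsto_mult[OF tendsto_const[of a] h'1]] h'_lim] ab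
      by simp
    have "eventually (\<lambda>Y. h' Y \<noteq> 0) (at_right 0)"
      using h'_lim ab by (intro tendsto_imp_eventually_ne[where c = b]) auto
    thus "eventually (\<lambda>Y. (Y powr (2 / 3 - \<mu>) * \<omega> Y - a * (Y powr (2 / 3 - \<mu>) * (h' Y - b))) / h' Y
        = Y powr (2 / 3 - \<mu>) * (g Y - a)) (at_right 0)"
      using ev
    proof eventually_elim
      case (elim Y)
      have \<omega>Y: "\<omega> Y = g Y * h' Y - a * b" using gh'[of Y] elim \<open>a * b = k\<close> by simp
      have "Y powr (2 / 3 - \<mu>) * \<omega> Y - a * (Y powr (2 / 3 - \<mu>) * (h' Y - b))
          = Y powr (2 / 3 - \<mu>) * (g Y - a) * h' Y"
        unfolding \<omega>Y by (simp add: algebra_simps)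
      thus ?case using elim by simp
    qed
  qed
  show ?thesis
  proof (rule Lim_transform_eventually)
    show "((\<lambda>Y. Y powr (2 / 3 - \<mu>) * (g Y - a) + Y powr (8 / 3 - \<mu>) * (a - Y powr (1 / 3) * e Y))
        \<longlongrightarrow> - (a * \<beta> / b)) (at_right 0)"
      using tendsto_add[OF g1 tendsto_mult[OF tendsto_powr_at_right_0[of "8 / 3 - \<mu>"] tendsto_diff[OF tendsto_const[of a] e]]] \<mu>
      by simp
    show "eventually (\<lambda>Y. Y powr (2 / 3 - \<mu>) * (g Y - a) + Y powr (8 / 3 - \<mu>) * (a - Y powr (1 / 3) * e Y)
        = Y powr (1 - \<mu>) * (1 - e Y)) (at_right 0)"
      using ev
    proof eventually_elim
      case (elim Y)
      have p: "Y powr (2 / 3 - \<mu>) * Y powr (1 / 3) = Y powr (1 - \<mu>)"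
        "Y powr (2 / 3 - \<mu>) * Y\<^sup>2 = Y powr (8 / 3 - \<mu>)"
        using elim by (simp_all add: powr_add[symmetric] powr_numeral[symmetric] del: powr_numeral)
      show ?case unfolding g_def p[symmetric] by (simp add: algebra_simps)
    qed
  qed
qed

text \<open>
  The hypothesis \<open>prod\<close> is the real part of the identity \<open>G H = k\<close>; the contribution of the
  imaginary parts is negligible because even terms do not contribute to them. The expansion of
  the first integral is known only up to a constant when \<open>\<mu> > 1\<close>, so that its correction term
  \<open>e\<close> is not expanded directly. Instead \<open>two_term_matching\<close> predicts \<open>1 - e\<close> from the
  expansion of the second integral, and the prediction for the difference of the values at
  \<open>Y / 2\<close> and \<open>Y\<close> is compared with what \<open>scaling_limit\<close> gives for the kernel \<open>kern_diff\<close>.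
\<close>

lemma exponent_condition_of_line_asymptotics:
  fixes Z :: "real \<Rightarrow> real" and A B k \<mu> :: real
  assumes Z[measurable]: "Z \<in> borel_measurable borel" and bdd: "\<And>t. \<bar>Z t\<bar> \<le> M"
    and A: "A \<noteq> 0" and B: "B \<noteq> 0" and \<mu>: "2 / 3 < \<mu>" "\<mu> < 2"
    and asym: "((\<lambda>t. (Z t - A * \<bar>t\<bar> powr (2 / 3)) / \<bar>t\<bar> powr \<mu>) \<longlongrightarrow> B) (at 0)"
    and prod: "\<And>Y. 0 < Y \<Longrightarrow> Y < 1 \<Longrightarrow>
       (1 - (1 - Y\<^sup>2) / (2 * pi * Y) * (LINT x|lborel. Z (Y * x) * kern x))
         * (k + (1 - Y\<^sup>2) / (4 * pi * Y) * (LINT x|lborel. (Z (Y * x))\<^sup>2 * kern x))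
       + (1 - Y\<^sup>2)\<^sup>2 / (8 * pi\<^sup>2 * Y\<^sup>2) * ((LINT x|lborel. Z (Y * x) * kern_odd x)
         * (LINT x|lborel. (Z (Y * x))\<^sup>2 * kern_odd x)) = k"
  shows "\<mu> \<noteq> 1 \<and> (\<mu> + 2 / 3) * cos (pi * \<mu> / 2) = \<mu> * cos (pi * \<mu> / 2 + pi / 3)"
proof -
  have ev: "eventually (\<lambda>Y. 0 < Y \<and> Y < 1) (at_right (0 :: real))"
    by (auto simp: eventually_at_right_field intro!: exI[of _ 1])
  have ev0: "eventually (\<lambda>t. t \<noteq> 0) (at (0 :: real))"
    by (simp add: eventually_at_filter)
  (* F1 and F2 are at most of order 2/3 and 4/3 at infinity, which are smaller than their
     orders \<mu> and \<mu> + 2/3 at 0; so the global bounds of scaling_limit hold for them. *)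
  define F1 where "F1 = (\<lambda>t. Z t - A * \<bar>t\<bar> powr (2 / 3))"
  define F2 where "F2 = (\<lambda>t. (Z t)\<^sup>2 - A\<^sup>2 * \<bar>t\<bar> powr (4 / 3))"
  have [measurable]: "F1 \<in> borel_measurable borel" "F2 \<in> borel_measurable borel"
    unfolding F1_def F2_def by measurable
  have F1_lim: "((\<lambda>t. F1 t / \<bar>t\<bar> powr \<mu>) \<longlongrightarrow> B) (at 0)"
    using asym by (simp add: F1_def)
  have F1_lim0: "((\<lambda>t. F1 t / \<bar>t\<bar> powr (2 / 3)) \<longlongrightarrow> 0) (at 0)"
  proof (rule Lim_transform_eventually)
    show "((\<lambda>t. F1 t / \<bar>t\<bar> powr \<mu> * \<bar>t\<bar> powr (\<mu> - 2 / 3)) \<longlongrightarrow> 0) (at 0)"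
      using tendsto_mult[OF F1_lim tendsto_abs_powr_at_0[of "\<mu> - 2 / 3"]] \<mu> by simp
  qed (use ev0 in eventually_elim, simp add: powr_diff)
  have Z_lim: "((\<lambda>t. Z t / \<bar>t\<bar> powr (2 / 3)) \<longlongrightarrow> A) (at 0)"
  proof (rule Lim_transform_eventually)
    show "((\<lambda>t. A + F1 t / \<bar>t\<bar> powr (2 / 3)) \<longlongrightarrow> A) (at 0)"
      using tendsto_add[OF tendsto_const[of A] F1_lim0] by simp
  qed (use ev0 in eventually_elim, simp add: F1_def diff_divide_distrib)
  have sq43: "(\<bar>t\<bar> powr (2 / 3))\<^sup>2 = \<bar>t\<bar> powr (4 / 3)" for t :: real
    by (simp add: power2_eq_square powr_add[symmetric])
  have F2_eq: "F2 t = F1 t * (Z t + A * \<bar>t\<bar> powr (2 / 3))" for t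
    unfolding F1_def F2_def sq43[symmetric] by (simp add: algebra_simps power2_eq_square)
  have F2_lim: "((\<lambda>t. F2 t / \<bar>t\<bar> powr (\<mu> + 2 / 3)) \<longlongrightarrow> 2 * A * B) (at 0)"
  proof (rule Lim_transform_eventually)
    show "((\<lambda>t. F1 t / \<bar>t\<bar> powr \<mu> * (Z t / \<bar>t\<bar> powr (2 / 3) + A)) \<longlongrightarrow> 2 * A * B) (at 0)"
      using tendsto_mult[OF F1_lim tendsto_add[OF Z_lim tendsto_const[of A]]] by (simp add: mult.commute)
    show "eventually (\<lambda>t. F1 t / \<bar>t\<bar> powr \<mu> * (Z t / \<bar>t\<bar> powr (2 / 3) + A) = F2 t / \<bar>t\<bar> powr (\<mu> + 2 / 3)) (at 0)"
      using ev0
    proof eventually_elim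
      case (elim t)
      have "Z t / \<bar>t\<bar> powr (2 / 3) + A = (Z t + A * \<bar>t\<bar> powr (2 / 3)) / \<bar>t\<bar> powr (2 / 3)"
        using elim by (simp add: add_divide_distrib)
      thus ?case by (simp only: F2_eq powr_add times_divide_times_eq)
    qed
  qed

  obtain C0 where C0: "\<And>t. t \<noteq> 0 \<Longrightarrow> \<bar>Z t\<bar> \<le> C0 * \<bar>t\<bar> powr (2 / 3)"
    by (rule growth_bound[of Z M 0, OF _ Z_lim]) (use bdd in auto)
  have F1_bound0: "\<bar>F1 t\<bar> \<le> (C0 + \<bar>A\<bar>) * \<bar>t\<bar> powr (2 / 3)" if "t \<noteq> 0" for t
  proof -
    have "\<bar>F1 t\<bar> \<le> \<bar>Z t\<bar> + \<bar>A * \<bar>t\<bar> powr (2 / 3)\<bar>" unfolding F1_def by (rule abs_triangle_ineq4)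
    thus ?thesis using C0[OF that] by (simp add: abs_mult distrib_right)
  qed
  obtain C1 where C1: "\<And>t. t \<noteq> 0 \<Longrightarrow> \<bar>F1 t\<bar> \<le> C1 * \<bar>t\<bar> powr \<mu>"
    by (rule growth_bound[OF F1_bound0 F1_lim]) (use \<mu> in auto)
  have Z2_bound: "\<bar>(Z t)\<^sup>2\<bar> \<le> C0\<^sup>2 * \<bar>t\<bar> powr (4 / 3)" if "t \<noteq> 0" for t
  proof -
    have "\<bar>Z t\<bar>\<^sup>2 \<le> (C0 * \<bar>t\<bar> powr (2 / 3))\<^sup>2" using C0[OF that] by (intro power_mono) auto
    thus ?thesis by (simp add: power_mult_distrib sq43)
  qed
  have F2_bound0: "\<bar>F2 t\<bar> \<le> (C0\<^sup>2 + A\<^sup>2) * \<bar>t\<bar> powr (4 / 3)" if "t \<noteq> 0" for t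
  proof -
    have "\<bar>F2 t\<bar> \<le> \<bar>(Z t)\<^sup>2\<bar> + \<bar>A\<^sup>2 * \<bar>t\<bar> powr (4 / 3)\<bar>" unfolding F2_def by (rule abs_triangle_ineq4)
    thus ?thesis using Z2_bound[OF that] by (simp add: abs_mult distrib_right)
  qed
  obtain C2 where C2: "\<And>t. t \<noteq> 0 \<Longrightarrow> \<bar>F2 t\<bar> \<le> C2 * \<bar>t\<bar> powr (\<mu> + 2 / 3)"
    by (rule growth_bound[OF F2_bound0 F2_lim]) (use \<mu> in auto)

  define S1 where "S1 = (\<lambda>Y. LINT x|lborel. F1 (Y * x) * kern x)"
  define S2 where "S2 = (\<lambda>Y. LINT x|lborel. F2 (Y * x) * kern_reg x)"
  define O1 where "O1 = (\<lambda>Y. LINT x|lborel. Z (Y * x) * kern_odd x)"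
  define O2 where "O2 = (\<lambda>Y. LINT x|lborel. (Z (Y * x))\<^sup>2 * kern_odd x)"
  define D where "D = (LINT t|lborel. (Z t)\<^sup>2 / t\<^sup>2)"
  have c23: "cos (pi * (2 / 3) / 2) = 1 / 2" using cos_60 by simp
  have c43: "cos (pi * (4 / 3) / 2) = - (1 / 2)"
  proof -
    have "pi * (4 / 3) / 2 = pi - pi / 3" by simp
    thus ?thesis using cos_pi_minus[of "pi / 3"] cos_60 by (simp only:)
  qed
  have "- (pi * (2 / 3) / cos (pi * (2 / 3) / 2)) = - (4 * pi / 3)"
    unfolding c23 by simp
  hence K23: "has_bochner_integral lborel (\<lambda>x. \<bar>x\<bar> powr (2 / 3) * kern x) (- (4 * pi / 3))"
    using kern_moment[of "2 / 3"] by (simp only:)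
  have "- (pi * (4 / 3) / cos (pi * (4 / 3) / 2)) = 8 * pi / 3"
    unfolding c43 by simp
  hence K43: "has_bochner_integral lborel (\<lambda>x. \<bar>x\<bar> powr (4 / 3) * kern_reg x) (8 * pi / 3)"
    using kern_reg_moment[of "4 / 3"] by (simp only:)
  have hom: "\<bar>Y * x\<bar> powr s = Y powr s * \<bar>x\<bar> powr s" if "Y > 0" for Y x s :: real
    using that by (simp add: abs_mult powr_mult)
  have S1_int: "integrable lborel (\<lambda>x. F1 (Y * x) * kern x)" if "Y > 0" for Y
    by (rule scaling_integrable[OF _ _ F1_bound0 _ that]) (use K23 in \<open>auto simp: has_bochner_integral_iff\<close>)
  have S2_int: "integrable lborel (\<lambda>x. F2 (Y * x) * kern_reg x)" if "Y > 0" for Y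
    by (rule scaling_integrable[OF _ _ F2_bound0 _ that]) (use K43 in \<open>auto simp: has_bochner_integral_iff\<close>)
  have Z2_int: "integrable lborel (\<lambda>x. (Z (Y * x))\<^sup>2 * kern_reg x)" if "Y > 0" for Y
    by (rule scaling_integrable[where F = "\<lambda>t. (Z t)\<^sup>2", OF _ _ Z2_bound _ that])
       (use K43 in \<open>auto simp: has_bochner_integral_iff\<close>)

  have R1: "(LINT x|lborel. Z (Y * x) * kern x) = - (4 * pi / 3) * A * Y powr (2 / 3) + S1 Y" if "Y > 0" for Y
  proof -
    have "Z (Y * x) * kern x = A * Y powr (2 / 3) * (\<bar>x\<bar> powr (2 / 3) * kern x) + F1 (Y * x) * kern x" for x
      by (simp add: F1_def hom[OF that] algebra_simps)
    hence "(LINT x|lborel. Z (Y * x) * kern x)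
        = (LINT x|lborel. A * Y powr (2 / 3) * (\<bar>x\<bar> powr (2 / 3) * kern x) + F1 (Y * x) * kern x)" by simp
    also have "\<dots> = A * Y powr (2 / 3) * (- (4 * pi / 3)) + S1 Y"
      unfolding S1_def using K23 S1_int[OF that]
      by (subst Bochner_Integration.integral_add) (auto simp: has_bochner_integral_iff)
    finally show ?thesis by simp
  qed

  have kern_int: "integrable lborel kern"
  proof -
    have "integrable lborel (\<lambda>x::real. 2 * (\<bar>x\<bar> powr 0 / (1 + x\<^sup>2)\<^sup>2) - \<bar>x\<bar> powr 0 / (1 + x\<^sup>2))"
      using rational_moments[of 0]
      by (intro Bochner_Integration.integrable_diff integrable_mult_right) (auto simp: has_bochner_integral_iff)
    thus ?thesis
      by (rule integrable_cong_AE_imp) (use AE_lborel_neq_0 in \<open>auto elim!: eventually_mono simp: kern_partial_fractions\<close>)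
  qed
  have R2: "(LINT x|lborel. (Z (Y * x))\<^sup>2 * kern x) = (8 * pi / 3) * A\<^sup>2 * Y powr (4 / 3) + S2 Y - Y * D" if "Y > 0" for Y
  proof -
    have Zk: "integrable lborel (\<lambda>x. (Z (Y * x))\<^sup>2 * kern x)"
    proof (rule Bochner_Integration.integrable_bound)
      show "integrable lborel (\<lambda>x. M\<^sup>2 * kern x)" using kern_int by (rule integrable_mult_right)
      show "AE x in lborel. norm ((Z (Y * x))\<^sup>2 * kern x) \<le> norm (M\<^sup>2 * kern x)"
      proof (rule AE_I2)
        fix x have "\<bar>Z (Y * x)\<bar>\<^sup>2 \<le> M\<^sup>2" using bdd by (intro power_mono) auto
        thus "norm ((Z (Y * x))\<^sup>2 * kern x) \<le> norm (M\<^sup>2 * kern x)"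
          by (simp add: abs_mult mult_right_mono)
      qed
    qed measurable
    have AEeq: "AE x in lborel. (Z (Y * x))\<^sup>2 * kern_reg x - (Z (Y * x))\<^sup>2 * kern x = Y\<^sup>2 * ((Z (Y * x))\<^sup>2 / (Y * x)\<^sup>2)"
      using AE_lborel_neq_0 by eventually_elim (use that in \<open>simp add: kern_reg_eq algebra_simps power_mult_distrib\<close>)
    have "D = Y * (LINT x|lborel. (Z (Y * x))\<^sup>2 / (Y * x)\<^sup>2)"
      unfolding D_def using that by (subst lborel_integral_real_affine[of Y _ 0]) auto
    hence "Y * D = Y\<^sup>2 * (LINT x|lborel. (Z (Y * x))\<^sup>2 / (Y * x)\<^sup>2)"
      unfolding power2_eq_square[of Y] mult.assoc by (rule arg_cong)
    also have "\<dots> = (LINT x|lborel. Y\<^sup>2 * ((Z (Y * x))\<^sup>2 / (Y * x)\<^sup>2))"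
      by (rule integral_mult_right_zero[symmetric])
    also have "\<dots> = (LINT x|lborel. (Z (Y * x))\<^sup>2 * kern_reg x - (Z (Y * x))\<^sup>2 * kern x)"
      by (rule integral_cong_AE) (use AEeq in \<open>auto elim!: eventually_mono\<close>)
    also have "\<dots> = (LINT x|lborel. (Z (Y * x))\<^sup>2 * kern_reg x) - (LINT x|lborel. (Z (Y * x))\<^sup>2 * kern x)"
      by (intro Bochner_Integration.integral_diff Z2_int that Zk)
    finally have 1: "(LINT x|lborel. (Z (Y * x))\<^sup>2 * kern x) = (LINT x|lborel. (Z (Y * x))\<^sup>2 * kern_reg x) - Y * D" by simp
    have "(Z (Y * x))\<^sup>2 * kern_reg x = A\<^sup>2 * Y powr (4 / 3) * (\<bar>x\<bar> powr (4 / 3) * kern_reg x) + F2 (Y * x) * kern_reg x" for x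
      by (simp add: F2_def hom[OF that] algebra_simps)
    hence "(LINT x|lborel. (Z (Y * x))\<^sup>2 * kern_reg x)
        = (LINT x|lborel. A\<^sup>2 * Y powr (4 / 3) * (\<bar>x\<bar> powr (4 / 3) * kern_reg x) + F2 (Y * x) * kern_reg x)" by simp
    also have "\<dots> = A\<^sup>2 * Y powr (4 / 3) * (8 * pi / 3) + S2 Y"
      unfolding S2_def using K43 S2_int[OF that]
      by (subst Bochner_Integration.integral_add) (auto simp: has_bochner_integral_iff)
    finally show ?thesis unfolding 1 by simp
  qed

  define J where "J = - (pi * (\<mu> + 2 / 3) / cos (pi * (\<mu> + 2 / 3) / 2))"
  have S1_lim: "((\<lambda>Y. Y powr (- (2 / 3)) * S1 Y) \<longlongrightarrow> 0) (at_right 0)"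
    using scaling_limit[OF _ _ F1_bound0 F1_lim0, of kern] K23 unfolding S1_def
    by (simp add: has_bochner_integral_iff)
  have S2_lim: "((\<lambda>Y. Y powr (- (\<mu> + 2 / 3)) * S2 Y) \<longlongrightarrow> 2 * A * B * J) (at_right 0)"
    using scaling_limit[OF _ _ C2 F2_lim, of kern_reg] kern_reg_moment[of "\<mu> + 2 / 3"] \<mu> unfolding S2_def J_def
    by (simp add: has_bochner_integral_iff)

  have O1_lim: "((\<lambda>Y. Y powr (- \<mu>) * O1 Y) \<longlongrightarrow> 0) (at_right 0)"
  proof (rule Lim_transform_eventually)
    show "((\<lambda>Y. Y powr (- \<mu>) * (LINT x|lborel. F1 (Y * x) * kern_odd x)) \<longlongrightarrow> 0) (at_right 0)"
      using scaling_limit[OF _ _ C1 F1_lim, of kern_odd] kern_odd_moment[of \<mu>] \<mu>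
      by (simp add: has_bochner_integral_iff)
    show "eventually (\<lambda>Y. Y powr (- \<mu>) * (LINT x|lborel. F1 (Y * x) * kern_odd x) = Y powr (- \<mu>) * O1 Y) (at_right 0)"
      using ev
    proof eventually_elim
      case (elim Y)
      have "integrable lborel (\<lambda>x. F1 (Y * x) * kern_odd x)"
        by (rule scaling_integrable[OF _ _ F1_bound0]) (use kern_odd_moment[of "2 / 3"] elim in \<open>auto simp: has_bochner_integral_iff\<close>)
      moreover have "Z (Y * x) * kern_odd x = A * Y powr (2 / 3) * (\<bar>x\<bar> powr (2 / 3) * kern_odd x) + F1 (Y * x) * kern_odd x" for x
        using elim by (simp add: F1_def hom algebra_simps)
      ultimately have "O1 Y = (LINT x|lborel. F1 (Y * x) * kern_odd x)"
        unfolding O1_def using kern_odd_moment[of "2 / 3"]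
        by (simp add: has_bochner_integral_iff)
      thus ?case by simp
    qed
  qed
  (* The second odd moment is needed with an exponent s below 2. It has to exceed 4/3, because
     the product of the imaginary parts, of order Y powr (\<mu> + s - 2), must be negligible
     against Y powr (\<mu> - 2/3). *)
  obtain \<delta> :: real where \<delta>: "0 < \<delta>" "\<delta> < \<mu> - 2 / 3" "\<delta> < 2 / 3"
    using dense[of 0 "min (\<mu> - 2 / 3) (2 / 3)"] \<mu> by auto
  define s where "s = 4 / 3 + \<delta>"
  have s: "4 / 3 < s \<and> s < 2 \<and> s < \<mu> + 2 / 3" using \<delta> \<mu> unfolding s_def by (intro conjI; linarith)
  have F2_lim0: "((\<lambda>t. F2 t / \<bar>t\<bar> powr s) \<longlongrightarrow> 0) (at 0)"
  proof (rule Lim_transform_eventually)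
    show "((\<lambda>t. F2 t / \<bar>t\<bar> powr (\<mu> + 2 / 3) * \<bar>t\<bar> powr (\<mu> + 2 / 3 - s)) \<longlongrightarrow> 0) (at 0)"
      using tendsto_mult[OF F2_lim tendsto_abs_powr_at_0[of "\<mu> + 2 / 3 - s"]] s by simp
  qed (use ev0 in eventually_elim, simp add: powr_diff)
  obtain C3 where C3: "\<And>t. t \<noteq> 0 \<Longrightarrow> \<bar>F2 t\<bar> \<le> C3 * \<bar>t\<bar> powr s"
    by (rule growth_bound[OF F2_bound0 F2_lim0]) (use s in auto)
  have O2_lim: "((\<lambda>Y. Y powr (- s) * O2 Y) \<longlongrightarrow> 0) (at_right 0)"
  proof (rule Lim_transform_eventually)
    show "((\<lambda>Y. Y powr (- s) * (LINT x|lborel. F2 (Y * x) * kern_odd x)) \<longlongrightarrow> 0) (at_right 0)"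
      using scaling_limit[OF _ _ C3 F2_lim0, of kern_odd] kern_odd_moment[of s] s
      by (simp add: has_bochner_integral_iff)
    show "eventually (\<lambda>Y. Y powr (- s) * (LINT x|lborel. F2 (Y * x) * kern_odd x) = Y powr (- s) * O2 Y) (at_right 0)"
      using ev
    proof eventually_elim
      case (elim Y)
      have "integrable lborel (\<lambda>x. F2 (Y * x) * kern_odd x)"
        by (rule scaling_integrable[OF _ _ F2_bound0]) (use kern_odd_moment[of "4 / 3"] elim in \<open>auto simp: has_bochner_integral_iff\<close>)
      moreover have "(Z (Y * x))\<^sup>2 * kern_odd x = A\<^sup>2 * Y powr (4 / 3) * (\<bar>x\<bar> powr (4 / 3) * kern_odd x) + F2 (Y * x) * kern_odd x" for x
        using elim by (simp add: F2_def hom algebra_simps)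
      ultimately have "O2 Y = (LINT x|lborel. F2 (Y * x) * kern_odd x)"
        unfolding O2_def using kern_odd_moment[of "4 / 3"]
        by (simp add: has_bochner_integral_iff)
      thus ?case by simp
    qed
  qed

  define e where "e = (\<lambda>Y. S1 Y / (2 * pi * Y))"
  define f where "f = (\<lambda>Y. S2 Y / (4 * pi * Y))"
  define \<omega> where "\<omega> = (\<lambda>Y. - ((1 - Y\<^sup>2)\<^sup>2 / (8 * pi\<^sup>2 * Y\<^sup>2) * (O1 Y * O2 Y)))"
  have pY: "Y powr p / Y = Y powr (p - 1)" if "Y > 0" for Y p :: real
    using that by (simp add: powr_diff)
  have m: "((\<lambda>Y. Y powr (1 - \<mu>) * (1 - e Y))
      \<longlongrightarrow> - ((2 * A / 3) * (2 * A * B * J / (4 * pi)) / (2 * A\<^sup>2 / 3))) (at_right 0)"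
  proof (rule two_term_matching[where d = "D / (4 * pi)" and f = f and \<omega> = \<omega> and k = k])
    show "2 * A / 3 \<noteq> 0" "2 * A\<^sup>2 / 3 \<noteq> 0" "2 / 3 < \<mu>" "\<mu> < 2" using A \<mu> by auto
    show "(1 + (1 - Y\<^sup>2) * (2 * A / 3 * Y powr (- (1 / 3)) - e Y))
        * (k + (1 - Y\<^sup>2) * (2 * A\<^sup>2 / 3 * Y powr (1 / 3) + f Y - D / (4 * pi))) = k + \<omega> Y" if "0 < Y" "Y < 1" for Y
    proof -
      have p1: "Y powr (- (1 / 3)) = Y powr (2 / 3) / Y" "Y powr (1 / 3) = Y powr (4 / 3) / Y"
        using pY[OF that(1)] by simp_all
      have g: "1 + (1 - Y\<^sup>2) * (2 * A / 3 * Y powr (- (1 / 3)) - e Y)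
          = 1 - (1 - Y\<^sup>2) / (2 * pi * Y) * (LINT x|lborel. Z (Y * x) * kern x)"
        unfolding R1[OF that(1)] e_def p1 using that by (simp add: field_simps)
      have h: "k + (1 - Y\<^sup>2) * (2 * A\<^sup>2 / 3 * Y powr (1 / 3) + f Y - D / (4 * pi))
          = k + (1 - Y\<^sup>2) / (4 * pi * Y) * (LINT x|lborel. (Z (Y * x))\<^sup>2 * kern x)"
        unfolding R2[OF that(1)] f_def p1 using that by (simp add: field_simps)
      show ?thesis using prod[OF that] unfolding g h \<omega>_def O1_def O2_def by simp
    qed
    show "((\<lambda>Y. Y powr (1 / 3) * e Y) \<longlongrightarrow> 0) (at_right 0)"
    proof (rule Lim_transform_eventually)
      show "((\<lambda>Y. Y powr (- (2 / 3)) * S1 Y / (2 * pi)) \<longlongrightarrow> 0) (at_right 0)"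
        using tendsto_divide[OF S1_lim tendsto_const[of "2 * pi"]] by simp
    qed (use ev in eventually_elim, simp add: e_def pY[of _ "1 / 3", symmetric, simplified])
    show "((\<lambda>Y. Y powr (1 / 3 - \<mu>) * f Y) \<longlongrightarrow> 2 * A * B * J / (4 * pi)) (at_right 0)"
    proof (rule Lim_transform_eventually)
      show "((\<lambda>Y. Y powr (- (\<mu> + 2 / 3)) * S2 Y / (4 * pi)) \<longlongrightarrow> 2 * A * B * J / (4 * pi)) (at_right 0)"
        by (intro tendsto_divide S2_lim tendsto_const) simp
      show "eventually (\<lambda>Y. Y powr (- (\<mu> + 2 / 3)) * S2 Y / (4 * pi) = Y powr (1 / 3 - \<mu>) * f Y) (at_right 0)"
        using ev
      proof eventually_elim
        case (elim Y)
        have "Y powr (- (\<mu> + 2 / 3)) = Y powr (1 / 3 - \<mu>) / Y" using pY[of Y "1 / 3 - \<mu>"] elim by (simp add: algebra_simps)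
        thus ?case by (simp add: f_def)
      qed
    qed
    show "((\<lambda>Y. Y powr (2 / 3 - \<mu>) * \<omega> Y) \<longlongrightarrow> 0) (at_right 0)"
    proof (rule Lim_transform_eventually)
      have "((\<lambda>Y::real. Y\<^sup>2) \<longlongrightarrow> 0) (at_right 0)"
        by (rule tendsto_eq_intros tendsto_ident_at refl | simp)+
      hence "((\<lambda>Y. - ((1 - Y\<^sup>2)\<^sup>2 / (8 * pi\<^sup>2))) \<longlongrightarrow> - ((1 - 0)\<^sup>2 / (8 * pi\<^sup>2))) (at_right 0)"
        by (intro tendsto_intros) auto
      from tendsto_mult[OF this tendsto_mult[OF tendsto_powr_at_right_0[of "s - 4 / 3"] tendsto_mult[OF O1_lim O2_lim]]]
      show "((\<lambda>Y. - ((1 - Y\<^sup>2)\<^sup>2 / (8 * pi\<^sup>2)) * (Y powr (s - 4 / 3) * (Y powr (- \<mu>) * O1 Y * (Y powr (- s) * O2 Y)))) \<longlongrightarrow> 0) (at_right 0)"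
        using s by simp
      show "eventually (\<lambda>Y. - ((1 - Y\<^sup>2)\<^sup>2 / (8 * pi\<^sup>2)) * (Y powr (s - 4 / 3) * (Y powr (- \<mu>) * O1 Y * (Y powr (- s) * O2 Y)))
          = Y powr (2 / 3 - \<mu>) * \<omega> Y) (at_right 0)"
        using ev
      proof eventually_elim
        case (elim Y)
        have "Y powr (s - 4 / 3) * (Y powr (- \<mu>) * Y powr (- s)) = Y powr (2 / 3 - \<mu>) * Y powr (- 2)"
          by (simp add: powr_add[symmetric])
        also have "Y powr (- 2) = 1 / Y\<^sup>2" using elim by (simp add: powr_minus_divide)
        finally have p: "Y powr (s - 4 / 3) * (Y powr (- \<mu>) * Y powr (- s)) = Y powr (2 / 3 - \<mu>) / Y\<^sup>2" by simp
        have "- ((1 - Y\<^sup>2)\<^sup>2 / (8 * pi\<^sup>2)) * (Y powr (s - 4 / 3) * (Y powr (- \<mu>) * O1 Y * (Y powr (- s) * O2 Y)))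
            = - ((1 - Y\<^sup>2)\<^sup>2 / (8 * pi\<^sup>2)) * ((Y powr (s - 4 / 3) * (Y powr (- \<mu>) * Y powr (- s))) * (O1 Y * O2 Y))"
          by (simp only: ac_simps)
        also have "\<dots> = Y powr (2 / 3 - \<mu>) * \<omega> Y" unfolding p \<omega>_def by simp
        finally show ?case .
      qed
    qed
  qed
  define \<kappa> where "\<kappa> = - (B * J / (2 * pi))"
  have "- ((2 * A / 3) * (2 * A * B * J / (4 * pi)) / (2 * A\<^sup>2 / 3)) = \<kappa>"
    using A by (simp add: \<kappa>_def field_simps power2_eq_square)
  hence m: "((\<lambda>Y. Y powr (1 - \<mu>) * (1 - e Y)) \<longlongrightarrow> \<kappa>) (at_right 0)" using m by simp

  (* Passing to the difference of the values at Y/2 and Y removes the summand 1 as well as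
     the unknown constant that e contains when \<mu> > 1. *)
  have half: "filterlim (\<lambda>Y::real. Y / 2) (at_right 0) (at_right 0)"
    by (auto simp: filterlim_at eventually_at_filter intro!: tendsto_eq_intros)
  have "((\<lambda>Y. 2 powr (1 - \<mu>) * ((Y / 2) powr (1 - \<mu>) * (1 - e (Y / 2))) - Y powr (1 - \<mu>) * (1 - e Y))
      \<longlongrightarrow> 2 powr (1 - \<mu>) * \<kappa> - \<kappa>) (at_right 0)"
    by (intro tendsto_diff tendsto_mult tendsto_const m filterlim_compose[OF m half])
  moreover have "eventually (\<lambda>Y. 2 powr (1 - \<mu>) * ((Y / 2) powr (1 - \<mu>) * (1 - e (Y / 2))) - Y powr (1 - \<mu>) * (1 - e Y)
      = - (1 / (2 * pi)) * (Y powr (- \<mu>) * (LINT x|lborel. F1 (Y * x) * kern_diff x))) (at_right 0)"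
    using ev
  proof eventually_elim
    case (elim Y)
    have "S1 (Y / 2) = 2 * (LINT x|lborel. F1 (Y * x) * kern (2 * x))"
      unfolding S1_def by (subst lborel_integral_real_affine[of 2 _ 0]) simp_all
    moreover have "integrable lborel (\<lambda>x. F1 (Y * x) * kern (2 * x))"
      using S1_int[of "Y / 2"] elim lborel_integrable_real_affine_iff[of 2 "\<lambda>x. F1 (Y / 2 * x) * kern x" 0] by simp
    moreover have "F1 (Y * x) * kern_diff x = 4 * (F1 (Y * x) * kern (2 * x)) - F1 (Y * x) * kern x" for x
      by (simp add: kern_diff_def algebra_simps)
    ultimately have d: "(LINT x|lborel. F1 (Y * x) * kern_diff x) = 2 * S1 (Y / 2) - S1 Y"
      using S1_int[of Y] elim by (simp add: S1_def)
    have "2 powr (1 - \<mu>) * ((Y / 2) powr (1 - \<mu>) * (1 - e (Y / 2))) = Y powr (1 - \<mu>) * (1 - e (Y / 2))"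
      using elim by (simp add: powr_divide)
    moreover have "Y powr (1 - \<mu>) = Y * Y powr (- \<mu>)" using elim by (simp add: powr_diff powr_minus_divide)
    ultimately have "2 powr (1 - \<mu>) * ((Y / 2) powr (1 - \<mu>) * (1 - e (Y / 2))) - Y powr (1 - \<mu>) * (1 - e Y)
        = Y powr (- \<mu>) * (Y * (e Y - e (Y / 2)))"
      by (simp add: algebra_simps)
    moreover have "Y * (e Y - e (Y / 2)) = - (1 / (2 * pi)) * (2 * S1 (Y / 2) - S1 Y)"
      unfolding e_def using elim by (simp add: field_simps)
    ultimately show ?case unfolding d by simp
  qed
  ultimately have lim1: "((\<lambda>Y. - (1 / (2 * pi)) * (Y powr (- \<mu>) * (LINT x|lborel. F1 (Y * x) * kern_diff x)))
      \<longlongrightarrow> 2 powr (1 - \<mu>) * \<kappa> - \<kappa>) (at_right 0)"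
    by (rule Lim_transform_eventually)
  have J4: "B * (LINT x|lborel. \<bar>x\<bar> powr \<mu> * kern_diff x) = B * ((2 powr (1 - \<mu>) - 1) * J)"
    if int: "integrable lborel (\<lambda>x. \<bar>x\<bar> powr \<mu> * kern_diff x)"
  proof -
    have "((\<lambda>Y. - (1 / (2 * pi)) * (Y powr (- \<mu>) * (LINT x|lborel. F1 (Y * x) * kern_diff x)))
      \<longlongrightarrow> - (1 / (2 * pi)) * (B * (LINT x|lborel. \<bar>x\<bar> powr \<mu> * kern_diff x))) (at_right 0)"
      by (intro tendsto_mult tendsto_const scaling_limit[OF _ _ C1 F1_lim int]) auto
    from tendsto_unique[OF _ this lim1] show ?thesis
      by (simp add: \<kappa>_def field_simps)
  qed
  have "\<mu> \<noteq> 1"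
  proof
    assume "\<mu> = 1"
    with J4 kern_diff_moment_one B show False by (simp add: has_bochner_integral_iff)
  qed
  have p2: "2 powr (1 - \<mu>) \<noteq> 1" using \<open>\<mu> \<noteq> 1\<close> by (simp add: powr_eq_one_iff_gen)
  have "(2 powr (1 - \<mu>) - 1) * J = (2 powr (1 - \<mu>) - 1) * - (pi * \<mu> / cos (pi * \<mu> / 2))"
    using J4 kern_diff_moment[of \<mu>] \<mu> \<open>\<mu> \<noteq> 1\<close> B by (simp add: has_bochner_integral_iff)
  moreover have "2 powr (1 - \<mu>) - 1 \<noteq> 0" using p2 by simp
  ultimately have "J = - (pi * \<mu> / cos (pi * \<mu> / 2))"
    by (simp only: mult_cancel_left simp_thms)
  moreover have "pi * (\<mu> + 2 / 3) / 2 = pi * \<mu> / 2 + pi / 3" by (simp add: algebra_simps)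
  ultimately have "pi * (\<mu> + 2 / 3) / cos (pi * \<mu> / 2 + pi / 3) = pi * \<mu> / cos (pi * \<mu> / 2)"
    unfolding J_def by simp
  hence "pi * ((\<mu> + 2 / 3) / cos (pi * \<mu> / 2 + pi / 3)) = pi * (\<mu> / cos (pi * \<mu> / 2))"
    by (simp only: times_divide_eq_right)
  hence eq: "(\<mu> + 2 / 3) / cos (pi * \<mu> / 2 + pi / 3) = \<mu> / cos (pi * \<mu> / 2)"
    using mult_left_cancel[OF pi_neq_zero] by blast
  have "pi / 3 < pi * \<mu> / 2" "pi * \<mu> / 2 < pi" using \<mu> by (auto simp: field_simps)
  hence "cos (pi * \<mu> / 2 + pi / 3) < 0" by (intro cos_neg_between) linarith+
  moreover from this eq \<mu> have "cos (pi * \<mu> / 2) \<noteq> 0" by auto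
  ultimately show ?thesis using eq \<open>\<mu> \<noteq> 1\<close> by (simp add: field_simps)
qed

section \<open>Fourier coefficients on the circle\<close>

lemma set_integrable_mult_bounded:
  fixes f :: "real \<Rightarrow> real" and \<phi> :: "real \<Rightarrow> complex"
  assumes f: "set_integrable lborel S f" and \<phi>[measurable]: "\<phi> \<in> borel_measurable borel"
    and b: "\<And>u. u \<in> S \<Longrightarrow> norm (\<phi> u) \<le> C"
  shows "set_integrable lborel S (\<lambda>u. of_real (f u) * \<phi> u)"
proof -
  have i: "integrable lborel (\<lambda>u. indicator S u *\<^sub>R f u)" using f by (simp add: set_integrable_def)
  have [measurable]: "(\<lambda>u. indicator S u *\<^sub>R f u) \<in> borel_measurable lborel"
    using i by (rule borel_measurable_integrable)
  have "integrable lborel (\<lambda>u. of_real (indicator S u *\<^sub>R f u) * \<phi> u)"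
  proof (rule Bochner_Integration.integrable_bound)
    show "integrable lborel (\<lambda>u. C * (indicator S u *\<^sub>R f u))" using i by (rule integrable_mult_right)
    show "AE u in lborel. norm (of_real (indicator S u *\<^sub>R f u) * \<phi> u) \<le> norm (C * (indicator S u *\<^sub>R f u))"
    proof (rule AE_I2)
      fix u
      show "norm (of_real (indicator S u *\<^sub>R f u) * \<phi> u) \<le> norm (C * (indicator S u *\<^sub>R f u))"
      proof (cases "u \<in> S")
        case True
        have "\<bar>f u\<bar> * norm (\<phi> u) \<le> \<bar>f u\<bar> * \<bar>C\<bar>"
          using b[OF True] by (intro mult_left_mono) auto
        thus ?thesis using True by (simp add: norm_mult abs_mult mult.commute)
      qed simp
    qed
  qed measurable
  moreover have "(\<lambda>u. of_real (indicator S u *\<^sub>R f u) * \<phi> u) = (\<lambda>u. indicator S u *\<^sub>R (of_real (f u) * \<phi> u))"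
    by (auto simp: indicator_def)
  ultimately show ?thesis by (simp add: set_integrable_def)
qed

lemma continuous_on_cis_mult [continuous_intros]:
  "continuous_on A g \<Longrightarrow> continuous_on A (\<lambda>u. cis (g u))"
  by (simp add: cis_conv_exp continuous_intros)

lemma fourier_coeff_integrable:
  assumes "set_integrable lborel {-pi..pi} f"
  shows "set_integrable lborel {-pi..pi} (\<lambda>u. complex_of_real (f u) * cis (- (of_int n * u)))"
  by (rule set_integrable_mult_bounded[OF assms, where C = 1])
     (auto intro!: borel_measurable_continuous_onI continuous_intros)

lemma fourier_coeff_add:
  assumes "set_integrable lborel {-pi..pi} f" "set_integrable lborel {-pi..pi} g"
  shows "fourier_coeff (\<lambda>u. f u + g u) n = fourier_coeff f n + fourier_coeff g n"
  using set_integral_add(2)[OF fourier_coeff_integrable[OF assms(1)] fourier_coeff_integrable[OF assms(2)], of n n]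
  by (simp add: fourier_coeff_def algebra_simps add_divide_distrib)

lemma fourier_coeff_cmult: "fourier_coeff (\<lambda>u. a * f u) n = of_real a * fourier_coeff f n"
  by (simp add: fourier_coeff_def mult.assoc)

lemma fourier_coeff_cnj: "cnj (fourier_coeff f n) = fourier_coeff f (- n)"
proof -
  have "cnj (LINT u|lborel. indicator {-pi..pi} u *\<^sub>R (complex_of_real (f u) * cis (- (of_int n * u))))
      = (LINT u|lborel. cnj (indicator {-pi..pi} u *\<^sub>R (complex_of_real (f u) * cis (- (of_int n * u)))))"
    by (rule Bochner_Integration.integral_cnj[symmetric])
  thus ?thesis unfolding fourier_coeff_def set_lebesgue_integral_def by (simp add: cis_cnj)
qed

lemma fourier_coeff_cong_AE:
  assumes "AE u in lborel. f u = g u" "f \<in> borel_measurable borel" "g \<in> borel_measurable borel"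
  shows "fourier_coeff f n = fourier_coeff g n"
proof -
  have [measurable]: "(\<lambda>u. cis (- (of_int n * u))) \<in> borel_measurable borel"
    by (intro borel_measurable_continuous_onI continuous_intros)
  note [measurable] = assms(2,3)
  show ?thesis
    unfolding fourier_coeff_def set_lebesgue_integral_def
    by (intro arg_cong2[where f = "(/)"] integral_cong_AE) (use assms(1) in \<open>auto elim!: eventually_mono\<close>)
qed

lemma fourier_coeff_const: "fourier_coeff (\<lambda>_. a) n = (if n = 0 then of_real a else 0)"
proof -
  have "(LINT u:{-pi..pi}|lborel. cis (- (of_int n * u))) = (if n = 0 then of_real (2 * pi) else 0)"
  proof (cases "n = 0")
    case False
    define F where "F = (\<lambda>u::real. cis (- (of_int n * u)) * (\<i> / of_int n))"
    have d: "(F has_vector_derivative cis (- (of_int n * u))) (at u within A)" for u A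
    proof -
      have "((\<lambda>w. exp (- (\<i> * of_int n * w)) * (\<i> / of_int n)) has_field_derivative exp (- (\<i> * of_int n * of_real u))) (at (of_real u))"
        using False by (auto intro!: derivative_eq_intros)
      from has_vector_derivative_real_field[OF this] show ?thesis
        by (simp add: F_def cis_conv_exp mult_ac)
    qed
    have "(LINT u:{-pi..pi}|lborel. cis (- (of_int n * u))) = F pi - F (- pi)"
      by (subst set_borel_integral_eq_integral, rule borel_integrable_atLeastAtMost', intro continuous_intros)
         (intro integral_unique fundamental_theorem_of_calculus d; simp)
    also have "\<dots> = 0"
    proof -
      have "cis (- (of_int n * pi)) = cis (- (of_int n * - pi))"
        by (simp add: complex_eq_iff sin_int_times_real cos_int_times_real mult.commute)
      thus ?thesis by (simp add: F_def)
    qed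
    finally show ?thesis using False by simp
  qed (simp add: set_lebesgue_integral_def scaleR_conv_of_real)
  thus ?thesis
    by (auto simp: fourier_coeff_def set_lebesgue_integral_def field_simps scaleR_conv_of_real)
qed

text \<open>
  Termwise integration of an absolutely convergent trigonometric series against \<open>f\<close>.
\<close>

lemma fourier_coeff_series_sums:
  fixes c :: "nat \<Rightarrow> complex" and \<nu> :: "nat \<Rightarrow> int"
  assumes f: "set_integrable lborel {-pi..pi} f" and c: "summable (\<lambda>n. norm (c n))"
  shows "(\<lambda>n. c n * fourier_coeff f (\<nu> n)) sums
     ((LINT u:{-pi..pi}|lborel. complex_of_real (f u) * (\<Sum>n. c n * cis (- (of_int (\<nu> n) * u)))) / complex_of_real (2 * pi))"
proof -
  let ?S = "{-pi..pi}"
  let ?g = "\<lambda>n u. indicator ?S u *\<^sub>R (complex_of_real (f u) * (c n * cis (- (of_int (\<nu> n) * u))))"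
  have fi: "integrable lborel (\<lambda>u. indicator ?S u *\<^sub>R f u)" using f by (simp add: set_integrable_def)
  have gi: "integrable lborel (?g n)" for n
  proof -
    have "set_integrable lborel ?S (\<lambda>u. complex_of_real (f u) * (c n * cis (- (of_int (\<nu> n) * u))))"
      by (rule set_integrable_mult_bounded[OF f, where C = "norm (c n)"])
         (auto intro!: borel_measurable_continuous_onI continuous_intros simp: norm_mult)
    thus ?thesis by (simp add: set_integrable_def)
  qed
  have ng: "norm (?g n u) = norm (c n) * \<bar>indicator ?S u *\<^sub>R f u\<bar>" for n u
    by (simp add: norm_mult abs_mult mult_ac)
  have sm: "(\<lambda>n. integral\<^sup>L lborel (?g n)) sums (\<integral>u. (\<Sum>n. ?g n u) \<partial>lborel)"
  proof (rule sums_integral[OF gi])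
    show "AE u in lborel. summable (\<lambda>n. norm (?g n u))"
      unfolding ng by (intro AE_I2 summable_mult2 c)
    show "summable (\<lambda>n. \<integral>u. norm (?g n u) \<partial>lborel)"
      unfolding ng by (simp add: summable_mult2 c)
  qed
  have "integral\<^sup>L lborel (?g n) = c n * (LINT u:?S|lborel. complex_of_real (f u) * cis (- (of_int (\<nu> n) * u)))" for n
    unfolding set_lebesgue_integral_def
    by (subst integral_mult_right_zero[symmetric]) (simp add: mult_ac scaleR_conv_of_real)
  moreover have "(\<Sum>n. ?g n u) = indicator ?S u *\<^sub>R (complex_of_real (f u) * (\<Sum>n. c n * cis (- (of_int (\<nu> n) * u))))" for u
  proof -
    have "summable (\<lambda>n. c n * cis (- (of_int (\<nu> n) * u)))"
      by (rule summable_norm_cancel) (use c in \<open>simp add: norm_mult\<close>)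
    from suminf_mult[OF this, of "of_real (indicator ?S u * f u)"] show ?thesis
      by (simp add: scaleR_conv_of_real mult.assoc)
  qed
  ultimately show ?thesis
    using sums_divide[OF sm, of "complex_of_real (2 * pi)"]
    by (simp add: fourier_coeff_def set_lebesgue_integral_def)
qed

text \<open>
  The substitution \<open>u = 2 arctan (Y x)\<close>: the stereographic projection of the circle followed by
  the dilation of the line that resolves the scale \<open>Y\<close> near \<open>u = 0\<close>.
\<close>

lemma

  fixes f :: "real \<Rightarrow> complex"
  assumes f: "continuous_on UNIV f" and Y: "Y > 0"
  shows circle_integrable_imp_line_integrable:
      "integrable lborel (\<lambda>x. (2 * Y / (1 + (Y * x)\<^sup>2)) *\<^sub>R f (2 * arctan (Y * x)))" (is ?int)
    and circle_integral_eq_line_integral: "(LINT u:{-pi..pi}|lborel. f u) = (LINT x|lborel. (2 * Y / (1 + (Y * x)\<^sup>2)) *\<^sub>R f (2 * arctan (Y * x)))" (is ?eq)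
proof -
  let ?g = "\<lambda>x. 2 * arctan (Y * x)" and ?g' = "\<lambda>x. 2 * Y / (1 + (Y * x)\<^sup>2)"
  have [measurable]: "f \<in> borel_measurable borel" by (rule borel_measurable_continuous_onI[OF f])
  have ar: "- pi < ?g x \<and> ?g x < pi" for x using arctan_bounded[of "Y * x"] by auto
  have fi: "set_integrable lborel {-pi..pi} f"
    by (rule borel_integrable_atLeastAtMost') (rule continuous_on_subset[OF f], simp)
  have "compact (f ` {-pi..pi})"
    by (intro compact_continuous_image continuous_on_subset[OF f]) auto
  then obtain C where C: "\<And>u. u \<in> {-pi..pi} \<Longrightarrow> norm (f u) \<le> C"
    using compact_imp_bounded bounded_iff by (metis image_eqI)
  have g'i: "integrable lborel ?g'"
  proof -
    have "integrable lborel (\<lambda>x::real. 1 / (1 + x\<^sup>2))"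
      by (rule integrable_cong_AE_imp[where g = "\<lambda>x::real. \<bar>x\<bar> powr 0 / (1 + x\<^sup>2)"])
         (use rational_moments(1)[of 0] AE_lborel_neq_0 in \<open>auto simp: has_bochner_integral_iff elim!: eventually_mono\<close>)
    hence "integrable lborel (\<lambda>x::real. 1 / (1 + (0 + Y * x)\<^sup>2))"
      using Y by (intro lborel_integrable_real_affine[where f = "\<lambda>x. 1 / (1 + x\<^sup>2)"]) auto
    from integrable_mult_right[OF this, of "2 * Y"] show ?thesis by simp
  qed
  have int: "integrable lborel (\<lambda>x. ?g' x *\<^sub>R f (?g x))"
  proof (rule Bochner_Integration.integrable_bound)
    show "integrable lborel (\<lambda>x. C * ?g' x)" using g'i by (rule integrable_mult_right)
    show "AE x in lborel. norm (?g' x *\<^sub>R f (?g x)) \<le> norm (C * ?g' x)"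
    proof (rule AE_I2)
      fix x
      have "norm (f (?g x)) \<le> \<bar>C\<bar>" using C[of "?g x"] ar[of x] by force
      hence "\<bar>?g' x\<bar> * norm (f (?g x)) \<le> \<bar>?g' x\<bar> * \<bar>C\<bar>" by (intro mult_left_mono) auto
      thus "norm (?g' x *\<^sub>R f (?g x)) \<le> norm (C * ?g' x)" by (simp only: norm_scaleR real_norm_def abs_mult mult.commute)
    qed
  qed measurable
  show ?int by (rule int)
  have lim: "(?g \<longlongrightarrow> pi) at_top" "(?g \<longlongrightarrow> - pi) at_bot"
  proof -
    have "filterlim (\<lambda>x. Y * x) at_top at_top" "filterlim (\<lambda>x. Y * x) at_bot at_bot"
      using Y by (auto intro: filterlim_tendsto_pos_mult_at_top filterlim_tendsto_pos_mult_at_bot filterlim_ident)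
    from tendsto_mult[OF tendsto_const[of 2] filterlim_compose[OF tendsto_arctan_at_top this(1)]]
      tendsto_mult[OF tendsto_const[of 2] filterlim_compose[OF tendsto_arctan_at_bot this(2)]]
    show "(?g \<longlongrightarrow> pi) at_top" "(?g \<longlongrightarrow> - pi) at_bot" by simp_all
  qed
  have "(LBINT u=ereal (- pi)..ereal pi. f u) = (LBINT x=-\<infinity>..\<infinity>. ?g' x *\<^sub>R f (?g x))"
  proof (rule interval_integral_substitution_integrable)
    show "DERIV ?g x :> ?g' x" for x
      using Y by (auto intro!: derivative_eq_intros simp: power2_eq_square divide_inverse)
    show "isCont f (?g x)" for x using f by (simp add: continuous_on_eq_continuous_at)
    show "isCont ?g' x" for x
      using one_plus_square_pos by (auto intro!: continuous_intros)
    show "0 \<le> ?g' x" for x using Y by simp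
    show "((ereal \<circ> ?g \<circ> real_of_ereal) \<longlongrightarrow> ereal (- pi)) (at_right (- \<infinity>))"
      using lim by (simp add: ereal_tendsto_simps)
    show "((ereal \<circ> ?g \<circ> real_of_ereal) \<longlongrightarrow> ereal pi) (at_left \<infinity>)"
      using lim by (simp add: ereal_tendsto_simps)
    show "set_integrable lborel (einterval (- \<infinity>) \<infinity>) (\<lambda>x. ?g' x *\<^sub>R f (?g x))"
      using int by (simp add: set_integrable_def einterval_def)
    show "set_integrable lborel (einterval (ereal (- pi)) (ereal pi)) f"
      by (rule set_integrable_subset[OF fi]) (auto simp: einterval_def)
  qed auto
  thus ?eq
    by (simp add: interval_integral_Icc[symmetric] interval_lebesgue_integral_def[of _ "- \<infinity>"] set_lebesgue_integral_def[of _ UNIV] einterval_def)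
qed

text \<open>
  The integral of a periodic function over \<open>[x - \<pi>, x + \<pi>]\<close> has derivative
  \<open>f (x + \<pi>) - f (x - \<pi>) = 0\<close> in \<open>x\<close>.
\<close>

lemma circle_integral_shift:
  fixes f :: "real \<Rightarrow> complex"
  assumes f: "continuous_on UNIV f" and per: "\<And>u. f (u + 2 * pi) = f u"
  shows "(LINT u:{-pi..pi}|lborel. f (a + u)) = (LINT u:{-pi..pi}|lborel. f u)"
proof -
  have c: "continuous_on A (\<lambda>u. f (g u))" if "continuous_on A g" for A and g :: "real \<Rightarrow> real"
    using continuous_on_compose2[OF f that] by simp
  have fc: "continuous_on A f" for A using continuous_on_subset[OF f] by simp
  have int: "f integrable_on {x..y}" for x y by (intro integrable_continuous_interval fc)
  define N where "N = \<bar>a\<bar> + 2 * pi"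
  have shift: "integral {x - pi..x + pi} f = integral {- pi..pi} f" if "\<bar>x\<bar> \<le> \<bar>a\<bar>" for x
  proof -
    define G where "G = (\<lambda>x. integral {- N..x} f)"
    have dG: "(G has_vector_derivative f x) (at x)" if "\<bar>x\<bar> < N" for x
    proof -
      have "(G has_vector_derivative f x) (at x within {- N..N})"
        unfolding G_def using that by (intro integral_has_vector_derivative fc) auto
      thus ?thesis using that at_within_Icc_at[of "- N" x N] by simp
    qed
    have eq: "integral {x - pi..x + pi} f = G (x + pi) - G (x - pi)" if "\<bar>x\<bar> \<le> \<bar>a\<bar>" for x
    proof -
      have "- N \<le> x - pi" "x - pi \<le> x + pi" using that pi_gt_zero unfolding N_def by linarith+
      hence "integral {- N..x - pi} f + integral {x - pi..x + pi} f = integral {- N..x + pi} f"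
        by (rule Henstock_Kurzweil_Integration.integral_combine) (rule int)
      thus ?thesis unfolding G_def by (simp add: algebra_simps)
    qed
    have "((\<lambda>x. G (x + pi) - G (x - pi)) has_vector_derivative 0) (at y within {- \<bar>a\<bar>..\<bar>a\<bar>})" if "y \<in> {- \<bar>a\<bar>..\<bar>a\<bar>}" for y
    proof -
      have y: "\<bar>y + pi\<bar> < N" "\<bar>y - pi\<bar> < N" using that pi_gt_zero unfolding N_def atLeastAtMost_iff by linarith+
      have tp: "((\<lambda>x. x + pi) has_vector_derivative 1) (at y)" and tm: "((\<lambda>x. x - pi) has_vector_derivative 1) (at y)"
        unfolding has_real_derivative_iff_has_vector_derivative[symmetric]
        by (auto intro!: derivative_eq_intros)
      have "f (y - pi) = f (y + pi)" using per[of "y - pi"] by (simp add: add.commute)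
      moreover have "((\<lambda>x. G (x + pi)) has_vector_derivative (1 *\<^sub>R f (y + pi))) (at y)"
        using vector_diff_chain_at[of "\<lambda>x. x + pi" 1 y G "f (y + pi)", OF _ dG[OF y(1)]] tp
        by (simp add: o_def)
      moreover have "((\<lambda>x. G (x - pi)) has_vector_derivative (1 *\<^sub>R f (y - pi))) (at y)"
        using vector_diff_chain_at[of "\<lambda>x. x - pi" 1 y G "f (y - pi)", OF _ dG[OF y(2)]] tm
        by (simp add: o_def)
      ultimately have "((\<lambda>x. G (x + pi) - G (x - pi)) has_vector_derivative 0) (at y)"
        using has_vector_derivative_diff by fastforce
      thus ?thesis by (rule has_vector_derivative_at_within)
    qed
    then obtain z where z: "\<And>y. y \<in> {- \<bar>a\<bar>..\<bar>a\<bar>} \<Longrightarrow> G (y + pi) - G (y - pi) = z"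
      using has_vector_derivative_zero_constant[of "{- \<bar>a\<bar>..\<bar>a\<bar>}" "\<lambda>x. G (x + pi) - G (x - pi)"] by auto
    have "G (x + pi) - G (x - pi) = G (0 + pi) - G (0 - pi)"
      using z[of x] z[of 0] that by (simp add: abs_le_iff)
    thus ?thesis using eq[of x] eq[of 0] that by simp
  qed
  have "(LINT u:{-pi..pi}|lborel. f (a + u)) = integral {-pi..pi} (\<lambda>u. f (a + u))"
    by (intro set_borel_integral_eq_integral borel_integrable_atLeastAtMost' c continuous_intros)
  also have "\<dots> = integral {a - pi..a + pi} f"
    using integral_shift_Icc_real[of "-pi" pi f a] by (simp add: o_def add.commute)
  also have "\<dots> = integral {-pi..pi} f" by (rule shift) simp
  also have "\<dots> = (LINT u:{-pi..pi}|lborel. f u)"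
    by (intro set_borel_integral_eq_integral(2)[symmetric] borel_integrable_atLeastAtMost' fc)
  finally show ?thesis .
qed

lemma cis_minus_two_arctan: "cis (- (2 * arctan t)) = (1 - \<i> * of_real t) / (1 + \<i> * of_real t)"
proof -
  have n: "1 + \<i> * of_real t \<noteq> (0 :: complex)" by (auto simp: complex_eq_iff)
  have p: "1 + t\<^sup>2 > 0" by (rule one_plus_square_pos)
  have c: "cis (- arctan t) = (1 - \<i> * of_real t) / of_real (sqrt (1 + t\<^sup>2))"
    by (simp add: complex_eq_iff cos_arctan sin_arctan)
  have "cis (- (2 * arctan t)) = (cis (- arctan t))\<^sup>2"
    by (simp only: Complex.DeMoivre) simp
  also have "\<dots> = (1 - \<i> * of_real t)\<^sup>2 / of_real ((sqrt (1 + t\<^sup>2))\<^sup>2)"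
    unfolding c by (simp only: power_divide of_real_power)
  also have "(sqrt (1 + t\<^sup>2))\<^sup>2 = 1 + t\<^sup>2" using p by simp
  also have "complex_of_real (1 + t\<^sup>2) = (1 - \<i> * of_real t) * (1 + \<i> * of_real t)"
    by (simp add: complex_eq_iff power2_eq_square)
  also have "(1 - \<i> * of_real t)\<^sup>2 / ((1 - \<i> * of_real t) * (1 + \<i> * of_real t)) = (1 - \<i> * of_real t) / (1 + \<i> * of_real t)"
  proof -
    have "1 - \<i> * of_real t \<noteq> (0 :: complex)" by (auto simp: complex_eq_iff)
    thus ?thesis using n by (simp add: power2_eq_square)
  qed
  finally show ?thesis .
qed

text \<open>
  The Cayley transform sends \<open>z = r e\<^sup>-\<^sup>i\<^sup>u\<close> with \<open>r = (1 - Y) / (1 + Y)\<close> and \<open>u = 2 arctan t\<close> to the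
  half plane. The first equation is for the Herglotz kernel, whose real part is the Poisson kernel;
  the second one is for the function \<open>z / (1 - z)\<^sup>2 = \<Sum> n z\<^sup>n\<close>, which generates the sums
  \<open>\<Sum> n a\<^sub>n r\<^sup>n\<close>.
\<close>

lemma cayley_disc:
  fixes Y t :: real
  assumes Y: "0 < Y"
  defines "z \<equiv> of_real ((1 - Y) / (1 + Y)) * cis (- (2 * arctan t))"
  shows "2 / (1 - z) - 1 = (1 + \<i> * of_real (Y * t)) / (of_real Y + \<i> * of_real t)"
    and "z / (1 - z)\<^sup>2 = of_real ((1 - Y\<^sup>2) * (1 + t\<^sup>2) / 4) / (of_real Y + \<i> * of_real t)\<^sup>2"
proof -
  define y w :: complex where "y = of_real Y" and "w = \<i> * of_real t"
  have n: "1 + w \<noteq> 0" "y + w \<noteq> 0" "1 + y \<noteq> 0"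
    using Y by (auto simp: complex_eq_iff y_def w_def)
  have z: "z = (1 - y) * (1 - w) / ((1 + y) * (1 + w))"
    unfolding z_def cis_minus_two_arctan by (simp add: y_def w_def)
  have 1: "1 - z = 2 * (y + w) / ((1 + y) * (1 + w))"
    unfolding z using n by (simp add: divide_simps) (simp add: algebra_simps)
  have "2 / (2 * s / D) = D / s" for s D :: complex by simp
  from this[of "y + w" "(1 + y) * (1 + w)"] have "2 / (1 - z) = (1 + y) * (1 + w) / (y + w)" unfolding 1 .
  hence "2 / (1 - z) - 1 = (1 + y) * (1 + w) / (y + w) - (y + w) / (y + w)" using n by simp
  also have "\<dots> = (1 + y * w) / (y + w)"
    unfolding diff_divide_distrib[symmetric] by (simp add: algebra_simps)
  finally have "2 / (1 - z) - 1 = (1 + y * w) / (y + w)" .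
  thus "2 / (1 - z) - 1 = (1 + \<i> * of_real (Y * t)) / (of_real Y + \<i> * of_real t)"
    by (simp add: y_def w_def algebra_simps)
  have "z / (1 - z)\<^sup>2 = (1 - y) * (1 - w) * (1 + y) * (1 + w) / (4 * (y + w)\<^sup>2)"
  proof -
    have "N / D / (2 * s / D)\<^sup>2 = N * D / (4 * s\<^sup>2)" if "D \<noteq> 0" for N D s :: complex
      using that by (simp add: power2_eq_square field_simps)
    from this[of "(1 + y) * (1 + w)" "(1 - y) * (1 - w)" "y + w"] show ?thesis
      unfolding 1 using n by (simp add: z mult.assoc)
  qed
  also have "(1 - y) * (1 - w) * (1 + y) * (1 + w) = of_real ((1 - Y\<^sup>2) * (1 + t\<^sup>2))"
  proof -
    have "(1 - y) * (1 - w) * (1 + y) * (1 + w) = (1 - y\<^sup>2) * (1 - w\<^sup>2)"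
      by (simp add: algebra_simps power2_eq_square)
    thus ?thesis by (simp add: y_def w_def power_mult_distrib)
  qed
  finally show "z / (1 - z)\<^sup>2 = of_real ((1 - Y\<^sup>2) * (1 + t\<^sup>2) / 4) / (of_real Y + \<i> * of_real t)\<^sup>2"
    by (simp add: y_def w_def)
qed

lemma geometric_disc:
  assumes "0 < Y" "Y < 1"
  defines "r \<equiv> (1 - Y) / (1 + Y) :: real"
  shows "0 < r" "r < 1" "norm (of_real r * cis x) < 1" "1 - of_real r * cis x \<noteq> 0"
proof -
  show r: "0 < r" "r < 1" using assms by (auto simp: r_def)
  thus n: "norm (of_real r * cis x) < 1" by (simp add: norm_mult)
  show "1 - of_real r * cis x \<noteq> 0" using n by force
qed

lemma bounded_on_circle:
  fixes D :: "real \<Rightarrow> real"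
  assumes "continuous_on UNIV D"
  obtains C where "\<And>t. \<bar>D (2 * arctan t)\<bar> \<le> C"
proof -
  have "compact (D ` {-pi..pi})"
    by (intro compact_continuous_image continuous_on_subset[OF assms]) auto
  then obtain C where C: "\<And>u. u \<in> {-pi..pi} \<Longrightarrow> norm (D u) \<le> C"
    using compact_imp_bounded bounded_iff by (metis image_eqI)
  have "\<bar>D (2 * arctan t)\<bar> \<le> C" for t
    using C[of "2 * arctan t"] arctan_bounded[of t] by simp
  thus ?thesis by (rule that)
qed

lemma set_integrable_circle_continuous:
  fixes f :: "real \<Rightarrow> 'a :: euclidean_space"
  assumes "continuous_on UNIV f"
  shows "set_integrable lborel {-pi..pi} f"
  by (rule borel_integrable_atLeastAtMost') (rule continuous_on_subset[OF assms], simp)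

lemma fourier_coeff_shift:
  assumes D: "continuous_on UNIV D" and per: "\<And>u. D (u + 2 * pi) = D u"
  shows "fourier_coeff (\<lambda>v. D (a + v)) n = cis (of_int n * a) * fourier_coeff D n"
proof -
  let ?f = "\<lambda>v. complex_of_real (D v) * cis (- (of_int n * (v - a)))"
  have "(LINT v:{-pi..pi}|lborel. ?f (a + v)) = (LINT v:{-pi..pi}|lborel. ?f v)"
  proof (rule circle_integral_shift)
    show "continuous_on UNIV ?f" by (intro continuous_intros D)
    fix u
    have "cis (- (of_int n * (u + 2 * pi - a))) = cis (- (of_int n * (u - a))) * cis (2 * pi * of_int (- n))"
      by (subst cis_mult) (simp add: algebra_simps)
    also have "cis (2 * pi * of_int (- n)) = 1" by (rule cis_multiple_2pi) simp
    finally show "?f (u + 2 * pi) = ?f u" by (simp add: per)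
  qed
  moreover have "?f v = cis (of_int n * a) * (complex_of_real (D v) * cis (- (of_int n * v)))" for v
    by (simp add: cis_mult algebra_simps)
  ultimately have "(LINT v:{-pi..pi}|lborel. complex_of_real (D (a + v)) * cis (- (of_int n * v)))
      = cis (of_int n * a) * (LINT v:{-pi..pi}|lborel. complex_of_real (D v) * cis (- (of_int n * v)))"
    by simp
  thus ?thesis by (simp add: fourier_coeff_def)
qed

text \<open>
  All Poisson integrals of \<open>D\<close> vanish. On the line the Poisson kernel is \<open>1 / (1 + x\<^sup>2)\<close> on the
  scale \<open>Y\<close>, so that by \<open>scaling_limit\<close> with exponent \<open>0\<close> these integrals tend to \<open>\<pi> D a\<close>.
\<close>

lemma fourier_coeff_zero_imp_zero:
  fixes D :: "real \<Rightarrow> real"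
  assumes D: "continuous_on UNIV D" and per: "\<And>u. D (u + 2 * pi) = D u"
    and zero: "\<And>n. fourier_coeff D n = 0"
  shows "D a = 0"
proof -
  define E where "E = (\<lambda>v. D (a + v))"
  have Ec: "continuous_on UNIV E"
    unfolding E_def by (rule continuous_on_compose2[OF D]) (auto intro: continuous_intros)
  have E0: "fourier_coeff E n = 0" for n
    unfolding E_def using fourier_coeff_shift[OF D per] zero by simp
  have Ei: "set_integrable lborel {-pi..pi} E" by (rule set_integrable_circle_continuous[OF Ec])
  have [measurable]: "E \<in> borel_measurable borel" by (rule borel_measurable_continuous_onI[OF Ec])
  have pois: "(LINT x|lborel. E (2 * arctan (Y * x)) * (1 / (1 + x\<^sup>2))) = 0" if Y: "0 < Y" "Y < 1" for Y
  proof -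
    define r where "r = (1 - Y) / (1 + Y)"
    note r = geometric_disc[OF Y, folded r_def]
    let ?z = "\<lambda>v. of_real r * cis (- v)"
    let ?f = "\<lambda>v. complex_of_real (E v) * (2 / (1 - ?z v) - 1)"
    have zc: "continuous_on UNIV (\<lambda>v. 1 / (1 - ?z v))" using r(4) by (intro continuous_intros) auto
    have geo: "(\<Sum>n. of_real (r ^ n) * cis (- (of_int (int n) * v))) = 1 / (1 - ?z v)" for v
    proof -
      have "of_real (r ^ n) * cis (- (of_int (int n) * v)) = ?z v ^ n" for n
        by (simp add: power_mult_distrib Complex.DeMoivre)
      thus ?thesis using suminf_geometric[OF r(3)[of "- v"]] by simp
    qed
    have "(\<lambda>n. complex_of_real (r ^ n) * fourier_coeff E (int n)) sums
       ((LINT v:{-pi..pi}|lborel. complex_of_real (E v) * (1 / (1 - ?z v))) / complex_of_real (2 * pi))"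
      unfolding geo[symmetric] using r by (intro fourier_coeff_series_sums Ei) (simp add: norm_power summable_geometric)
    hence "(\<lambda>n. 0) sums ((LINT v:{-pi..pi}|lborel. complex_of_real (E v) * (1 / (1 - ?z v))) / complex_of_real (2 * pi))"
      by (simp only: E0 mult_zero_right)
    from sums_unique2[OF this sums_zero] have i1: "(LINT v:{-pi..pi}|lborel. complex_of_real (E v) * (1 / (1 - ?z v))) = 0"
      by simp
    have i0: "(LINT v:{-pi..pi}|lborel. complex_of_real (E v)) = 0"
      using E0[of 0] by (simp add: fourier_coeff_def)
    have fe: "?f v = 2 * (complex_of_real (E v) * (1 / (1 - ?z v))) - complex_of_real (E v)" for v
      by (simp add: right_diff_distrib)
    have nz: "of_real r * cis v \<noteq> 1" for v using r(4)[of v] by auto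
    have "(LINT v:{-pi..pi}|lborel. ?f v)
        = (LINT v:{-pi..pi}|lborel. 2 * (complex_of_real (E v) * (1 / (1 - ?z v)))) - (LINT v:{-pi..pi}|lborel. complex_of_real (E v))"
      unfolding fe by (intro set_integral_diff(2) set_integrable_circle_continuous continuous_intros Ec) (use nz in auto)
    also have "(LINT v:{-pi..pi}|lborel. 2 * (complex_of_real (E v) * (1 / (1 - ?z v)))) = 2 * 0"
      unfolding i1[symmetric] by (rule set_integral_mult_right)
    finally have "(LINT v:{-pi..pi}|lborel. ?f v) = 0" unfolding i0 by simp
    hence "0 = (LINT v:{-pi..pi}|lborel. ?f v)" by simp
    also have "\<dots> = (LINT x|lborel. (2 * Y / (1 + (Y * x)\<^sup>2)) *\<^sub>R ?f (2 * arctan (Y * x)))"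
      by (rule circle_integral_eq_line_integral[OF _ Y(1)]) (intro continuous_intros zc Ec; use r(4) in simp)
    finally have F: "(LINT x|lborel. (2 * Y / (1 + (Y * x)\<^sup>2)) *\<^sub>R ?f (2 * arctan (Y * x))) = 0" by simp
    have pt: "Re ((2 * Y / (1 + (Y * x)\<^sup>2)) *\<^sub>R ?f (2 * arctan (Y * x))) = 2 * (E (2 * arctan (Y * x)) * (1 / (1 + x\<^sup>2)))" for x
    proof -
      have "2 / (1 - ?z (2 * arctan (Y * x))) - 1 = (1 + \<i> * of_real (Y * (Y * x))) / (of_real Y + \<i> * of_real (Y * x))"
        unfolding r_def by (rule cayley_disc(1)[OF Y(1)])
      moreover have "Re ((1 + \<i> * of_real (Y * (Y * x))) / (of_real Y + \<i> * of_real (Y * x))) = (1 + (Y * x)\<^sup>2) / (Y * (1 + x\<^sup>2))"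
      proof -
        have "Re ((1 + \<i> * of_real (Y * (Y * x))) / (of_real Y + \<i> * of_real (Y * x)))
            = (Y + Y * (Y * x) * (Y * x)) / (Y\<^sup>2 + (Y * x)\<^sup>2)"
          by (simp add: Re_divide)
        also have "\<dots> = (Y * (1 + (Y * x)\<^sup>2)) / (Y * (Y * (1 + x\<^sup>2)))"
          by (simp add: algebra_simps power2_eq_square)
        also have "\<dots> = (1 + (Y * x)\<^sup>2) / (Y * (1 + x\<^sup>2))" using Y by (subst mult_divide_mult_cancel_left) auto
        finally show ?thesis .
      qed
      ultimately have w: "Re (2 / (1 - ?z (2 * arctan (Y * x))) - 1) = (1 + (Y * x)\<^sup>2) / (Y * (1 + x\<^sup>2))"
        by simp
      have "Re (c *\<^sub>R (complex_of_real e * w)) = c * (e * Re w)" for c e w by simp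
      hence "Re ((2 * Y / (1 + (Y * x)\<^sup>2)) *\<^sub>R ?f (2 * arctan (Y * x)))
          = 2 * Y / (1 + (Y * x)\<^sup>2) * (E (2 * arctan (Y * x)) * ((1 + (Y * x)\<^sup>2) / (Y * (1 + x\<^sup>2))))"
        unfolding w[symmetric] .
      also have "\<dots> = 2 * (E (2 * arctan (Y * x)) * (1 / (1 + x\<^sup>2)))"
        using Y one_plus_square_pos(2)[of "Y * x"] by simp
      finally show ?thesis .
    qed
    have Fint: "integrable lborel (\<lambda>x. (2 * Y / (1 + (Y * x)\<^sup>2)) *\<^sub>R ?f (2 * arctan (Y * x)))"
      by (rule circle_integrable_imp_line_integrable[OF _ Y(1)]) (intro continuous_intros zc Ec; use r(4) in simp)
    have "0 = Re (LINT x|lborel. (2 * Y / (1 + (Y * x)\<^sup>2)) *\<^sub>R ?f (2 * arctan (Y * x)))" unfolding F by simp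
    also have "\<dots> = (LINT x|lborel. 2 * (E (2 * arctan (Y * x)) * (1 / (1 + x\<^sup>2))))"
      unfolding pt[symmetric] by (rule integral_Re[OF Fint, symmetric])
    also have "\<dots> = 2 * (LINT x|lborel. E (2 * arctan (Y * x)) * (1 / (1 + x\<^sup>2)))"
      by (rule integral_mult_right_zero)
    finally show ?thesis by simp
  qed
  obtain C where C: "\<And>t. \<bar>E (2 * arctan t)\<bar> \<le> C" using bounded_on_circle[OF Ec] by blast
  have s0: "has_bochner_integral lborel (\<lambda>x::real. \<bar>x\<bar> powr 0 * (1 / (1 + x\<^sup>2))) pi"
    using rational_moments(1)[of 0] by simp
  have "((\<lambda>Y. Y powr (- 0) * (LINT x|lborel. E (2 * arctan (Y * x)) * (1 / (1 + x\<^sup>2))))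
      \<longlongrightarrow> E 0 * (LINT x|lborel. \<bar>x\<bar> powr 0 * (1 / (1 + x\<^sup>2)))) (at_right 0)"
  proof (rule scaling_limit[where F = "\<lambda>t. E (2 * arctan t)" and C = C])
    have "((\<lambda>t. E (2 * arctan t)) \<longlongrightarrow> E (2 * arctan 0)) (at 0)"
      using Ec by (intro isCont_tendsto_compose[of _ E] tendsto_intros) (auto simp: continuous_on_eq_continuous_at)
    hence "((\<lambda>t. E (2 * arctan t)) \<longlongrightarrow> E 0) (at 0)" by simp
    thus "((\<lambda>t. E (2 * arctan t) / \<bar>t\<bar> powr 0) \<longlongrightarrow> E 0) (at 0)"
      by (rule Lim_transform_eventually) (auto simp: eventually_at_filter)
  qed (use C s0 in \<open>auto simp: has_bochner_integral_iff\<close>)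
  moreover have "eventually (\<lambda>Y. Y powr (- 0) * (LINT x|lborel. E (2 * arctan (Y * x)) * (1 / (1 + x\<^sup>2))) = 0) (at_right 0)"
    using pois by (auto simp: eventually_at_right_field intro!: exI[of _ 1])
  ultimately have lim0: "((\<lambda>Y::real. 0) \<longlongrightarrow> E 0 * (LINT x|lborel. \<bar>x\<bar> powr 0 * (1 / (1 + x\<^sup>2)))) (at_right 0)"
    by (rule Lim_transform_eventually)
  hence "E 0 * pi = 0"
    using s0 tendsto_unique[OF _ lim0 tendsto_const] by (simp add: has_bochner_integral_iff)
  thus ?thesis by (simp add: E_def)
qed

lemma fourier_coeff_bounded:
  assumes f: "set_integrable lborel {-pi..pi} f"
  shows "\<exists>M. \<forall>n. norm (fourier_coeff f n) \<le> M"
proof (intro exI allI)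
  fix n
  have "norm (LINT u:{-pi..pi}|lborel. complex_of_real (f u) * cis (- (of_int n * u)))
      \<le> (LINT u:{-pi..pi}|lborel. norm (complex_of_real (f u) * cis (- (of_int n * u))))"
    by (rule set_integral_norm_bound[OF fourier_coeff_integrable[OF f]])
  thus "norm (fourier_coeff f n) \<le> (LINT u:{-pi..pi}|lborel. \<bar>f u\<bar>) / (2 * pi)"
    by (simp add: fourier_coeff_def norm_mult norm_divide divide_right_mono)
qed

lemma
  fixes g :: "int \<Rightarrow> complex"
  assumes "(\<lambda>m. norm (g m)) summable_on UNIV"
  shows summable_norm_int_decode: "summable (\<lambda>n. norm (g (int_decode n)))"
    and infsum_int_eq_suminf: "(\<Sum>\<^sub>\<infinity>m. g m) = (\<Sum>n. g (int_decode n))"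
proof -
  have "(\<lambda>n. norm (g (int_decode n))) summable_on UNIV"
    using summable_on_reindex_bij_betw[OF bij_int_decode, of "\<lambda>m. norm (g m)"] assms by simp
  thus s: "summable (\<lambda>n. norm (g (int_decode n)))" by (rule summable_on_imp_summable)
  have "((\<lambda>n. g (int_decode n)) has_sum (\<Sum>n. g (int_decode n))) UNIV"
    by (intro norm_summable_imp_has_sum[OF s] summable_sums summable_norm_cancel[OF s])
  hence "(g has_sum (\<Sum>n. g (int_decode n))) UNIV"
    using has_sum_reindex_bij_betw[OF bij_int_decode, of g] by simp
  thus "(\<Sum>\<^sub>\<infinity>m. g m) = (\<Sum>n. g (int_decode n))" by (rule infsumI)
qed

lemma fourier_series_mult:
  fixes c :: "int \<Rightarrow> complex"
  assumes c: "(\<lambda>m. norm (c m)) summable_on UNIV" and f: "set_integrable lborel {-pi..pi} f"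
    and s: "\<And>u. complex_of_real (s u) = (\<Sum>\<^sub>\<infinity>m. c m * cis (of_int m * u))"
  shows "fourier_coeff (\<lambda>u. s u * f u) j = (\<Sum>\<^sub>\<infinity>m. c m * fourier_coeff f (j - m))"
proof -
  have cn: "summable (\<lambda>n. norm (c (int_decode n)))" by (rule summable_norm_int_decode[OF c])
  have s_sum: "complex_of_real (s u) = (\<Sum>n. c (int_decode n) * cis (of_int (int_decode n) * u))" for u
    unfolding s by (rule infsum_int_eq_suminf) (use c in \<open>simp add: norm_mult\<close>)
  let ?t = "\<lambda>n. c (int_decode n) * fourier_coeff f (j - int_decode n)"
  have "?t sums ((LINT u:{-pi..pi}|lborel. complex_of_real (f u) *
      (\<Sum>n. c (int_decode n) * cis (- (of_int (j - int_decode n) * u)))) / complex_of_real (2 * pi))"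
    by (rule fourier_coeff_series_sums[OF f cn])
  also have "(\<lambda>u. complex_of_real (f u) * (\<Sum>n. c (int_decode n) * cis (- (of_int (j - int_decode n) * u))))
      = (\<lambda>u. complex_of_real (s u * f u) * cis (- (of_int j * u)))"
  proof (rule ext)
    fix u
    have "summable (\<lambda>n. c (int_decode n) * cis (of_int (int_decode n) * u))"
      by (rule summable_norm_cancel) (use cn in \<open>simp add: norm_mult\<close>)
    from suminf_mult2[OF this, of "cis (- (of_int j * u))"]
    have "complex_of_real (s u) * cis (- (of_int j * u)) = (\<Sum>n. c (int_decode n) * cis (of_int (int_decode n) * u) * cis (- (of_int j * u)))"
      unfolding s_sum .
    also have "(\<lambda>n. c (int_decode n) * cis (of_int (int_decode n) * u) * cis (- (of_int j * u)))
        = (\<lambda>n. c (int_decode n) * cis (- (of_int (j - int_decode n) * u)))"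
      by (simp add: mult.assoc cis_mult algebra_simps)
    finally show "complex_of_real (f u) * (\<Sum>n. c (int_decode n) * cis (- (of_int (j - int_decode n) * u)))
        = complex_of_real (s u * f u) * cis (- (of_int j * u))"
      by (simp add: mult_ac)
  qed
  finally have sums: "?t sums fourier_coeff (\<lambda>u. s u * f u) j" by (simp add: fourier_coeff_def)
  obtain M where M: "\<And>n. norm (fourier_coeff f n) \<le> M"
    using fourier_coeff_bounded[OF f] by blast
  have "(\<lambda>m. norm (c m * fourier_coeff f (j - m))) summable_on UNIV"
  proof (rule summable_on_comparison_test)
    show "(\<lambda>m. norm (c m) * M) summable_on UNIV" by (rule summable_on_cmult_left[OF c])
    show "norm (c m * fourier_coeff f (j - m)) \<le> norm (c m) * M" for m
      using M by (auto simp: norm_mult intro!: mult_left_mono)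
  qed auto
  from infsum_int_eq_suminf[OF this] show ?thesis using sums_unique[OF sums] by simp
qed

text \<open>
  The sum of the series is continuous and has the same Fourier coefficients as \<open>f\<close>.
\<close>

lemma fourier_inversion:
  fixes f :: "real \<Rightarrow> real"
  assumes f: "continuous_on UNIV f" and per: "\<And>u. f (u + 2 * pi) = f u"
    and c: "(\<lambda>m. norm (fourier_coeff f m)) summable_on UNIV"
  shows "complex_of_real (f u) = (\<Sum>\<^sub>\<infinity>m. fourier_coeff f m * cis (of_int m * u))"
proof -
  let ?c = "fourier_coeff f"
  define S where "S = (\<lambda>u::real. \<Sum>\<^sub>\<infinity>m. ?c m * cis (of_int m * u))"
  define s where "s = (\<lambda>u. Re (S u))"
  have cn: "summable (\<lambda>n. norm (?c (int_decode n)))" by (rule summable_norm_int_decode[OF c])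
  have S_sum: "S u = (\<Sum>n. ?c (int_decode n) * cis (of_int (int_decode n) * u))" for u
    unfolding S_def by (rule infsum_int_eq_suminf) (use c in \<open>simp add: norm_mult\<close>)
  have S_cont: "continuous_on UNIV S"
  proof (rule uniform_limit_theorem)
    show "uniform_limit UNIV (\<lambda>N u. \<Sum>n<N. ?c (int_decode n) * cis (of_int (int_decode n) * u)) S sequentially"
      unfolding S_sum[abs_def] by (rule Weierstrass_m_test[OF _ cn]) (simp add: norm_mult)
  qed (auto intro!: always_eventually continuous_intros)
  have S_per: "S (u + 2 * pi) = S u" for u
  proof -
    have "cis (of_int m * (u + 2 * pi)) = cis (of_int m * u)" for m
    proof -
      have "cis (of_int m * (u + 2 * pi)) = cis (of_int m * u) * cis (2 * pi * of_int m)"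
        by (subst cis_mult) (simp add: algebra_simps)
      thus ?thesis by simp
    qed
    thus ?thesis unfolding S_def by simp
  qed
  have S_real: "S u = of_real (s u)" for u
  proof -
    have "cnj (S u) = (\<Sum>\<^sub>\<infinity>m. ?c (- m) * cis (of_int (- m) * u))"
      unfolding S_def by (simp add: infsum_cnj[symmetric] cis_cnj fourier_coeff_cnj del: infsum_cnj)
    also have "\<dots> = S u"
      unfolding S_def by (rule infsum_reindex_bij_betw[of uminus UNIV UNIV "\<lambda>m. ?c m * cis (of_int m * u)"]) (rule bij_uminus)
    finally have "S u \<in> \<real>" by (simp add: complex_is_Real_iff complex_eq_iff)
    thus ?thesis unfolding s_def by simp
  qed
  have s_cont: "continuous_on UNIV s" unfolding s_def by (intro continuous_intros S_cont)
  have coeff: "fourier_coeff s j = ?c j" for j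
  proof -
    have "fourier_coeff (\<lambda>u. s u * 1) j = (\<Sum>\<^sub>\<infinity>m. ?c m * fourier_coeff (\<lambda>_. 1) (j - m))"
      by (rule fourier_series_mult[OF c]) (auto intro!: set_integrable_circle_continuous simp: S_real[symmetric] S_def)
    also have "\<dots> = (\<Sum>\<^sub>\<infinity>m\<in>{j}. ?c m * fourier_coeff (\<lambda>_. 1) (j - m))"
      by (rule infsum_cong_neutral) (auto simp: fourier_coeff_const)
    finally show ?thesis by (simp add: fourier_coeff_const)
  qed
  have "f u + - 1 * s u = 0"
  proof (rule fourier_coeff_zero_imp_zero[where D = "\<lambda>u. f u + - 1 * s u" and a = u])
    show "continuous_on UNIV (\<lambda>u. f u + - 1 * s u)" by (intro continuous_intros f s_cont)
    show "f (u + 2 * pi) + - 1 * s (u + 2 * pi) = f u + - 1 * s u" for u by (simp add: per s_def S_per)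
    show "fourier_coeff (\<lambda>u. f u + - 1 * s u) n = 0" for n
      using fourier_coeff_add[of f "\<lambda>u. - 1 * s u" n] fourier_coeff_cmult[of "- 1" s n] coeff
        set_integrable_circle_continuous[OF f] set_integrable_circle_continuous[of "\<lambda>u. - s u"] continuous_on_minus[OF s_cont]
      by simp
  qed
  thus ?thesis using S_real[of u] by (simp add: S_def)
qed

text \<open>
  The convolution theorem. The first factor is the sum of its absolutely convergent Fourier series,
  the second one is merely integrable, like the image of \<open>\<eta>\<close> under the multiplier.
\<close>

lemma fourier_coeff_mult:
  fixes f g :: "real \<Rightarrow> real"
  assumes "continuous_on UNIV f" "\<And>u. f (u + 2 * pi) = f u"
    and "(\<lambda>m. norm (fourier_coeff f m)) summable_on UNIV"
    and "set_integrable lborel {-pi..pi} g"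
  shows "fourier_coeff (\<lambda>u. f u * g u) j = (\<Sum>\<^sub>\<infinity>m. fourier_coeff f m * fourier_coeff g (j - m))"
  by (rule fourier_series_mult[OF assms(3,4) fourier_inversion[OF assms(1-3)]])

lemma Koebe_sums:
  fixes z :: "'a :: {real_normed_field, banach}"
  assumes "norm z < 1"
  shows "(\<lambda>n. of_nat n * z ^ n) sums (z / (1 - z)\<^sup>2)"
proof -
  have "(\<lambda>n. z * (of_nat (Suc n) * z ^ n)) sums (z * (1 / (1 - z)\<^sup>2))"
    by (intro sums_mult geometric_deriv_sums assms)
  hence "(\<lambda>n. of_nat (Suc n) * z ^ Suc n) sums (z / (1 - z)\<^sup>2)" by (simp add: mult_ac)
  thus ?thesis by (rule sums_Suc_imp[rotated]) simp
qed

text \<open>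
  The sum is \<open>\<integral> f(u) \<kappa>(r e\<^sup>-\<^sup>i\<^sup>u) du / (2 \<pi>)\<close> with \<open>\<kappa> z = z / (1 - z)\<^sup>2\<close>. Under \<open>u = 2 arctan (Y x)\<close> the
  Jacobian cancels against the factor \<open>1 + t\<^sup>2\<close> in \<open>cayley_disc\<close>, and a constant multiple of
  \<open>1 / (1 + \<i> x)\<^sup>2\<close> remains.
\<close>

lemma disc_derivative_eq_line_integral:
  fixes f :: "real \<Rightarrow> real"
  assumes f: "continuous_on UNIV f" and Y: "0 < Y" "Y < 1"
  shows "(\<lambda>n. of_nat n * fourier_coeff f (int n) * of_real (((1 - Y) / (1 + Y)) ^ n)) sums
     (of_real ((1 - Y\<^sup>2) / (4 * pi * Y)) *
        Complex (LINT x|lborel. f (2 * arctan (Y * x)) * kern x) (LINT x|lborel. f (2 * arctan (Y * x)) * kern_odd x))"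
proof -
  define r where "r = (1 - Y) / (1 + Y)"
  note r = geometric_disc[OF Y, folded r_def]
  let ?z = "\<lambda>v. of_real r * cis (- v)"
  let ?f = "\<lambda>v. complex_of_real (f v) * (?z v / (1 - ?z v)\<^sup>2)"
  have fi: "set_integrable lborel {-pi..pi} f" by (rule set_integrable_circle_continuous[OF f])
  have fc: "continuous_on UNIV ?f" using r(4) by (intro continuous_intros f) auto
  have sm: "summable (\<lambda>n. norm (of_nat n * complex_of_real r ^ n))"
    using Koebe_sums[of r] r(1,2) by (simp add: norm_mult norm_power sums_iff)
  have k: "(\<Sum>n. (of_nat n * of_real r ^ n) * cis (- (of_int (int n) * v))) = ?z v / (1 - ?z v)\<^sup>2" for v
  proof -
    have "(of_nat n * of_real r ^ n) * cis (- (of_int (int n) * v)) = of_nat n * ?z v ^ n" for n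
      by (simp add: power_mult_distrib Complex.DeMoivre)
    hence "(\<lambda>n. (of_nat n * of_real r ^ n) * cis (- (of_int (int n) * v))) = (\<lambda>n. of_nat n * ?z v ^ n)" by (rule ext)
    hence "(\<Sum>n. (of_nat n * of_real r ^ n) * cis (- (of_int (int n) * v))) = (\<Sum>n. of_nat n * ?z v ^ n)"
      by (rule arg_cong)
    also have "\<dots> = ?z v / (1 - ?z v)\<^sup>2"
      by (rule sums_unique[OF Koebe_sums[OF r(3)[of "- v"]], symmetric])
    finally show ?thesis .
  qed
  have int: "integrable lborel (\<lambda>x. (2 * Y / (1 + (Y * x)\<^sup>2)) *\<^sub>R ?f (2 * arctan (Y * x)))"
    by (rule circle_integrable_imp_line_integrable[OF fc Y(1)])
  have pt: "(2 * Y / (1 + (Y * x)\<^sup>2)) *\<^sub>R ?f (2 * arctan (Y * x))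
      = of_real ((1 - Y\<^sup>2) / (2 * Y)) * Complex (f (2 * arctan (Y * x)) * kern x) (f (2 * arctan (Y * x)) * kern_odd x)" for x
  proof -
    define t where "t = Y * x"
    have z: "?z (2 * arctan t) / (1 - ?z (2 * arctan t))\<^sup>2 = of_real ((1 - Y\<^sup>2) * (1 + t\<^sup>2) / 4) / (of_real Y + \<i> * of_real t)\<^sup>2"
      unfolding r_def by (rule cayley_disc(2)[OF Y(1)])
    have s: "of_real Y + \<i> * of_real t = of_real Y * (1 + \<i> * of_real x)" by (simp add: t_def algebra_simps)
    have inv: "1 / (1 + \<i> * of_real x)\<^sup>2 = Complex (kern x) (kern_odd x)"
    proof -
      have n: "1 + \<i> * of_real x \<noteq> (0::complex)" by (auto simp: complex_eq_iff)
      have "Complex (kern x) (kern_odd x) * (1 + \<i> * of_real x)\<^sup>2 = 1"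
      proof -
        have "Complex (kern x) (kern_odd x) = of_real (1 / (1 + x\<^sup>2)\<^sup>2) * (1 - \<i> * of_real x)\<^sup>2"
          by (simp add: complex_eq_iff kern_def kern_odd_def power2_eq_square)
        moreover have "((1 - \<i> * of_real x) * (1 + \<i> * of_real x)) = complex_of_real (1 + x\<^sup>2)"
          by (simp add: complex_eq_iff power2_eq_square)
        ultimately have "Complex (kern x) (kern_odd x) * (1 + \<i> * of_real x)\<^sup>2 = of_real (1 / (1 + x\<^sup>2)\<^sup>2) * of_real ((1 + x\<^sup>2)\<^sup>2)"
          by (simp only: mult.assoc power_mult_distrib[symmetric] of_real_power)
        thus ?thesis using one_plus_square_pos(2)[of x] by (simp flip: of_real_mult of_real_power of_real_add)
      qed
      thus ?thesis using n by (simp add: field_simps)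
    qed
    have K: "?z (2 * arctan t) / (1 - ?z (2 * arctan t))\<^sup>2 = of_real ((1 - Y\<^sup>2) * (1 + t\<^sup>2) / (4 * Y\<^sup>2)) * Complex (kern x) (kern_odd x)"
      unfolding z s inv[symmetric] by (simp add: power_mult_distrib)
    have "(2 * Y / (1 + t\<^sup>2)) *\<^sub>R ?f (2 * arctan t)
        = of_real (2 * Y / (1 + t\<^sup>2) * f (2 * arctan t) * ((1 - Y\<^sup>2) * (1 + t\<^sup>2) / (4 * Y\<^sup>2))) * Complex (kern x) (kern_odd x)"
      unfolding K by (simp only: scaleR_conv_of_real of_real_mult mult.assoc)
    also have "2 * Y / (1 + t\<^sup>2) * f (2 * arctan t) * ((1 - Y\<^sup>2) * (1 + t\<^sup>2) / (4 * Y\<^sup>2)) = (1 - Y\<^sup>2) / (2 * Y) * f (2 * arctan t)"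
      using Y one_plus_square_pos(2)[of t] by (simp add: divide_simps power2_eq_square)
    finally show ?thesis unfolding t_def[symmetric] by (simp add: complex_eq_iff)
  qed
  have "(\<lambda>n. (of_nat n * of_real r ^ n) * fourier_coeff f (int n)) sums
      ((LINT v:{-pi..pi}|lborel. ?f v) / complex_of_real (2 * pi))"
    unfolding k[symmetric] by (rule fourier_coeff_series_sums[OF fi sm])
  also have "(LINT v:{-pi..pi}|lborel. ?f v) = (LINT x|lborel. of_real ((1 - Y\<^sup>2) / (2 * Y)) * Complex (f (2 * arctan (Y * x)) * kern x) (f (2 * arctan (Y * x)) * kern_odd x))"
    unfolding pt[symmetric] by (rule circle_integral_eq_line_integral[OF fc Y(1)])
  also have "\<dots> = of_real ((1 - Y\<^sup>2) / (2 * Y)) * (LINT x|lborel. Complex (f (2 * arctan (Y * x)) * kern x) (f (2 * arctan (Y * x)) * kern_odd x))"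
    by (rule integral_mult_right_zero)
  also have "(LINT x|lborel. Complex (f (2 * arctan (Y * x)) * kern x) (f (2 * arctan (Y * x)) * kern_odd x))
      = Complex (LINT x|lborel. f (2 * arctan (Y * x)) * kern x) (LINT x|lborel. f (2 * arctan (Y * x)) * kern_odd x)"
  proof -
    have "(1 - Y\<^sup>2) / (2 * Y) \<noteq> 0" using Y by (simp add: power2_eq_1_iff)
    hence "of_real ((2 * Y) / (1 - Y\<^sup>2)) * (of_real ((1 - Y\<^sup>2) / (2 * Y)) * w) = w" for w :: complex
      by (simp only: mult.assoc[symmetric] of_real_mult[symmetric]) simp
    with integrable_mult_right[OF int[unfolded pt], of "of_real ((2 * Y) / (1 - Y\<^sup>2))"]
    have "integrable lborel (\<lambda>x. Complex (f (2 * arctan (Y * x)) * kern x) (f (2 * arctan (Y * x)) * kern_odd x))"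
      by (simp only:)
    from integral_Re[OF this] integral_Im[OF this] show ?thesis by (simp add: complex_eq_iff)
  qed
  finally show ?thesis by (simp add: r_def mult_ac)
qed

section \<open>The product identity for the Fourier coefficients\<close>

lemma summable_on_single: "(\<lambda>x. if x = c then z else (0 :: 'a :: {comm_monoid_add, topological_space})) summable_on UNIV"
  using has_sum_finite_neutralI[of "{c}" UNIV "\<lambda>x. if x = c then z else 0" z]
  by (auto intro: has_sum_imp_summable)

lemma
  fixes f g :: "'a \<Rightarrow> complex"
  assumes "f summable_on A" "g summable_on A"
  shows summable_on_diff_complex: "(\<lambda>x. f x - g x) summable_on A"
    and infsum_diff_complex: "(\<Sum>\<^sub>\<infinity>x\<in>A. f x - g x) = infsum f A - infsum g A"
  using infsum_add[of f A "\<lambda>x. - g x"] summable_on_add[of f A "\<lambda>x. - g x"] assms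
  by (simp_all add: infsum_uminus summable_on_uminus)

lemma summable_on_inverse_int_squares: "(\<lambda>m::int. 1 / (real_of_int m)\<^sup>2) summable_on UNIV"
proof -
  have "(\<lambda>n::nat. 1 / (real n)\<^sup>2) summable_on UNIV"
    using inverse_power_summable[of 2, where 'a = real]
    by (intro norm_summable_imp_summable_on) (simp add: inverse_eq_divide)
  hence "((\<lambda>m::int. 1 / (real_of_int m)\<^sup>2) \<circ> int) summable_on UNIV"
    "((\<lambda>m::int. 1 / (real_of_int m)\<^sup>2) \<circ> (\<lambda>n. - int n)) summable_on UNIV" by (simp_all add: o_def)
  moreover have "inj int" "inj (\<lambda>n. - int n)" by (simp_all add: inj_on_def)
  ultimately have "(\<lambda>m::int. 1 / (real_of_int m)\<^sup>2) summable_on range int"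
    "(\<lambda>m::int. 1 / (real_of_int m)\<^sup>2) summable_on range (\<lambda>n. - int n)"
    using summable_on_reindex by blast+
  hence "(\<lambda>m::int. 1 / (real_of_int m)\<^sup>2) summable_on (range int \<union> range (\<lambda>n. - int n))"
    by (rule summable_on_union)
  also have "range int \<union> range (\<lambda>n. - int n) = UNIV"
  proof (intro equalityI subsetI UNIV_I)
    fix m :: int
    show "m \<in> range int \<union> range (\<lambda>n. - int n)" by (cases m rule: int_cases2) auto
  qed
  finally show ?thesis .
qed

text \<open>
  \<open>2 \<bar>a\<^sub>n\<bar> \<le> 1 / n\<^sup>2 + n\<^sup>2 \<bar>a\<^sub>n\<bar>\<^sup>2\<close> for \<open>n \<noteq> 0\<close>.
\<close>

lemma summable_on_coeffs_of_square_summable_derivative: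
  fixes a :: "int \<Rightarrow> complex"
  assumes "(\<lambda>n. (of_int n)\<^sup>2 * (cmod (a n))\<^sup>2) summable_on UNIV"
  shows "(\<lambda>n. norm (a n)) summable_on UNIV"
proof (rule summable_on_comparison_test)
  let ?f = "\<lambda>n. (1 / (real_of_int n)\<^sup>2 + (of_int n)\<^sup>2 * (cmod (a n))\<^sup>2) + (if n = 0 then norm (a 0) else 0)"
  have "(\<lambda>n::int. if n = 0 then norm (a 0) else 0) summable_on UNIV"
    by (rule summable_on_single)
  thus "?f summable_on UNIV"
    by (intro summable_on_add summable_on_inverse_int_squares assms)
  show "norm (a n) \<le> ?f n" for n
  proof (cases "n = 0")
    case False
    have "0 \<le> (1 / \<bar>of_int n\<bar> - \<bar>of_int n\<bar> * cmod (a n))\<^sup>2" by simp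
    also have "\<dots> = 1 / (real_of_int n)\<^sup>2 + (of_int n)\<^sup>2 * (cmod (a n))\<^sup>2 - 2 * cmod (a n)"
      using False by (simp add: power2_diff power_mult_distrib power_divide)
    finally have "norm (a n) \<le> 1 / (real_of_int n)\<^sup>2 + (of_int n)\<^sup>2 * (cmod (a n))\<^sup>2"
      using norm_ge_zero[of "a n"] by linarith
    thus ?thesis using False by simp
  qed simp
qed auto

text \<open>
  Each double sum is a product of two sums after an injective change of the index pair.
\<close>

lemma summable_on_shifted_product:
  fixes u :: "nat \<Rightarrow> real" and v :: "int \<Rightarrow> real"
  assumes u: "u summable_on UNIV" "\<And>p. u p \<ge> 0" and v: "v summable_on UNIV" "\<And>m. v m \<ge> 0"
  shows "(\<lambda>(p, q). u p * v (c + int p - int q)) summable_on UNIV"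
    and "(\<lambda>(p, q). u q * v (c + int p - int q)) summable_on UNIV"
proof -
  have s: "(\<lambda>(p, m). u p * v m) summable_on (UNIV \<times> UNIV)"
  proof (rule summable_on_SigmaI[where g = "\<lambda>p. u p * infsum v UNIV"])
    show "((\<lambda>y. case (p, y) of (p, m) \<Rightarrow> u p * v m) has_sum u p * infsum v UNIV) UNIV" for p
      using v by (auto intro!: has_sum_cmult_right has_sum_infsum)
    show "(\<lambda>p. u p * infsum v UNIV) summable_on UNIV" using u by (intro summable_on_cmult_left)
  qed (use u v in auto)
  have "((\<lambda>(p, m). u p * v m) \<circ> (\<lambda>(p, q). (p, c + int p - int q))) summable_on UNIV"
    by (subst summable_on_reindex[symmetric]) (auto simp: inj_on_def intro: summable_on_subset_banach[OF s])
  thus "(\<lambda>(p, q). u p * v (c + int p - int q)) summable_on UNIV" by (simp add: o_def case_prod_unfold)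
  have "((\<lambda>(p, m). u p * v m) \<circ> (\<lambda>(p, q). (q, c + int p - int q))) summable_on UNIV"
    by (subst summable_on_reindex[symmetric]) (auto simp: inj_on_def intro: summable_on_subset_banach[OF s])
  thus "(\<lambda>(p, q). u q * v (c + int p - int q)) summable_on UNIV" by (simp add: o_def case_prod_unfold)
qed

text \<open>
  The coefficients of positive index of the power series \<open>G H\<close> vanish. Let \<open>g\<close> be the coefficients of
  \<open>G\<close>. The hypotheses give that \<open>h j = \<Sum> cnj (g q) a (j + q)\<close>, the Fourier coefficients of
  \<open>\<zeta> cnj G\<close> on the circle, are those of \<open>H\<close>; in particular they vanish for \<open>j < 0\<close>. So the
  \<open>n\<close>-th coefficient of the product is \<open>\<Sum> g p cnj (g q) a (n - p + q)\<close> over all \<open>p\<close> and \<open>q\<close>. Since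
  \<open>\<zeta>\<close> is real, conjugation of this double sum amounts to replacing \<open>n\<close> by \<open>- n\<close>, and for \<open>- n\<close> it is
  \<open>\<Sum> g q h (- n - q) = 0\<close>.
\<close>

lemma bernoulli_coefficient_identity:
  fixes a b :: "int \<Rightarrow> complex" and k :: complex
  assumes herm: "\<And>n. a (- n) = cnj (a n)"
    and l2: "(\<lambda>n. (of_int n)\<^sup>2 * (cmod (a n))\<^sup>2) summable_on UNIV"
    and b: "\<And>j. b j = (\<Sum>\<^sub>\<infinity>m. a m * a (j - m))"
    and eq: "\<And>j. (\<Sum>\<^sub>\<infinity>m. a m * (of_int \<bar>j - m\<bar> * a (j - m))) = a j - (if j = 0 then k else 0) - of_int \<bar>j\<bar> / 2 * b j"
    and n: "n > 0"
  shows "(\<Sum>p\<le>n. (if p = 0 then 1 else - 2 * of_nat p * a (int p)) * (if n - p = 0 then k else of_nat (n - p) * b (int (n - p)))) = 0"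
proof -
  have l1: "(\<lambda>m. norm (a m)) summable_on UNIV"
    by (rule summable_on_coeffs_of_square_summable_derivative[OF l2])
  have bij: "bij (\<lambda>m. j - m)" for j :: int
    by (rule bij_betw_byWitness[where f' = "\<lambda>m. j - m"]) auto
  define C where "C = sqrt (\<Sum>\<^sub>\<infinity>n. (of_int n)\<^sup>2 * (cmod (a n))\<^sup>2)"
  have C: "\<bar>of_int m\<bar> * norm (a m) \<le> C" for m
  proof -
    have "(\<Sum>n\<in>{m}. (of_int n)\<^sup>2 * (cmod (a n))\<^sup>2) \<le> (\<Sum>\<^sub>\<infinity>n. (of_int n)\<^sup>2 * (cmod (a n))\<^sup>2)"
      by (rule finite_sum_le_infsum[OF l2]) auto
    hence "(\<bar>of_int m\<bar> * norm (a m))\<^sup>2 \<le> (\<Sum>\<^sub>\<infinity>n. (of_int n)\<^sup>2 * (cmod (a n))\<^sup>2)"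
      by (simp add: power_mult_distrib)
    thus ?thesis unfolding C_def by (rule real_le_rsqrt)
  qed
  have l1j: "(\<lambda>m. norm (a (j - m))) summable_on UNIV" for j
    using l1 summable_on_reindex_bij_betw[OF bij[of j], of "\<lambda>m. norm (a m)"] by simp
  have sW: "(\<lambda>m. w m * (a m * a (j - m))) summable_on UNIV" if w: "\<And>m. norm (w m) \<le> \<bar>of_int m\<bar>" for w :: "int \<Rightarrow> complex" and j
  proof (rule abs_summable_summable, rule summable_on_comparison_test)
    show "(\<lambda>m. C * norm (a (j - m))) summable_on UNIV" by (intro summable_on_cmult_right l1j)
    show "norm (w m * (a m * a (j - m))) \<le> C * norm (a (j - m))" for m
    proof -
      have "norm (w m) * norm (a m) \<le> C" using mult_right_mono[OF w norm_ge_zero] C by (rule order_trans)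
      from mult_right_mono[OF this norm_ge_zero] show ?thesis by (simp add: norm_mult mult.assoc)
    qed
  qed auto
  have sB: "(\<lambda>m. a m * a (j - m)) summable_on UNIV" for j
  proof (rule abs_summable_summable, rule summable_on_comparison_test)
    define A where "A = (\<Sum>\<^sub>\<infinity>m. norm (a m))"
    have A: "norm (a m) \<le> A" for m
      using finite_sum_le_infsum[OF l1, of "{m}"] by (simp add: A_def)
    show "(\<lambda>m. A * norm (a (j - m))) summable_on UNIV" by (intro summable_on_cmult_right l1j)
    show "norm (a m * a (j - m)) \<le> A * norm (a (j - m))" for m
      using A by (simp add: norm_mult mult_right_mono)
  qed auto
  have W: "(\<Sum>\<^sub>\<infinity>m. of_int \<bar>m\<bar> * (a m * a (j - m))) = a j - (if j = 0 then k else 0) - of_int \<bar>j\<bar> / 2 * b j" for j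
    using infsum_reindex_bij_betw[OF bij[of j], of "\<lambda>m. of_int \<bar>m\<bar> * (a m * a (j - m))"] eq[of j]
    by (simp add: mult_ac)
  have V: "(\<Sum>\<^sub>\<infinity>m. of_int m * (a m * a (j - m))) = of_int j / 2 * b j" for j
  proof -
    let ?V = "\<Sum>\<^sub>\<infinity>m. of_int m * (a m * a (j - m))"
    have "?V = (\<Sum>\<^sub>\<infinity>m. of_int (j - m) * (a (j - m) * a (j - (j - m))))"
      by (rule infsum_reindex_bij_betw[OF bij[of j], symmetric])
    also have "\<dots> = (\<Sum>\<^sub>\<infinity>m. of_int j * (a m * a (j - m)) - of_int m * (a m * a (j - m)))"
      by (intro infsum_cong) (simp add: algebra_simps)
    also have "\<dots> = of_int j * b j - ?V"
      unfolding b using infsum_diff_complex[OF summable_on_cmult_right[OF sB[of j], of "of_int j"] sW[of of_int j]]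
      by (simp add: infsum_cmult_right')
    finally show ?thesis by (simp add: mult.commute)
  qed
  define g where "g = (\<lambda>p::nat. if p = 0 then 1 else - 2 * of_nat p * a (int p))"
  define h where "h = (\<lambda>j. \<Sum>\<^sub>\<infinity>q::nat. cnj (g q) * a (j + int q))"
  have cg: "cnj (g q) = (if q = 0 then 1 else 0) - 2 * of_nat q * a (- int q)" for q
    by (simp add: g_def herm)
  have h: "h j = (if j = 0 then k else 0) + of_int (\<bar>j\<bar> + j) / 2 * b j" for j
  proof -
    let ?t = "\<lambda>m. of_int (\<bar>m\<bar> - m) * (a m * a (j - m))"
    have tsplit: "?t m = of_int \<bar>m\<bar> * (a m * a (j - m)) - of_int m * (a m * a (j - m))" for m
      by (simp add: algebra_simps)
    have ts: "?t summable_on UNIV"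
      unfolding tsplit by (intro summable_on_diff_complex sW) auto
    have 1: "infsum ?t UNIV = (\<Sum>\<^sub>\<infinity>m. of_int \<bar>m\<bar> * (a m * a (j - m))) - (\<Sum>\<^sub>\<infinity>m. of_int m * (a m * a (j - m)))"
      unfolding tsplit by (intro infsum_diff_complex sW) auto
    have 2: "infsum ?t UNIV = infsum ?t (range (\<lambda>q. - int q))"
    proof (rule infsum_cong_neutral)
      fix m assume "m \<in> UNIV - range (\<lambda>q. - int q)"
      hence "m > 0" by (cases m rule: int_cases2) auto
      thus "?t m = 0" by simp
    qed auto
    also have "\<dots> = (\<Sum>\<^sub>\<infinity>q::nat. 2 * of_nat q * a (- int q) * a (j + int q))"
      by (subst infsum_reindex) (auto simp: inj_on_def o_def mult.assoc)
    finally have 2: "infsum ?t UNIV = (\<Sum>\<^sub>\<infinity>q::nat. 2 * of_nat q * a (- int q) * a (j + int q))" .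
    have s2: "(\<lambda>q::nat. 2 * of_nat q * a (- int q) * a (j + int q)) summable_on UNIV"
    proof -
      have "?t summable_on (range (\<lambda>q. - int q))" by (rule summable_on_subset_banach[OF ts]) auto
      thus ?thesis by (subst (asm) summable_on_reindex) (auto simp: inj_on_def o_def mult.assoc)
    qed
    have 3: "h j = a j - (\<Sum>\<^sub>\<infinity>q::nat. 2 * of_nat q * a (- int q) * a (j + int q))"
    proof -
      have s1: "((\<lambda>q::nat. (if q = 0 then a j else 0)) has_sum a j) UNIV"
        using has_sum_finite_neutralI[of "{0::nat}" UNIV "\<lambda>q. if q = 0 then a j else 0" "a j"] by simp
      have "h j = (\<Sum>\<^sub>\<infinity>q::nat. (if q = 0 then a j else 0) - 2 * of_nat q * a (- int q) * a (j + int q))"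
        unfolding h_def cg by (intro infsum_cong) (simp add: algebra_simps)
      also have "\<dots> = a j - (\<Sum>\<^sub>\<infinity>q::nat. 2 * of_nat q * a (- int q) * a (j + int q))"
        using s1 s2 by (subst infsum_diff_complex) (auto simp: infsumI has_sum_imp_summable)
      finally show ?thesis .
    qed
    show ?thesis unfolding 3 2[symmetric] 1 W V by (simp add: algebra_simps add_divide_distrib)
  qed
  have h_neg: "h j = 0" if "j < 0" for j using that by (simp add: h)
  have g2: "(\<lambda>p. (norm (g p))\<^sup>2) summable_on UNIV"
  proof -
    have "((\<lambda>n. (of_int n)\<^sup>2 * (cmod (a n))\<^sup>2) \<circ> int) summable_on UNIV"
      by (subst summable_on_reindex[symmetric]) (auto intro: summable_on_subset_banach[OF l2])
    hence "(\<lambda>p. 4 * ((of_nat p)\<^sup>2 * (cmod (a (int p)))\<^sup>2)) summable_on UNIV"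
      by (intro summable_on_cmult_right) (simp add: o_def)
    moreover have "(\<lambda>p::nat. if p = 0 then 1 else 0 :: real) summable_on UNIV"
      by (rule summable_on_single)
    ultimately have "(\<lambda>p. (if p = 0 then 1 else 0) + 4 * ((of_nat p)\<^sup>2 * (cmod (a (int p)))\<^sup>2)) summable_on UNIV"
      by (intro summable_on_add)
    also have "(\<lambda>p. (if p = 0 then 1 else 0) + 4 * ((of_nat p)\<^sup>2 * (cmod (a (int p)))\<^sup>2)) = (\<lambda>p. (norm (g p))\<^sup>2)"
      by (auto simp: g_def norm_mult power_mult_distrib fun_eq_iff)
    finally show ?thesis .
  qed
  have fub: "(\<lambda>(p, q). cnj (g p) * (g q * a (c + int p - int q))) summable_on UNIV \<times> UNIV" for c
  proof (rule abs_summable_summable, rule summable_on_comparison_test)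
    let ?w = "\<lambda>x. (1 / 2) * ((case x of (p, q) \<Rightarrow> (norm (g p))\<^sup>2 * norm (a (c + int p - int q)))
                         + (case x of (p, q) \<Rightarrow> (norm (g q))\<^sup>2 * norm (a (c + int p - int q))))"
    show "?w summable_on UNIV \<times> UNIV"
      unfolding UNIV_Times_UNIV
      by (intro summable_on_cmult_right summable_on_add summable_on_shifted_product(1)[where u = "\<lambda>p. (norm (g p))\<^sup>2" and v = "\<lambda>m. norm (a m)"]
            summable_on_shifted_product(2)[where u = "\<lambda>p. (norm (g p))\<^sup>2" and v = "\<lambda>m. norm (a m)"] g2 l1) auto
    show "norm (case x of (p, q) \<Rightarrow> cnj (g p) * (g q * a (c + int p - int q))) \<le> ?w x" for x
    proof (cases x)
      case (Pair p q)
      have "0 \<le> (norm (g p) - norm (g q))\<^sup>2" by simp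
      hence "norm (g p) * norm (g q) \<le> 1 / 2 * ((norm (g p))\<^sup>2 + (norm (g q))\<^sup>2)"
        by (simp add: power2_diff)
      from mult_right_mono[OF this norm_ge_zero[of "a (c + int p - int q)"]] show ?thesis
        by (simp add: Pair norm_mult algebra_simps)
    qed
  qed auto
  let ?S = "\<Sum>p\<le>n. (if p = 0 then 1 else - 2 * of_nat p * a (int p)) * (if n - p = 0 then k else of_nat (n - p) * b (int (n - p)))"
  have "?S = (\<Sum>p\<le>n. g p * h (int n - int p))"
    by (intro sum.cong) (auto simp: g_def h of_nat_diff)
  also have "\<dots> = (\<Sum>\<^sub>\<infinity>p. g p * h (int n - int p))"
  proof -
    have "(\<Sum>\<^sub>\<infinity>p. g p * h (int n - int p)) = (\<Sum>\<^sub>\<infinity>p\<in>{..n}. g p * h (int n - int p))"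
      by (rule infsum_cong_neutral) (auto simp: h_neg)
    thus ?thesis by simp
  qed
  also have "cnj \<dots> = (\<Sum>\<^sub>\<infinity>p. \<Sum>\<^sub>\<infinity>q. cnj (g p) * (g q * a (- int n + int p - int q)))"
  proof -
    have "cnj (g p * h (int n - int p)) = (\<Sum>\<^sub>\<infinity>q. cnj (g p) * (g q * a (- int n + int p - int q)))" for p
    proof -
      have "cnj (a (int n - int p + int q)) = a (- int n + int p - int q)" for q
        by (simp add: herm[symmetric] algebra_simps)
      thus ?thesis unfolding h_def by (simp add: infsum_cnj[symmetric] infsum_cmult_right'[symmetric] del: infsum_cnj)
    qed
    thus ?thesis by (simp add: infsum_cnj[symmetric] del: infsum_cnj)
  qed
  also have "\<dots> = (\<Sum>\<^sub>\<infinity>q. \<Sum>\<^sub>\<infinity>p. cnj (g p) * (g q * a (- int n + int p - int q)))"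
    by (rule infsum_swap_banach[OF fub])
  also have "\<dots> = (\<Sum>\<^sub>\<infinity>q. g q * h (- int n - int q))"
    unfolding h_def by (intro infsum_cong) (simp add: infsum_cmult_right'[symmetric] algebra_simps)
  also have "\<dots> = 0" using n by (simp add: h_neg)
  finally have "cnj ?S = 0" .
  thus ?thesis by (simp only: complex_cnj_zero_iff)
qed

section \<open>From Babenko's equation to the exponent\<close>

lemma arctan_bounds:
  fixes t :: real
  assumes "t > 0"
  shows "t / (1 + t\<^sup>2) \<le> arctan t" "arctan t \<le> t"
proof -
  have "\<exists>z>0. z < t \<and> arctan t - arctan 0 = (t - 0) * (1 / (1 + z\<^sup>2))"
    using assms by (intro MVT2) (auto intro!: derivative_eq_intros simp: divide_inverse)
  then obtain z where z: "0 < z" "z < t" "arctan t = t * (1 / (1 + z\<^sup>2))" by auto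
  have "1 / (1 + t\<^sup>2) \<le> 1 / (1 + z\<^sup>2)"
    using z by (intro divide_left_mono add_left_mono power_mono mult_pos_pos one_plus_square_pos) auto
  thus "t / (1 + t\<^sup>2) \<le> arctan t" unfolding z(3) using assms mult_left_mono[of _ _ t] by fastforce
  have "1 / (1 + z\<^sup>2) \<le> 1" using one_plus_square_pos[of z] by simp
  thus "arctan t \<le> t" unfolding z(3) using assms mult_left_mono[of "1 / (1 + z\<^sup>2)" 1 t] by simp
qed

text \<open>
  With \<open>q = arctan t / t\<close>, which lies between \<open>1 - t\<^sup>2\<close> and \<open>1\<close>, also \<open>q\<^sup>p\<close> does, for
  \<open>q \<le> q\<^sup>p \<le> 1\<close>.
\<close>

lemma arctan_powr_diff_le:
  fixes t p :: real
  assumes t: "t \<noteq> 0" and p: "0 < p" "p < 1"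
  shows "\<bar>\<bar>2 * arctan t\<bar> powr p - \<bar>2 * t\<bar> powr p\<bar> \<le> \<bar>2 * t\<bar> powr p * t\<^sup>2"
proof -
  define x where "x = \<bar>t\<bar>"
  have x: "x > 0" using t by (simp add: x_def)
  have ax: "\<bar>arctan t\<bar> = arctan x"
    by (cases "t \<ge> 0") (auto simp: x_def abs_of_neg abs_of_nonneg arctan_minus arctan_less_zero_iff)
  define q where "q = arctan x / x"
  have "q \<ge> 1 / (1 + x\<^sup>2)" using arctan_bounds(1)[OF x] x by (simp add: q_def field_simps)
  moreover have "1 / (1 + x\<^sup>2) \<ge> 1 - x\<^sup>2"
    using one_plus_square_pos[of x] by (simp add: field_simps)
  ultimately have q1: "q \<ge> 1 - x\<^sup>2" by simp
  have q: "0 < q" "q \<le> 1" using arctan_bounds(2)[OF x] x by (auto simp: q_def)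
  have "q powr 1 \<le> q powr p" using q p by (intro powr_mono') auto
  moreover have "q powr p \<le> 1" using q p by (intro powr_le1) auto
  ultimately have d: "\<bar>q powr p - 1\<bar> \<le> x\<^sup>2" using q q1 by simp
  have "\<bar>2 * arctan t\<bar> powr p = (2 * x) powr p * q powr p"
    using x q by (simp add: abs_mult ax powr_mult[symmetric] q_def)
  hence "\<bar>2 * arctan t\<bar> powr p - \<bar>2 * t\<bar> powr p = (2 * x) powr p * (q powr p - 1)"
    by (simp add: abs_mult x_def algebra_simps)
  hence "\<bar>\<bar>2 * arctan t\<bar> powr p - \<bar>2 * t\<bar> powr p\<bar> = (2 * x) powr p * \<bar>q powr p - 1\<bar>"
    by (simp add: abs_mult)
  also have "\<dots> \<le> (2 * x) powr p * x\<^sup>2" by (intro mult_left_mono d) simp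
  finally show ?thesis by (simp add: x_def abs_mult)
qed

text \<open>
  Replacing \<open>u\<close> by \<open>2 arctan t\<close> changes \<open>\<bar>u\<bar>\<^sup>2\<^sup>/\<^sup>3\<close> by a term of order \<open>8/3\<close>, which is beyond the
  precision \<open>\<bar>t\<bar>\<^sup>\<mu>\<close> of the expansion.
\<close>

lemma asymptotics_in_half_angle:
  fixes f :: "real \<Rightarrow> real" and A B \<mu> :: real
  assumes \<mu>: "0 < \<mu>" "\<mu> < 8 / 3"
    and f: "((\<lambda>u. (f u - A * \<bar>u\<bar> powr (2 / 3)) / \<bar>u\<bar> powr \<mu>) \<longlongrightarrow> B) (at 0)"
  shows "((\<lambda>t. (f (2 * arctan t) - (A * 2 powr (2 / 3)) * \<bar>t\<bar> powr (2 / 3)) / \<bar>t\<bar> powr \<mu>) \<longlongrightarrow> B * 2 powr \<mu>) (at 0)"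
proof -
  let ?u = "\<lambda>t::real. 2 * arctan t"
  have ev0: "eventually (\<lambda>t. t \<noteq> 0) (at (0 :: real))"
    by (simp add: eventually_at_filter)
  have "((\<lambda>t. ?u t) \<longlongrightarrow> 2 * arctan 0) (at 0)" by (intro tendsto_intros)
  hence u: "filterlim ?u (at 0) (at 0)"
    by (auto simp: filterlim_at eventually_at_filter)
  have quot: "((\<lambda>t. \<bar>?u t\<bar> / \<bar>t\<bar>) \<longlongrightarrow> 2) (at 0)"
  proof -
    have "(arctan has_real_derivative inverse (1 + 0\<^sup>2)) (at 0)" by (rule DERIV_arctan)
    hence "((\<lambda>t. (arctan t - arctan 0) / (t - 0)) \<longlongrightarrow> 1) (at 0)" by (simp add: has_field_derivative_iff)
    hence "((\<lambda>t. \<bar>2 * ((arctan t - arctan 0) / (t - 0))\<bar>) \<longlongrightarrow> \<bar>2 * 1\<bar>) (at 0)" by (intro tendsto_intros)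
    thus ?thesis by (simp add: abs_mult)
  qed
  have "((\<lambda>t. (f (?u t) - A * \<bar>?u t\<bar> powr (2 / 3)) / \<bar>?u t\<bar> powr \<mu> * (\<bar>?u t\<bar> / \<bar>t\<bar>) powr \<mu>) \<longlongrightarrow> B * 2 powr \<mu>) (at 0)"
    by (intro tendsto_mult filterlim_compose[OF f u] tendsto_powr quot tendsto_const) simp
  hence main: "((\<lambda>t. (f (?u t) - A * \<bar>?u t\<bar> powr (2 / 3)) / \<bar>t\<bar> powr \<mu>) \<longlongrightarrow> B * 2 powr \<mu>) (at 0)"
    by (rule Lim_transform_eventually) (use ev0 in eventually_elim, simp add: powr_divide)
  have rest: "((\<lambda>t. A * (\<bar>?u t\<bar> powr (2 / 3) - \<bar>2 * t\<bar> powr (2 / 3)) / \<bar>t\<bar> powr \<mu>) \<longlongrightarrow> 0) (at 0)"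
  proof (rule Lim_null_comparison)
    show "((\<lambda>t. \<bar>A\<bar> * 2 powr (2 / 3) * \<bar>t\<bar> powr (8 / 3 - \<mu>)) \<longlongrightarrow> 0) (at 0)"
      using tendsto_mult[OF tendsto_const[of "\<bar>A\<bar> * 2 powr (2 / 3)"] tendsto_abs_powr_at_0[of "8 / 3 - \<mu>"]] \<mu> by simp
    show "eventually (\<lambda>t. norm (A * (\<bar>?u t\<bar> powr (2 / 3) - \<bar>2 * t\<bar> powr (2 / 3)) / \<bar>t\<bar> powr \<mu>)
        \<le> \<bar>A\<bar> * 2 powr (2 / 3) * \<bar>t\<bar> powr (8 / 3 - \<mu>)) (at 0)"
      using ev0
    proof eventually_elim
      case (elim t)
      have p: "\<bar>t\<bar> powr (8 / 3 - \<mu>) = \<bar>t\<bar> powr (2 / 3) * t\<^sup>2 / \<bar>t\<bar> powr \<mu>"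
      proof -
        have "\<bar>t\<bar> powr (2 / 3) * t\<^sup>2 = \<bar>t\<bar> powr (2 / 3) * \<bar>t\<bar> powr 2" using elim by simp
        also have "\<dots> = \<bar>t\<bar> powr (8 / 3)" by (simp only: powr_add[symmetric]) simp
        finally show ?thesis by (simp add: powr_diff)
      qed
      have "norm (A * (\<bar>?u t\<bar> powr (2 / 3) - \<bar>2 * t\<bar> powr (2 / 3)) / \<bar>t\<bar> powr \<mu>)
          = \<bar>A\<bar> * \<bar>\<bar>?u t\<bar> powr (2 / 3) - \<bar>2 * t\<bar> powr (2 / 3)\<bar> / \<bar>t\<bar> powr \<mu>"
        by (simp add: abs_mult)
      also have "\<dots> \<le> \<bar>A\<bar> * (\<bar>2 * t\<bar> powr (2 / 3) * t\<^sup>2) / \<bar>t\<bar> powr \<mu>"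
        by (intro divide_right_mono mult_left_mono arctan_powr_diff_le elim) auto
      also have "\<dots> = \<bar>A\<bar> * 2 powr (2 / 3) * \<bar>t\<bar> powr (8 / 3 - \<mu>)"
        unfolding p by (simp add: abs_mult powr_mult)
      finally show ?case .
    qed
  qed
  have "((\<lambda>t. (f (?u t) - A * \<bar>?u t\<bar> powr (2 / 3)) / \<bar>t\<bar> powr \<mu>
      + A * (\<bar>?u t\<bar> powr (2 / 3) - \<bar>2 * t\<bar> powr (2 / 3)) / \<bar>t\<bar> powr \<mu>) \<longlongrightarrow> B * 2 powr \<mu> + 0) (at 0)"
    by (rule tendsto_add[OF main rest])
  thus ?thesis
    by (simp add: add_divide_distrib[symmetric] abs_mult powr_mult algebra_simps)
qed

lemma L2_circle_integrable:
  assumes "f \<in> L2_circle"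
  shows "set_integrable lborel {-pi..pi} f"
proof -
  have m[measurable]: "f \<in> borel_measurable borel" and s: "set_integrable lborel {-pi..pi} (\<lambda>u. (f u)\<^sup>2)"
    using assms by (auto simp: L2_circle_def)
  have one: "set_integrable lborel {-pi..pi} (\<lambda>u. 1 :: real)"
    by (rule borel_integrable_atLeastAtMost') (intro continuous_intros)
  show ?thesis
    unfolding set_integrable_def
  proof (rule Bochner_Integration.integrable_bound)
    show "integrable lborel (\<lambda>u. indicator {-pi..pi} u *\<^sub>R (1 + (f u)\<^sup>2))"
      using set_integral_add(1)[OF one s] by (simp add: set_integrable_def)
    show "AE u in lborel. norm (indicator {-pi..pi} u *\<^sub>R f u) \<le> norm (indicator {-pi..pi} u *\<^sub>R (1 + (f u)\<^sup>2))"
    proof (rule AE_I2)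
      fix u
      have "0 \<le> (\<bar>f u\<bar> - 1)\<^sup>2" by simp
      hence "2 * \<bar>f u\<bar> \<le> 1 + (f u)\<^sup>2" by (simp add: power2_diff)
      hence "\<bar>f u\<bar> \<le> \<bar>1 + (f u)\<^sup>2\<bar>" by simp
      thus "norm (indicator {-pi..pi} u *\<^sub>R f u) \<le> norm (indicator {-pi..pi} u *\<^sub>R (1 + (f u)\<^sup>2))"
        by (simp add: indicator_def)
    qed
  qed measurable
qed

text \<open>
  The hypotheses of \<open>bernoulli_coefficient_identity\<close> for \<open>\<zeta> = k - \<eta>\<close>. The last equation consists of
  the Fourier coefficients of \<open>\<zeta> (K \<zeta>) = \<zeta> - k - K (\<zeta>\<^sup>2) / 2\<close>, in which the product on the
  left becomes a convolution.
\<close>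

lemma babenko_coefficients:
  fixes c :: real and \<eta> :: "real \<Rightarrow> real"
  assumes sol: "babenko_solution c \<eta>" and cont: "continuous_on UNIV \<eta>"
  defines "k \<equiv> c\<^sup>2 / 2"
  defines "\<zeta> \<equiv> \<lambda>u. k - \<eta> u"
  defines "a \<equiv> fourier_coeff \<zeta>" and "b \<equiv> fourier_coeff (\<lambda>u. (\<zeta> u)\<^sup>2)"
  shows "(\<lambda>n. (of_int n)\<^sup>2 * (cmod (a n))\<^sup>2) summable_on UNIV"
    and "b j = (\<Sum>\<^sub>\<infinity>m. a m * a (j - m))"
    and "(\<Sum>\<^sub>\<infinity>m. a m * (of_int \<bar>j - m\<bar> * a (j - m))) = a j - (if j = 0 then of_real k else 0) - of_int \<bar>j\<bar> / 2 * b j"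
proof -
  obtain N K2 where N: "K_maps \<eta> N" and K2: "K_maps (\<lambda>u. (\<eta> u)\<^sup>2) K2"
    and eq: "AE u in lborel. (c\<^sup>2 * N u - \<eta> u) - \<eta> u * N u - 1 / 2 * K2 u = 0"
    using sol unfolding babenko_solution_def by blast
  have \<eta>: "\<eta> \<in> Dom_K" using sol by (simp add: babenko_solution_def)
  have \<zeta>c: "continuous_on UNIV \<zeta>" unfolding \<zeta>_def by (intro continuous_intros cont)
  have \<zeta>p: "\<zeta> (u + 2 * pi) = \<zeta> u" for u
    using \<eta> by (simp add: \<zeta>_def Dom_K_def L2_circle_def)
  have \<zeta>i: "set_integrable lborel {-pi..pi} \<zeta>" by (rule set_integrable_circle_continuous[OF \<zeta>c])
  have \<zeta>2i: "set_integrable lborel {-pi..pi} (\<lambda>u. (\<zeta> u)\<^sup>2)"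
    by (intro set_integrable_circle_continuous continuous_intros \<zeta>c)
  have ci: "set_integrable lborel {-pi..pi} (\<lambda>u. x :: real)" for x
    by (intro set_integrable_circle_continuous continuous_intros)
  have Ni: "set_integrable lborel {-pi..pi} N" and K2i: "set_integrable lborel {-pi..pi} K2"
    using N K2 by (auto simp: K_maps_def intro: L2_circle_integrable)
  have meas[measurable]: "N \<in> borel_measurable borel" "K2 \<in> borel_measurable borel" "\<zeta> \<in> borel_measurable borel"
    using N K2 borel_measurable_continuous_onI[OF \<zeta>c] by (auto simp: K_maps_def L2_circle_def)
  have a_eq: "a n = (if n = 0 then of_real k else 0) - fourier_coeff \<eta> n" for n
    using fourier_coeff_add[OF ci[of k] set_integrable_circle_continuous[of "\<lambda>u. - 1 * \<eta> u"], of n]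
      fourier_coeff_cmult[of "- 1" \<eta> n] fourier_coeff_const[of k n] cont
    by (simp add: a_def \<zeta>_def continuous_intros)
  have Na: "fourier_coeff N n = - (of_int \<bar>n\<bar> * a n)" for n
    using N by (simp add: K_maps_def a_eq)
  have "(\<lambda>n. (of_int n)\<^sup>2 * (cmod (a n))\<^sup>2) = (\<lambda>n. (of_int n)\<^sup>2 * (cmod (fourier_coeff \<eta> n))\<^sup>2)"
    by (rule ext) (simp add: a_eq)
  thus l2: "(\<lambda>n. (of_int n)\<^sup>2 * (cmod (a n))\<^sup>2) summable_on UNIV"
    using \<eta> by (simp only: Dom_K_def mem_Collect_eq)
  have l1: "(\<lambda>m. norm (fourier_coeff \<zeta> m)) summable_on UNIV"
    using summable_on_coeffs_of_square_summable_derivative[OF l2] by (simp add: a_def)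
  have conv: "fourier_coeff (\<lambda>u. \<zeta> u * g u) j = (\<Sum>\<^sub>\<infinity>m. a m * fourier_coeff g (j - m))"
    if "set_integrable lborel {-pi..pi} g" for g
    unfolding a_def by (rule fourier_coeff_mult[OF \<zeta>c \<zeta>p l1 that])
  show "b j = (\<Sum>\<^sub>\<infinity>m. a m * a (j - m))"
    using conv[OF \<zeta>i] by (simp add: a_def b_def power2_eq_square)
  have K2a: "fourier_coeff K2 j = of_int \<bar>j\<bar> * (b j - 2 * of_real k * a j)"
  proof -
    have "fourier_coeff (\<lambda>u. (\<eta> u)\<^sup>2) j = fourier_coeff (\<lambda>u. (k\<^sup>2 + (- 2 * k) * \<zeta> u) + (\<zeta> u)\<^sup>2) j"
      by (simp add: \<zeta>_def algebra_simps power2_eq_square)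
    also have "\<dots> = fourier_coeff (\<lambda>u. k\<^sup>2) j + (- 2 * of_real k) * a j + b j"
    proof -
      have i: "set_integrable lborel {-pi..pi} (\<lambda>u. (- 2 * k) * \<zeta> u)"
        by (intro set_integrable_circle_continuous continuous_intros \<zeta>c)
      have i': "set_integrable lborel {-pi..pi} (\<lambda>u. k\<^sup>2 + (- 2 * k) * \<zeta> u)"
        by (intro set_integrable_circle_continuous continuous_intros \<zeta>c)
      show ?thesis
        unfolding fourier_coeff_add[OF i' \<zeta>2i] fourier_coeff_add[OF ci i] fourier_coeff_cmult
        by (simp add: a_def b_def)
    qed
    finally have *: "fourier_coeff (\<lambda>u. (\<eta> u)\<^sup>2) j = fourier_coeff (\<lambda>u. k\<^sup>2) j + (- 2 * of_real k) * a j + b j" .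
    have "fourier_coeff K2 j = of_int \<bar>j\<bar> * fourier_coeff (\<lambda>u. (\<eta> u)\<^sup>2) j"
      using K2 by (simp add: K_maps_def)
    thus ?thesis unfolding * by (simp add: fourier_coeff_const algebra_simps)
  qed
  have "fourier_coeff (\<lambda>u. \<zeta> u * N u) j = fourier_coeff (\<lambda>u. ((k + (- 1) * \<zeta> u) + (- k) * N u) + (1 / 2) * K2 u) j"
  proof (rule fourier_coeff_cong_AE)
    show "AE u in lborel. \<zeta> u * N u = ((k + (- 1) * \<zeta> u) + (- k) * N u) + (1 / 2) * K2 u"
      using eq by eventually_elim (simp add: \<zeta>_def k_def algebra_simps)
  qed measurable
  also have "\<dots> = (if j = 0 then of_real k else 0) - a j - of_real k * fourier_coeff N j + 1 / 2 * fourier_coeff K2 j"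
  proof -
    have i1: "set_integrable lborel {-pi..pi} (\<lambda>u. (- 1) * \<zeta> u)" and i2: "set_integrable lborel {-pi..pi} (\<lambda>u. (- k) * N u)"
      and i3: "set_integrable lborel {-pi..pi} (\<lambda>u. (1 / 2) * K2 u)"
      by (rule set_integrable_mult_right, rule \<zeta>i Ni K2i)+
    have i12: "set_integrable lborel {-pi..pi} (\<lambda>u. k + (- 1) * \<zeta> u)" by (rule set_integral_add(1)[OF ci i1])
    have i123: "set_integrable lborel {-pi..pi} (\<lambda>u. (k + (- 1) * \<zeta> u) + (- k) * N u)" by (rule set_integral_add(1)[OF i12 i2])
    show ?thesis
      unfolding fourier_coeff_add[OF i123 i3] fourier_coeff_add[OF i12 i2] fourier_coeff_add[OF ci i1] fourier_coeff_cmult fourier_coeff_const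
      by (simp add: a_def)
  qed
  finally have "fourier_coeff (\<lambda>u. \<zeta> u * N u) j = (if j = 0 then of_real k else 0) - a j + of_int \<bar>j\<bar> / 2 * b j"
    unfolding Na K2a by (simp add: algebra_simps)
  moreover have "fourier_coeff (\<lambda>u. \<zeta> u * N u) j = (\<Sum>\<^sub>\<infinity>m. - (a m * (of_int \<bar>j - m\<bar> * a (j - m))))"
    unfolding conv[OF Ni] Na by (simp add: algebra_simps)
  ultimately have "- (\<Sum>\<^sub>\<infinity>m. a m * (of_int \<bar>j - m\<bar> * a (j - m))) = (if j = 0 then of_real k else 0) - a j + of_int \<bar>j\<bar> / 2 * b j"
    by (simp only: infsum_uminus)
  thus "(\<Sum>\<^sub>\<infinity>m. a m * (of_int \<bar>j - m\<bar> * a (j - m))) = a j - (if j = 0 then of_real k else 0) - of_int \<bar>j\<bar> / 2 * b j"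
    by (simp only: minus_equation_iff[of "infsum _ _"]) (simp add: algebra_simps)
qed

text \<open>
  The real part of \<open>G H = k\<close> at the point \<open>(1 - Y) / (1 + Y)\<close>, by the Cauchy product of the two
  power series.
\<close>

lemma babenko_disc_identity:
  fixes c :: real and \<eta> :: "real \<Rightarrow> real" and Y :: real
  assumes sol: "babenko_solution c \<eta>" and cont: "continuous_on UNIV \<eta>" and Y: "0 < Y" "Y < 1"
  defines "k \<equiv> c\<^sup>2 / 2"
  defines "Z \<equiv> \<lambda>t. k - \<eta> (2 * arctan t)"
  shows "(1 - (1 - Y\<^sup>2) / (2 * pi * Y) * (LINT x|lborel. Z (Y * x) * kern x))
         * (k + (1 - Y\<^sup>2) / (4 * pi * Y) * (LINT x|lborel. (Z (Y * x))\<^sup>2 * kern x))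
       + (1 - Y\<^sup>2)\<^sup>2 / (8 * pi\<^sup>2 * Y\<^sup>2) * ((LINT x|lborel. Z (Y * x) * kern_odd x)
         * (LINT x|lborel. (Z (Y * x))\<^sup>2 * kern_odd x)) = k"
proof -
  define \<zeta> where "\<zeta> = (\<lambda>u. k - \<eta> u)"
  define a where "a = fourier_coeff \<zeta>"
  define b where "b = fourier_coeff (\<lambda>u. (\<zeta> u)\<^sup>2)"
  define r where "r = (1 - Y) / (1 + Y)"
  note r = geometric_disc[OF Y, folded r_def]
  have \<zeta>c: "continuous_on UNIV \<zeta>" unfolding \<zeta>_def by (intro continuous_intros cont)
  have \<zeta>2c: "continuous_on UNIV (\<lambda>u. (\<zeta> u)\<^sup>2)" by (intro continuous_intros \<zeta>c)
  note bc = babenko_coefficients[OF sol cont, folded k_def, folded \<zeta>_def, folded a_def b_def]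
  define g h where "g = (\<lambda>n::nat. if n = 0 then 1 else - 2 * of_nat n * a (int n))"
    and "h = (\<lambda>n::nat. if n = 0 then of_real k else of_nat n * b (int n))"
  have S: "(\<Sum>p\<le>n. g p * h (n - p)) = (if n = 0 then of_real k else 0)" for n
  proof (cases "n = 0")
    case False
    have "a (- m) = cnj (a m)" for m by (simp add: a_def fourier_coeff_cnj)
    from bernoulli_coefficient_identity[OF this bc, of n] False show ?thesis
      unfolding g_def h_def b_def \<zeta>_def by simp
  qed (simp add: g_def h_def)
  define I where "I = (\<lambda>f. of_real ((1 - Y\<^sup>2) / (4 * pi * Y)) *
        Complex (LINT x|lborel. f (2 * arctan (Y * x)) * kern x) (LINT x|lborel. f (2 * arctan (Y * x)) * kern_odd x))"
  have sa: "(\<lambda>n. of_nat n * a (int n) * of_real (r ^ n)) sums I \<zeta>"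
    unfolding I_def a_def r_def by (rule disc_derivative_eq_line_integral[OF \<zeta>c Y])
  have sb: "(\<lambda>n. of_nat n * b (int n) * of_real (r ^ n)) sums I (\<lambda>u. (\<zeta> u)\<^sup>2)"
    unfolding I_def b_def r_def by (rule disc_derivative_eq_line_integral[OF \<zeta>2c Y])
  have s1: "(\<lambda>n::nat. if n = 0 then z else 0) sums z" for z :: complex
    using sums_single[of 0 "\<lambda>_. z"] by simp
  have sg: "(\<lambda>n. g n * of_real (r ^ n)) sums (1 - 2 * I \<zeta>)"
  proof -
    have "(\<lambda>n. (if n = 0 then 1 else 0) - 2 * (of_nat n * a (int n) * of_real (r ^ n))) sums (1 - 2 * I \<zeta>)"
      by (intro sums_diff sums_mult s1 sa)
    also have "(\<lambda>n. (if n = 0 then 1 else 0) - 2 * (of_nat n * a (int n) * of_real (r ^ n))) = (\<lambda>n. g n * of_real (r ^ n))"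
      by (auto simp: g_def fun_eq_iff)
    finally show ?thesis .
  qed
  have sh: "(\<lambda>n. h n * of_real (r ^ n)) sums (of_real k + I (\<lambda>u. (\<zeta> u)\<^sup>2))"
  proof -
    have "(\<lambda>n. (if n = 0 then of_real k else 0) + (of_nat n * b (int n) * of_real (r ^ n))) sums (of_real k + I (\<lambda>u. (\<zeta> u)\<^sup>2))"
      by (intro sums_add s1 sb)
    also have "(\<lambda>n. (if n = 0 then of_real k else 0) + (of_nat n * b (int n) * of_real (r ^ n))) = (\<lambda>n. h n * of_real (r ^ n))"
      by (auto simp: h_def fun_eq_iff)
    finally show ?thesis .
  qed
  have summ: "summable (\<lambda>n. norm (w n * of_real (r ^ n)))" if w: "\<And>n. norm (w n) \<le> M * (1 + of_nat n)" for w :: "nat \<Rightarrow> complex" and M :: real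
  proof (rule summable_comparison_test)
    have "summable (\<lambda>n. r ^ n)" "summable (\<lambda>n. of_nat n * r ^ n)"
      using r(1,2) Koebe_sums[of r] by (auto simp: sums_iff summable_geometric)
    hence "summable (\<lambda>n. M * (r ^ n + of_nat n * r ^ n))" by (intro summable_mult summable_add)
    thus "summable (\<lambda>n. M * (1 + of_nat n) * r ^ n)" by (simp add: algebra_simps)
    have "norm (norm (w n * of_real (r ^ n))) \<le> M * (1 + of_nat n) * r ^ n" for n
      using mult_right_mono[OF w[of n], of "r ^ n"] r(1) by (simp add: norm_mult norm_power)
    thus "\<exists>N. \<forall>n\<ge>N. norm (norm (w n * of_real (r ^ n))) \<le> M * (1 + of_nat n) * r ^ n" by blast
  qed
  obtain Ma where Ma: "\<And>n. norm (a n) \<le> Ma"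
    using fourier_coeff_bounded[OF set_integrable_circle_continuous[OF \<zeta>c]] unfolding a_def by blast
  obtain Mb where Mb: "\<And>n. norm (b n) \<le> Mb"
    using fourier_coeff_bounded[OF set_integrable_circle_continuous[OF \<zeta>2c]] unfolding b_def by blast
  have Ma0: "Ma \<ge> 0" and Mb0: "Mb \<ge> 0" using Ma[of 0] Mb[of 0] norm_ge_zero order_trans by blast+
  have summ_g: "summable (\<lambda>n. norm (g n * of_real (r ^ n)))"
  proof (rule summ[of _ "1 + 2 * Ma"])
    fix n show "norm (g n) \<le> (1 + 2 * Ma) * (1 + of_nat n)"
      using mult_left_mono[OF Ma, of "of_nat n" "int n"] Ma0 by (auto simp: g_def norm_mult algebra_simps)
  qed
  have summ_h: "summable (\<lambda>n. norm (h n * of_real (r ^ n)))"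
  proof (rule summ[of _ "\<bar>k\<bar> + Mb"])
    fix n show "norm (h n) \<le> (\<bar>k\<bar> + Mb) * (1 + of_nat n)"
    proof (cases "n = 0")
      case False
      have "real n * norm (b (int n)) \<le> real n * Mb" by (rule mult_left_mono[OF Mb]) simp
      moreover have "0 \<le> real n * \<bar>k\<bar>" by simp
      ultimately have "real n * norm (b (int n)) \<le> (\<bar>k\<bar> + Mb) * (1 + real n)"
        using Mb0 unfolding distrib_left distrib_right mult.commute[of "real n"] mult_1_right by linarith
      thus ?thesis using False by (simp add: h_def norm_mult)
    qed (use Mb0 in \<open>simp add: h_def\<close>)
  qed
  have "(\<lambda>n. \<Sum>p\<le>n. (g p * of_real (r ^ p)) * (h (n - p) * of_real (r ^ (n - p)))) sums
      ((1 - 2 * I \<zeta>) * (of_real k + I (\<lambda>u. (\<zeta> u)\<^sup>2)))"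
    using Cauchy_product_sums[OF summ_g summ_h] sums_unique[OF sg] sums_unique[OF sh] by simp
  also have "(\<lambda>n. \<Sum>p\<le>n. (g p * of_real (r ^ p)) * (h (n - p) * of_real (r ^ (n - p)))) = (\<lambda>n. if n = 0 then of_real k else 0)"
  proof (rule ext)
    fix n
    have "(g p * of_real (r ^ p)) * (h (n - p) * of_real (r ^ (n - p))) = of_real (r ^ n) * (g p * h (n - p))" if "p \<le> n" for p
    proof -
      have "complex_of_real (r ^ n) = of_real (r ^ p) * of_real (r ^ (n - p))"
        using that by (simp add: power_add[symmetric] flip: of_real_mult)
      thus ?thesis by (simp only: mult_ac)
    qed
    hence "(\<Sum>p\<le>n. (g p * of_real (r ^ p)) * (h (n - p) * of_real (r ^ (n - p)))) = of_real (r ^ n) * (\<Sum>p\<le>n. g p * h (n - p))"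
      unfolding sum_distrib_left by (intro sum.cong) auto
    thus "(\<Sum>p\<le>n. (g p * of_real (r ^ p)) * (h (n - p) * of_real (r ^ (n - p)))) = (if n = 0 then of_real k else 0)"
      unfolding S by simp
  qed
  finally have prod: "(1 - 2 * I \<zeta>) * (of_real k + I (\<lambda>u. (\<zeta> u)\<^sup>2)) = of_real k"
    using s1 sums_unique2 by blast
  define R1 O1 R2 O2 where "R1 = (LINT x|lborel. Z (Y * x) * kern x)" and "O1 = (LINT x|lborel. Z (Y * x) * kern_odd x)"
    and "R2 = (LINT x|lborel. (Z (Y * x))\<^sup>2 * kern x)" and "O2 = (LINT x|lborel. (Z (Y * x))\<^sup>2 * kern_odd x)"
  define q where "q = (1 - Y\<^sup>2) / (4 * pi * Y)"
  have I1: "I \<zeta> = Complex (q * R1) (q * O1)" and I2: "I (\<lambda>u. (\<zeta> u)\<^sup>2) = Complex (q * R2) (q * O2)"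
    by (simp_all add: I_def R1_def O1_def R2_def O2_def Z_def \<zeta>_def q_def[symmetric] complex_eq_iff)
  have "Re ((1 - 2 * I \<zeta>) * (of_real k + I (\<lambda>u. (\<zeta> u)\<^sup>2))) = k" unfolding prod by simp
  hence "(1 - 2 * q * R1) * (k + q * R2) + 2 * q\<^sup>2 * (O1 * O2) = k"
    unfolding I1 I2 by (simp add: algebra_simps power2_eq_square)
  moreover have "2 * q = (1 - Y\<^sup>2) / (2 * pi * Y)" "2 * q\<^sup>2 = (1 - Y\<^sup>2)\<^sup>2 / (8 * pi\<^sup>2 * Y\<^sup>2)"
    using Y by (simp_all add: q_def power_divide power_mult_distrib field_simps)
  ultimately show ?thesis
    unfolding R1_def[symmetric] O1_def[symmetric] R2_def[symmetric] O2_def[symmetric] q_def[symmetric] by (simp only:)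
qed

theorem theorem2:
  fixes \<eta> :: "real \<Rightarrow> real" and A B c \<mu> :: real
  assumes "babenko_solution c \<eta>"
    and "continuous_on UNIV \<eta>"
    and "A > 0" and "B \<noteq> 0"
    and "2 / 3 < \<mu>" and "\<mu> < 2"
    and "(\<lambda>u. \<eta> u - (c\<^sup>2 / 2 - A * \<bar>u\<bar> powr (2 / 3) - B * \<bar>u\<bar> powr \<mu>))
           \<in> o[at 0](\<lambda>u. \<bar>u\<bar> powr \<mu>)"
  shows "is_second_root \<mu>"
proof -
  define \<zeta> where "\<zeta> = (\<lambda>u. c\<^sup>2 / 2 - \<eta> u)"
  define Z where "Z = (\<lambda>t. c\<^sup>2 / 2 - \<eta> (2 * arctan t))"
  have \<zeta>c: "continuous_on UNIV \<zeta>" unfolding \<zeta>_def by (intro continuous_intros assms(2))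
  have "((\<lambda>u. B - (\<eta> u - (c\<^sup>2 / 2 - A * \<bar>u\<bar> powr (2 / 3) - B * \<bar>u\<bar> powr \<mu>)) / \<bar>u\<bar> powr \<mu>) \<longlongrightarrow> B - 0) (at 0)"
    by (intro tendsto_diff tendsto_const smalloD_tendsto assms(7))
  hence "((\<lambda>u. (\<zeta> u - A * \<bar>u\<bar> powr (2 / 3)) / \<bar>u\<bar> powr \<mu>) \<longlongrightarrow> B) (at 0)"
    unfolding diff_0_right
    by (rule Lim_transform_eventually)
       (auto simp: eventually_at_filter \<zeta>_def diff_divide_distrib add_divide_distrib)
  from asymptotics_in_half_angle[OF _ _ this]
  have Z: "((\<lambda>t. (Z t - (A * 2 powr (2 / 3)) * \<bar>t\<bar> powr (2 / 3)) / \<bar>t\<bar> powr \<mu>) \<longlongrightarrow> B * 2 powr \<mu>) (at 0)"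
    using assms(5,6) by (simp add: \<zeta>_def Z_def)
  obtain M where M: "\<And>t. \<bar>Z t\<bar> \<le> M"
    using bounded_on_circle[OF \<zeta>c] unfolding \<zeta>_def Z_def by blast
  have "continuous_on UNIV Z"
    unfolding Z_def by (intro continuous_intros continuous_on_compose2[OF assms(2)]) auto
  hence "Z \<in> borel_measurable borel" by (rule borel_measurable_continuous_onI)
  hence "\<mu> \<noteq> 1 \<and> (\<mu> + 2 / 3) * cos (pi * \<mu> / 2) = \<mu> * cos (pi * \<mu> / 2 + pi / 3)"
  proof (rule exponent_condition_of_line_asymptotics[OF _ M _ _ assms(5,6) Z])
    show "A * 2 powr (2 / 3) \<noteq> 0" "B * 2 powr \<mu> \<noteq> 0" using assms(3,4) by simp_all
  qed (unfold Z_def, rule babenko_disc_identity[OF assms(1,2)])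
  thus ?thesis using is_second_rootI assms(5,6) by blast
qed

end
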